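(* Let $D$ be a periodic Dedekind group such that $\pi(D)$ is finite and $D_p$ is of finite rank for every $p\in\pi(D)$. Let $\varphi$ be a power automorphism of $D$, and write $t_p=\exp\varphi_p$ for every $p\in\pi(D)$ such that $D_p$ is abelian. Assume that the following conditions hold for the primes $p \in \pi(D)$: (i) If $D_2$ is non-abelian, $\varphi_2$ is the identity automorphism. (ii) If $p>2$ then $t_p\equiv 1\pmod p$, and if $D_p$ is infinite also $t_p\neq 1$. (iii) If $p=2$ and $D_2$ is infinite, then $t_2\neq 1,-1$. Then the semidirect product $G=\langle g\rangle\ltimes D$, where $g$ is of infinite order and acts on $D$ via $\varphi$, is a locally nilpotent FCI-group. Conversely, every non-periodic locally nilpotent FCI-group $G$ is either abelian or isomorphic to a group $\langle g\rangle\ltimes D$ of the form just described (with $D$ and $\varphi$ satisfying all the hypotheses above, including (i)--(iii)), $D$ being the torsion subgroup of $G$.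
   Context: A group $G$ is an FCI-group if $|C_G(x):\langle x\rangle|<\infty$ for every $x\in G$ such that $\langle x\rangle$ is not normal in $G$. A Dedekind group is a group all of whose subgroups are normal. For a periodic group $D$, $\pi(D)$ is the set of prime divisors of the orders of elements of $D$; when $D$ is also nilpotent (as periodic Dedekind groups are), $D_p$ denotes its unique Sylow $p$-subgroup and, for an automorphism $\varphi$ of $D$, $\varphi_p$ denotes the restriction of $\varphi$ to $D_p$. A power automorphism of a group is an automorphism sending every element $x$ to a power of $x$. For an abelian $p$-group $A$, every power automorphism $\psi$ of $A$ is of the form $a\mapsto a^t$ (for all $a\in A$) for some $p$-adic unit $t\in\mathbb{Z}_p^{\times}$, where $\mathbb{Z}_p$ is the ring of $p$-adic integers; one writes $\exp\psi=t$. The $p$-adic integer $t$ is uniquely determined if $A$ has infinite exponent, and is determined only modulo $p^n$ if $A$ has finite exponent $p^n$. Rank: the rank of an abelian $p$-group $A$ is the dimension over the field with $p$ elements of the subgroup of elements of order at most $p$. In general, a group has finite (Prüfer) rank $r$ if every finitely generated subgroup can be generated by $r$ elements and $r$ is the least such integer (for abelian $p$-groups, finiteness of the two ranks is equivalent). *)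

theory Defs
  imports "HOL-Algebra.Algebra" "HOL-Algebra.Bij"
begin

section \<open>Groups\<close>

definition periodic :: "('a, 'b) monoid_scheme \<Rightarrow> bool" where
  "periodic G \<longleftrightarrow> group G \<and> (\<forall>x\<in>carrier G. \<exists>n::nat. n > 0 \<and> x [^]\<^bsub>G\<^esub> n = \<one>\<^bsub>G\<^esub>)"

definition torsion_elements :: "('a, 'b) monoid_scheme \<Rightarrow> 'a set" where
  "torsion_elements G = {x \<in> carrier G. \<exists>n::nat. n > 0 \<and> x [^]\<^bsub>G\<^esub> n = \<one>\<^bsub>G\<^esub>}"

definition dedekind_group :: "('a, 'b) monoid_scheme \<Rightarrow> bool" where
  "dedekind_group G \<longleftrightarrow> group G \<and> (\<forall>H. subgroup H G \<longrightarrow> H \<lhd> G)"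

definition centralizer :: "('a, 'b) monoid_scheme \<Rightarrow> 'a \<Rightarrow> 'a set" where
  "centralizer G x = {y \<in> carrier G. y \<otimes>\<^bsub>G\<^esub> x = x \<otimes>\<^bsub>G\<^esub> y}"

definition fci_group :: "('a, 'b) monoid_scheme \<Rightarrow> bool" where
  "fci_group G \<longleftrightarrow> group G \<and>
     (\<forall>x\<in>carrier G. \<not> generate G {x} \<lhd> G \<longrightarrow>
        finite (rcosets\<^bsub>G\<lparr>carrier := centralizer G x\<rparr>\<^esub> (generate G {x})))"

primrec lower_central :: "('a, 'b) monoid_scheme \<Rightarrow> nat \<Rightarrow> 'a set" where
  "lower_central G 0 = carrier G"
| "lower_central G (Suc n) =
     generate G {x \<otimes>\<^bsub>G\<^esub> y \<otimes>\<^bsub>G\<^esub> inv\<^bsub>G\<^esub> x \<otimes>\<^bsub>G\<^esub> inv\<^bsub>G\<^esub> y | x y. x \<in> lower_central G n \<and> y \<in> carrier G}"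

definition nilpotent_group :: "('a, 'b) monoid_scheme \<Rightarrow> bool" where
  "nilpotent_group G \<longleftrightarrow> group G \<and> (\<exists>n. lower_central G n = {\<one>\<^bsub>G\<^esub>})"

definition locally_nilpotent_group :: "('a, 'b) monoid_scheme \<Rightarrow> bool" where
  "locally_nilpotent_group G \<longleftrightarrow> group G \<and>
     (\<forall>S. finite S \<and> S \<subseteq> carrier G \<longrightarrow> nilpotent_group (G\<lparr>carrier := generate G S\<rparr>))"

text \<open>Finite Pruefer rank; it is also used for groups that are not abelian.\<close>

definition finite_rank :: "('a, 'b) monoid_scheme \<Rightarrow> bool" where
  "finite_rank G \<longleftrightarrow> (\<exists>r. \<forall>S. finite S \<and> S \<subseteq> carrier G \<longrightarrow>
     (\<exists>T. finite T \<and> T \<subseteq> carrier G \<and> card T \<le> r \<and> generate G T = generate G S))"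

definition prime_divisors :: "('a, 'b) monoid_scheme \<Rightarrow> nat set" where
  "prime_divisors G = {p. Factorial_Ring.prime p \<and> (\<exists>x\<in>carrier G. p dvd group.ord G x)}"

definition p_subgroup :: "nat \<Rightarrow> 'a set \<Rightarrow> ('a, 'b) monoid_scheme \<Rightarrow> bool" where
  "p_subgroup p P G \<longleftrightarrow> subgroup P G \<and> (\<forall>x\<in>P. \<exists>n. group.ord G x = p ^ n)"

text \<open>In a possibly infinite group, a Sylow \<open>p\<close>-subgroup is a maximal \<open>p\<close>-subgroup.\<close>

definition sylow_p_subgroup :: "nat \<Rightarrow> 'a set \<Rightarrow> ('a, 'b) monoid_scheme \<Rightarrow> bool" where
  "sylow_p_subgroup p P G \<longleftrightarrow> p_subgroup p P G \<and>
     (\<forall>Q. p_subgroup p Q G \<and> P \<subseteq> Q \<longrightarrow> Q = P)"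

text \<open>Only meaningful if the Sylow \<open>p\<close>-subgroup is unique, as in a periodic nilpotent group.\<close>

definition sylow_component :: "('a, 'b) monoid_scheme \<Rightarrow> nat \<Rightarrow> ('a, 'b) monoid_scheme" where
  "sylow_component G p = G\<lparr>carrier := (THE P. sylow_p_subgroup p P G)\<rparr>"

definition power_automorphism :: "('a, 'b) monoid_scheme \<Rightarrow> ('a \<Rightarrow> 'a) \<Rightarrow> bool" where
  "power_automorphism G \<phi> \<longleftrightarrow> \<phi> \<in> auto G \<and> (\<forall>x\<in>carrier G. \<exists>k::int. \<phi> x = x [^]\<^bsub>G\<^esub> k)"

text \<open>
  The pair \<open>(m, d)\<close> stands for \<open>g\<^sup>m d\<close>, where \<open>g\<close> acts on \<open>D\<close> by
  \<open>g\<^sup>-\<^sup>1 d g = \<phi> d\<close>, so that \<open>g\<^sup>m d g\<^sup>n e = g\<^sup>m\<^sup>+\<^sup>n (\<phi>\<^sup>n d) e\<close>.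
\<close>

definition cyclic_semidirect :: "('a, 'b) monoid_scheme \<Rightarrow> ('a \<Rightarrow> 'a) \<Rightarrow> (int \<times> 'a) monoid" where
  "cyclic_semidirect D \<phi> =
     \<lparr>carrier = UNIV \<times> carrier D,
      monoid.mult = (\<lambda>(m, d) (n, e). (m + n, (\<phi> [^]\<^bsub>AutoGroup D\<^esub> n) d \<otimes>\<^bsub>D\<^esub> e)),
      one = (0, \<one>\<^bsub>D\<^esub>)\<rparr>"


section \<open>\<open>p\<close>-adic exponents\<close>

text \<open>
  The ring of \<open>p\<close>-adic integers as the inverse limit of the rings \<open>\<int>/p\<^sup>n\<close>: a \<open>p\<close>-adic integer
  is the sequence of its residues modulo \<open>p\<^sup>n\<close>, each taken in \<open>{0..<p\<^sup>n}\<close>, so that equality of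
  \<open>p\<close>-adic integers is equality of sequences.
\<close>

definition padic_ring :: "nat \<Rightarrow> (nat \<Rightarrow> int) ring" where
  "padic_ring p =
     \<lparr>carrier = {t. \<forall>n. t n \<in> {0..<int p ^ n} \<and> t (Suc n) mod int p ^ n = t n},
      monoid.mult = (\<lambda>s t n. (s n * t n) mod int p ^ n),
      one = (\<lambda>n. 1 mod int p ^ n),
      ring.zero = (\<lambda>n. 0),
      ring.add = (\<lambda>s t n. (s n + t n) mod int p ^ n)\<rparr>"

text \<open>
  For an element \<open>a\<close> of order \<open>p\<^sup>n\<close>, the power \<open>a\<^sup>t\<close> is \<open>a\<^sup>k\<close> for any integer \<open>k\<close> congruent
  to \<open>t\<close> modulo \<open>p\<^sup>n\<close>.
\<close>

definition padic_pow :: "('a, 'b) monoid_scheme \<Rightarrow> nat \<Rightarrow> 'a \<Rightarrow> (nat \<Rightarrow> int) \<Rightarrow> 'a" where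
  "padic_pow A p a t = a [^]\<^bsub>A\<^esub> t (multiplicity p (group.ord A a))"

text \<open>
  \<open>is_exponent A p \<psi> t\<close> says that \<open>t\<close> is a possible value of \<open>exp \<psi>\<close>. This is a relation because
  \<open>t\<close> is determined only modulo \<open>p\<^sup>n\<close> if \<open>A\<close> has finite exponent \<open>p\<^sup>n\<close>.
\<close>

definition is_exponent ::
  "('a, 'b) monoid_scheme \<Rightarrow> nat \<Rightarrow> ('a \<Rightarrow> 'a) \<Rightarrow> (nat \<Rightarrow> int) \<Rightarrow> bool" where
  "is_exponent A p \<psi> t \<longleftrightarrow>
     t \<in> Units (padic_ring p) \<and> (\<forall>a\<in>carrier A. \<psi> a = padic_pow A p a t)"

lemma cring_padic_ring:
  assumes "p > 0"
  shows "cring (padic_ring p)"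
proof (rule cringI)
  let ?R = "padic_ring p"
  have pos: "int p ^ n > 0" for n
    using assms by simp
  have red: "(x mod int p ^ Suc n) mod int p ^ n = x mod int p ^ n" for x n
    by (simp add: mod_mod_cancel)
  have lift: "t n = t (Suc n) mod int p ^ n" if "t \<in> carrier ?R" for t n
    using that by (simp add: padic_ring_def)
  have closed: "(\<lambda>n. f n mod int p ^ n) \<in> carrier ?R"
    if "\<And>n. f (Suc n) mod int p ^ n = f n mod int p ^ n" for f
    using that pos red by (simp add: padic_ring_def)
  have add_closed: "x \<oplus>\<^bsub>?R\<^esub> y \<in> carrier ?R"
    if "x \<in> carrier ?R" "y \<in> carrier ?R" for x y
  proof -
    have "(x (Suc n) + y (Suc n)) mod int p ^ n = (x n + y n) mod int p ^ n" for n
      by (subst lift[of _ n, OF that(1)], subst lift[of _ n, OF that(2)]) (simp add: mod_add_eq)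
    from closed[of "\<lambda>n. x n + y n", OF this] show ?thesis
      by (simp add: padic_ring_def)
  qed
  have mult_closed: "x \<otimes>\<^bsub>?R\<^esub> y \<in> carrier ?R"
    if "x \<in> carrier ?R" "y \<in> carrier ?R" for x y
  proof -
    have "(x (Suc n) * y (Suc n)) mod int p ^ n = (x n * y n) mod int p ^ n" for n
      by (subst lift[of _ n, OF that(1)], subst lift[of _ n, OF that(2)]) (simp add: mod_mult_eq)
    from closed[of "\<lambda>n. x n * y n", OF this] show ?thesis
      by (simp add: padic_ring_def)
  qed
  have small: "t n mod int p ^ n = t n" if "t \<in> carrier ?R" for t n
    using that by (simp add: padic_ring_def)
  show "abelian_group ?R"
  proof (rule abelian_groupI)
    fix x assume x: "x \<in> carrier ?R"
    have "(\<lambda>n. (- x n) mod int p ^ n) \<in> carrier ?R"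
      by (rule closed) (subst lift[OF x], simp add: mod_minus_eq)
    moreover have "(\<lambda>n. (- x n) mod int p ^ n) \<oplus>\<^bsub>?R\<^esub> x = \<zero>\<^bsub>?R\<^esub>"
      by (simp add: padic_ring_def mod_simps)
    ultimately show "\<exists>y\<in>carrier ?R. y \<oplus>\<^bsub>?R\<^esub> x = \<zero>\<^bsub>?R\<^esub>"
      by blast
    show "\<zero>\<^bsub>?R\<^esub> \<oplus>\<^bsub>?R\<^esub> x = x"
      using small[OF x] by (simp add: padic_ring_def)
  next
    show "\<zero>\<^bsub>?R\<^esub> \<in> carrier ?R"
      using pos by (simp add: padic_ring_def)
  qed (use add_closed in \<open>auto simp: padic_ring_def mod_simps ac_simps\<close>)
  show "Group.comm_monoid ?R"
  proof (rule comm_monoidI)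
    show "\<one>\<^bsub>?R\<^esub> \<in> carrier ?R"
      using closed[of "\<lambda>n. 1"] by (simp add: padic_ring_def)
    fix x assume x: "x \<in> carrier ?R"
    show "\<one>\<^bsub>?R\<^esub> \<otimes>\<^bsub>?R\<^esub> x = x"
      using small[OF x] by (simp add: padic_ring_def mod_simps)
  qed (use mult_closed in \<open>auto simp: padic_ring_def mod_simps ac_simps\<close>)
  show "(x \<oplus>\<^bsub>?R\<^esub> y) \<otimes>\<^bsub>?R\<^esub> z = x \<otimes>\<^bsub>?R\<^esub> z \<oplus>\<^bsub>?R\<^esub> y \<otimes>\<^bsub>?R\<^esub> z"
    if "x \<in> carrier ?R" "y \<in> carrier ?R" "z \<in> carrier ?R" for x y z
    by (simp add: padic_ring_def mod_simps distrib_right)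
qed


section \<open>The data of the construction\<close>

text \<open>
  The hypotheses on \<open>D\<close> and \<open>\<phi>\<close>, with a choice \<open>t p\<close> of \<open>exp \<phi>\<^sub>p\<close> for every \<open>p\<close> in \<open>\<pi>(D)\<close>
  such that \<open>D\<^sub>p\<close> is abelian. The congruence modulo \<open>p\<close> is divisibility in the ring of
  \<open>p\<close>-adic integers.
\<close>

definition fci_datum ::
  "('a, 'b) monoid_scheme \<Rightarrow> ('a \<Rightarrow> 'a) \<Rightarrow> (nat \<Rightarrow> nat \<Rightarrow> int) \<Rightarrow> bool" where
  "fci_datum D \<phi> t \<longleftrightarrow>
     periodic D \<and> dedekind_group D \<and>
     finite (prime_divisors D) \<and>
     (\<forall>p\<in>prime_divisors D. finite_rank (sylow_component D p)) \<and>
     power_automorphism D \<phi> \<and>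
     (\<forall>p\<in>prime_divisors D. comm_group (sylow_component D p) \<longrightarrow>
        is_exponent (sylow_component D p) p
          (restrict \<phi> (carrier (sylow_component D p))) (t p)) \<and>
     (2 \<in> prime_divisors D \<and> \<not> comm_group (sylow_component D 2) \<longrightarrow>
        (\<forall>x\<in>carrier (sylow_component D 2). \<phi> x = x)) \<and>
     (\<forall>p\<in>prime_divisors D. p > 2 \<longrightarrow>
        ([p] \<cdot>\<^bsub>padic_ring p\<^esub> \<one>\<^bsub>padic_ring p\<^esub>) divides\<^bsub>padic_ring p\<^esub>
          (t p \<ominus>\<^bsub>padic_ring p\<^esub> \<one>\<^bsub>padic_ring p\<^esub>) \<and>
        (infinite (carrier (sylow_component D p)) \<longrightarrow> t p \<noteq> \<one>\<^bsub>padic_ring p\<^esub>)) \<and>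
     (2 \<in> prime_divisors D \<and> infinite (carrier (sylow_component D 2)) \<longrightarrow>
        t 2 \<noteq> \<one>\<^bsub>padic_ring 2\<^esub> \<and> t 2 \<noteq> \<ominus>\<^bsub>padic_ring 2\<^esub> \<one>\<^bsub>padic_ring 2\<^esub>)"

end

(*
  In a Dedekind group the inner automorphisms are power automorphisms, and these commute, so the
  group has class at most 2. Its non-abelian primary components are 2-groups of the form Q C with
  Q = <x, y> quaternion and C = C(Q) of exponent 2; they are finite when the rank is, and all their
  power automorphisms are inner.

  An element g^m d of the semidirect product with m <> 0 has finitely many fixed points in D, since
  p^n | t^m - 1 forces p^n | m (t - 1) (for p = 2 apply this to t^2). Local nilpotency holds because
  elements of prime order are central.

  Conversely, a torsion element commutes with a power of any element of infinite order, so FCI makes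
  every cyclic torsion subgroup normal. The torsion elements thus form a Dedekind group T on which
  conjugation acts by power automorphisms. If G is not abelian, any two elements of infinite order
  have a common nontrivial power; this gives [G, G] <= T. For x of infinite order with <x> not
  normal, C_T(x) is finite. Counting orbits of T on the conjugates of x then gives an exponent N
  with y^N in <x> T for all y, so G/T is infinite cyclic. Elements of prime order lie in C_T(x),
  which bounds the primes and the ranks. A generator g of G modulo T is corrected by an element of
  the non-abelian 2-component; an exponent 1 or -1 on an infinite component would make C_T(x)
  infinite for a suitable x.
*)
theory Submission
  imports Defs
begin

section \<open>Groups with commutators and powers\<close>

text \<open>Local nilpotency enters mainly through one computation: if g conjugates x to its l-th
  power, then x to the power (l - 1)^n is 1 for some n. So l = 1 when x has infinite order, and l is
  1 modulo p when x has order p. This is the source of the centrality of elements of prime order and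
  of the congruence for the exponents.

  The obstacle in the converse is that FCI compares only commuting elements, while two elements x, y
  of infinite order need not commute. They are linked by a third one: take w of infinite order in
  the last term of the lower central series of <x, y> that is not inside T. All commutators of w
  with <x, y> are torsion, so some power of w commutes with both. Commutators are likewise bilinear
  only modulo the next term of such a series, and claims about them are proved by moving along it.

  G need not be finitely generated, so exponents must be uniform in the element: they are factorials
  of an index |C(x) : <x>| or of |C_T(x)|, because the pigeonhole principle gives an exponent below
  that bound which varies with the element.\<close>

abbreviation commutator :: "('a, 'b) monoid_scheme \<Rightarrow> 'a \<Rightarrow> 'a \<Rightarrow> 'a" where
  "commutator G x y \<equiv> x \<otimes>\<^bsub>G\<^esub> y \<otimes>\<^bsub>G\<^esub> inv\<^bsub>G\<^esub> x \<otimes>\<^bsub>G\<^esub> inv\<^bsub>G\<^esub> y"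

text \<open>Normality of the cyclic subgroup in terms of elements, so that conjugation becomes
  arithmetic of exponents. Containment of each conjugate in <x> suffices, since the inverse of g is
  tested as well.\<close>

definition normal_cyc :: "('a, 'b) monoid_scheme \<Rightarrow> 'a \<Rightarrow> bool" where
  "normal_cyc G x \<longleftrightarrow>
     x \<in> carrier G \<and> (\<forall>g\<in>carrier G. \<exists>k::int. g \<otimes>\<^bsub>G\<^esub> x \<otimes>\<^bsub>G\<^esub> inv\<^bsub>G\<^esub> g = x [^]\<^bsub>G\<^esub> k)"

context group begin

lemma inv_cancel_left:
  assumes "x \<in> carrier G" "y \<in> carrier G"
  shows "inv x \<otimes> (x \<otimes> y) = y" "x \<otimes> (inv x \<otimes> y) = y"
  using assms by (simp_all flip: m_assoc)

lemmas grp_simps = m_assoc inv_mult_group inv_cancel_left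

lemma commute_iff_commutator:
  assumes "x \<in> carrier G" "y \<in> carrier G"
  shows "x \<otimes> y = y \<otimes> x \<longleftrightarrow> commutator G x y = \<one>"
proof -
  have "commutator G x y = (x \<otimes> y) \<otimes> inv (y \<otimes> x)"
    using assms by (simp add: grp_simps)
  then show ?thesis
    using assms by (metis inv_closed inv_equality inv_inv m_closed r_inv)
qed

lemma conj_mult:
  assumes "g \<in> carrier G" "x \<in> carrier G" "y \<in> carrier G"
  shows "g \<otimes> (x \<otimes> y) \<otimes> inv g = (g \<otimes> x \<otimes> inv g) \<otimes> (g \<otimes> y \<otimes> inv g)"
  using assms by (simp add: grp_simps)

lemma conj_hom:
  assumes "g \<in> carrier G"
  shows "(\<lambda>x. g \<otimes> x \<otimes> inv g) \<in> hom G G"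
  using assms conj_mult by (simp add: hom_def)

lemma conj_int_pow:
  assumes "g \<in> carrier G" "x \<in> carrier G"
  shows "g \<otimes> (x [^] (k::int)) \<otimes> inv g = (g \<otimes> x \<otimes> inv g) [^] k"
  using hom_int_pow[OF conj_hom[OF assms(1)] assms(2) is_group is_group] .

lemma conj_nat_pow:
  assumes "g \<in> carrier G" "x \<in> carrier G"
  shows "g \<otimes> (x [^] (k::nat)) \<otimes> inv g = (g \<otimes> x \<otimes> inv g) [^] k"
  using conj_int_pow[OF assms, of "int k"] by (simp add: int_pow_int)

lemma conj_eq_iff:
  assumes "g \<in> carrier G" "x \<in> carrier G" "y \<in> carrier G"
  shows "g \<otimes> x \<otimes> inv g = y \<longleftrightarrow> g \<otimes> x = y \<otimes> g"
  using assms by (metis inv_solve_right m_closed)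

lemma commute_int_pow:
  assumes "x \<in> carrier G" "y \<in> carrier G" "x \<otimes> y = y \<otimes> x"
  shows "x [^] (k::int) \<otimes> y = y \<otimes> x [^] k"
proof -
  have "y \<otimes> x \<otimes> inv y = x"
    using assms by (simp add: conj_eq_iff)
  then have "y \<otimes> x [^] k \<otimes> inv y = x [^] k"
    using assms by (simp add: conj_int_pow)
  then show ?thesis
    using assms by (metis conj_eq_iff int_pow_closed)
qed

lemma commute_nat_pow:
  assumes "x \<in> carrier G" "y \<in> carrier G" "x \<otimes> y = y \<otimes> x"
  shows "x [^] (k::nat) \<otimes> y = y \<otimes> x [^] k"
  using commute_int_pow[OF assms, of "int k"] by (simp add: int_pow_int)

lemma commute_inv:
  assumes "x \<in> carrier G" "y \<in> carrier G" "x \<otimes> y = y \<otimes> x"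
  shows "inv x \<otimes> y = y \<otimes> inv x"
  using assms by (metis inv_closed inv_solve_left inv_solve_right m_assoc m_closed)

lemma commute_mult:
  assumes "x \<in> carrier G" "y \<in> carrier G" "z \<in> carrier G" "x \<otimes> z = z \<otimes> x" "y \<otimes> z = z \<otimes> y"
  shows "(x \<otimes> y) \<otimes> z = z \<otimes> (x \<otimes> y)"
  using assms by (metis m_assoc)

text \<open>Here \<open>y x = x y c\<close>, so \<open>c = [y\<inverse>, x\<inverse>]\<close>.\<close>

lemma nat_pow_mult_central:
  assumes "x \<in> carrier G" "y \<in> carrier G" "c \<in> carrier G"
    and yx: "y \<otimes> x = x \<otimes> y \<otimes> c" and cx: "c \<otimes> x = x \<otimes> c" and cy: "c \<otimes> y = y \<otimes> c"
  shows "y [^] (n::nat) \<otimes> x = x \<otimes> y [^] n \<otimes> c [^] n"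
proof (induction n)
  case (Suc n)
  have "y [^] Suc n \<otimes> x = y [^] n \<otimes> (y \<otimes> x)"
    using assms by (simp add: m_assoc)
  also have "\<dots> = y [^] n \<otimes> (x \<otimes> (c \<otimes> y))"
    using assms by (simp add: m_assoc cy)
  also have "\<dots> = y [^] n \<otimes> x \<otimes> (c \<otimes> y)"
    using assms by (simp add: m_assoc)
  also have "\<dots> = x \<otimes> y [^] n \<otimes> (c [^] n \<otimes> c \<otimes> y)"
    using assms Suc.IH by (simp add: m_assoc)
  also have "c [^] n \<otimes> c \<otimes> y = y \<otimes> c [^] Suc n"
    using commute_nat_pow[OF assms(3,2) cy, of "Suc n"] by simp
  finally show ?case
    using assms by (simp add: m_assoc)
qed (use assms in simp)

text \<open>Collecting all x on the left moves a y past an x exactly n(n - 1)/2 times, and each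
  exchange costs one c. The division by 2 is the reason why the prime 2 behaves differently
  later.\<close>

lemma pow_mult_class2:
  assumes "x \<in> carrier G" "y \<in> carrier G" "c \<in> carrier G"
    and yx: "y \<otimes> x = x \<otimes> y \<otimes> c" and cx: "c \<otimes> x = x \<otimes> c" and cy: "c \<otimes> y = y \<otimes> c"
  shows "(x \<otimes> y) [^] (n::nat) = x [^] n \<otimes> y [^] n \<otimes> c [^] (n * (n - 1) div 2)"
proof (induction n)
  case (Suc n)
  have cxy: "c [^] k \<otimes> (x \<otimes> y) = x \<otimes> y \<otimes> c [^] k" for k :: nat
  proof (rule commute_nat_pow)
    show "c \<otimes> (x \<otimes> y) = x \<otimes> y \<otimes> c"
      using commute_mult[OF assms(1,2,3) cx[symmetric] cy[symmetric]] by simp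
  qed (use assms in simp_all)
  have "(x \<otimes> y) [^] Suc n = x [^] n \<otimes> y [^] n \<otimes> (c [^] (n * (n - 1) div 2) \<otimes> (x \<otimes> y))"
    using assms Suc.IH by (simp add: m_assoc)
  also have "\<dots> = x [^] n \<otimes> (y [^] n \<otimes> x) \<otimes> y \<otimes> c [^] (n * (n - 1) div 2)"
    using assms by (simp add: cxy) (simp add: m_assoc)
  also have "\<dots> = x [^] n \<otimes> x \<otimes> y [^] n \<otimes> (c [^] n \<otimes> y) \<otimes> c [^] (n * (n - 1) div 2)"
    using assms by (simp add: nat_pow_mult_central[OF assms]) (simp add: m_assoc)
  also have "\<dots> = x [^] Suc n \<otimes> y [^] Suc n \<otimes> (c [^] n \<otimes> c [^] (n * (n - 1) div 2))"
    using assms by (simp add: commute_nat_pow[OF assms(3,2) cy]) (simp add: m_assoc)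
  also have "c [^] n \<otimes> c [^] (n * (n - 1) div 2) = c [^] (n + n * (n - 1) div 2)"
    using assms by (simp add: nat_pow_mult)
  also have "n + n * (n - 1) div 2 = Suc n * (Suc n - 1) div 2"
    by (cases n) (simp_all add: algebra_simps)
  finally show ?case .
qed (use assms in simp)

lemma commutator_pow_left:
  assumes "x \<in> carrier G" "y \<in> carrier G"
    and "commutator G x y \<otimes> x = x \<otimes> commutator G x y"
    and "commutator G x y \<otimes> y = y \<otimes> commutator G x y"
  shows "commutator G (x [^] (n::nat)) y = commutator G x y [^] n"
proof -
  define c where "c = commutator G x y"
  have c: "c \<in> carrier G" using assms by (simp add: c_def)
  have *: "x \<otimes> y = y \<otimes> x \<otimes> c"
  proof -
    have "x \<otimes> y = c \<otimes> (y \<otimes> x)" using assms(1,2) by (simp add: c_def grp_simps)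
    also have "\<dots> = y \<otimes> x \<otimes> c" using assms c unfolding c_def[symmetric] by (metis m_assoc)
    finally show ?thesis .
  qed
  have "x [^] n \<otimes> y = y \<otimes> x [^] n \<otimes> c [^] n"
    using nat_pow_mult_central[OF assms(2,1) c *] assms by (simp add: c_def)
  also have "\<dots> = c [^] n \<otimes> (y \<otimes> x [^] n)"
    using commute_nat_pow[OF c, of "y \<otimes> x [^] n" n] assms c
    by (metis c_def commute_mult commute_nat_pow m_closed nat_pow_closed)
  finally have "x [^] n \<otimes> y = c [^] n \<otimes> (y \<otimes> x [^] n)" .
  then have "commutator G (x [^] n) y = c [^] n \<otimes> (y \<otimes> x [^] n) \<otimes> inv (x [^] n) \<otimes> inv y"
    by simp
  also have "\<dots> = c [^] n" using assms c by (simp add: grp_simps)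
  finally show ?thesis unfolding c_def .
qed

lemma inv_commutator:
  assumes "x \<in> carrier G" "y \<in> carrier G"
  shows "inv (commutator G x y) = commutator G y x"
  using assms by (simp add: grp_simps)

lemma commutator_pow_right:
  assumes "x \<in> carrier G" "y \<in> carrier G"
    and "commutator G x y \<otimes> x = x \<otimes> commutator G x y"
    and "commutator G x y \<otimes> y = y \<otimes> commutator G x y"
  shows "commutator G x (y [^] (n::nat)) = commutator G x y [^] n"
proof -
  define c where "c = commutator G x y"
  have c: "c \<in> carrier G" "commutator G y x = inv c"
    using assms(1,2) by (simp_all add: c_def inv_commutator)
  have "commutator G (y [^] n) x = commutator G y x [^] n"
    unfolding c(2) using assms c
    by (intro commutator_pow_left[of y x n, unfolded c(2)]) (simp_all add: commute_inv flip: c_def)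
  then have "inv (commutator G (y [^] n) x) = inv (inv c [^] n)"
    by (simp only: c(2))
  also have "\<dots> = c [^] n"
    using c(1) by (simp flip: nat_pow_inv)
  finally show ?thesis
    using assms(1,2) inv_commutator[of "y [^] n" x] by (simp add: c_def)
qed

lemma ord_le_pow_eq_one:
  assumes "x \<in> carrier G" "n > 0" "x [^] (n::nat) = \<one>"
  shows "ord x > 0" "ord x \<le> n"
  using assms pow_eq_id[of x n] by (auto simp: dvd_imp_le intro: Nat.gr0I)

lemma int_pow_mod:
  assumes "x \<in> carrier G" "x [^] (n::nat) = \<one>"
  shows "x [^] (k mod int n) = x [^] k"
proof -
  have "x [^] k = x [^] (int n * (k div int n)) \<otimes> x [^] (k mod int n)"
    using assms by (simp flip: int_pow_mult)
  also have "x [^] (int n * (k div int n)) = (x [^] n) [^] (k div int n)"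
    using assms by (simp add: int_pow_int flip: int_pow_pow)
  finally show ?thesis using assms by simp
qed

lemma int_pow_cong:
  assumes "x \<in> carrier G" "x [^] (n::nat) = \<one>" "k mod int n = l mod int n"
  shows "x [^] k = x [^] l"
  using assms int_pow_mod by metis

lemma int_pow_nat_ex:
  assumes "x \<in> carrier G" "n > 0" "x [^] (n::nat) = \<one>"
  shows "\<exists>l<n. x [^] (k::int) = x [^] (l::nat)"
proof (intro exI conjI)
  show "nat (k mod int n) < n" using assms by (simp add: nat_less_iff)
  show "x [^] k = x [^] nat (k mod int n)"
    using int_pow_mod[OF assms(1,3), of k] assms(2) by (simp flip: int_pow_int)
qed

lemma pow_gcd_eq_one:
  assumes "x \<in> carrier G" "x [^] (a::nat) = \<one>" "x [^] (b::nat) = \<one>"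
  shows "x [^] gcd a b = \<one>"
  using assms by (simp add: pow_eq_id)

lemma generate_singleton_iff:
  assumes "x \<in> carrier G"
  shows "y \<in> generate G {x} \<longleftrightarrow> (\<exists>k::int. y = x [^] k)"
  using assms by (auto simp: generate_pow)

lemma normal_generate_iff_normal_cyc:
  assumes x: "x \<in> carrier G"
  shows "generate G {x} \<lhd> G \<longleftrightarrow> normal_cyc G x"
proof
  assume "generate G {x} \<lhd> G"
  then show "normal_cyc G x"
    unfolding normal_cyc_def using x normal.inv_op_closed2[of "generate G {x}" G]
    by (metis generate.incl generate_singleton_iff insertI1)
next
  assume n: "normal_cyc G x"
  have "subgroup (generate G {x}) G" using x by (simp add: generate_is_subgroup)
  then show "generate G {x} \<lhd> G"
  proof (rule normal_invI)
    fix g h assume g: "g \<in> carrier G" and "h \<in> generate G {x}"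
    then obtain k :: int where "h = x [^] k" using x generate_singleton_iff by blast
    moreover obtain l :: int where "g \<otimes> x \<otimes> inv g = x [^] l"
      using n g normal_cyc_def by metis
    ultimately have "g \<otimes> h \<otimes> inv g = x [^] (l * k)"
      using g x by (simp add: conj_int_pow int_pow_pow)
    then show "g \<otimes> h \<otimes> inv g \<in> generate G {x}" using x generate_singleton_iff by blast
  qed
qed

text \<open>As <a> is normalised by everything, <a>K is a subgroup for each subgroup K, so one more
  generator multiplies the order by at most n. The explicit bound is what later plays against finite
  rank.\<close>

lemma normal_cyc_torsion_generate:
  assumes "finite F"
    and "\<And>x. x \<in> F \<Longrightarrow> normal_cyc G x \<and> x [^] (n::nat) = \<one>" and n: "n > 0"
  shows "finite (generate G F) \<and> card (generate G F) \<le> n ^ card F"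
  using assms(1,2)
proof (induction F)
  case empty
  then show ?case by (simp add: generate_empty)
next
  case (insert a F)
  let ?K = "generate G F"
  have IH: "finite ?K" "card ?K \<le> n ^ card F" using insert by auto
  have a: "a \<in> carrier G" "normal_cyc G a" "a [^] n = \<one>" using insert.prems by (auto simp: normal_cyc_def)
  have F: "F \<subseteq> carrier G" using insert.prems by (auto simp: normal_cyc_def)
  have K: "subgroup ?K G" using F by (rule generate_is_subgroup)
  then have KG: "?K \<subseteq> carrier G" by (rule subgroup.subset)
  define P where "P = {a [^] (i::int) \<otimes> b | i b. b \<in> ?K}"
  have P: "subgroup P G"
  proof (rule subgroupI)
    show "P \<subseteq> carrier G" using a KG by (auto simp: P_def)
    show "P \<noteq> {}" using subgroup.one_closed[OF K] by (auto simp: P_def)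
  next
    fix u assume "u \<in> P"
    then obtain i :: int and b where u: "u = a [^] i \<otimes> b" "b \<in> ?K" by (auto simp: P_def)
    have b: "b \<in> carrier G" using u KG by blast
    obtain k :: int where k: "inv b \<otimes> a \<otimes> inv (inv b) = a [^] k"
      using a b normal_cyc_def by (metis inv_closed)
    have "inv u = (inv b \<otimes> a [^] (- i) \<otimes> inv (inv b)) \<otimes> inv b"
      using u a b by (simp add: grp_simps int_pow_neg)
    also have "\<dots> = a [^] (k * (- i)) \<otimes> inv b"
      using a b k by (simp only: conj_int_pow inv_closed) (simp add: int_pow_pow)
    finally show "inv u \<in> P"
      using subgroup.m_inv_closed[OF K u(2)] by (auto simp: P_def)
  next
    fix u v assume "u \<in> P" "v \<in> P"
    then obtain i j :: int and b d where u: "u = a [^] i \<otimes> b" "b \<in> ?K" "v = a [^] j \<otimes> d" "d \<in> ?K"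
      by (auto simp: P_def)
    have b: "b \<in> carrier G" "d \<in> carrier G" using u KG by blast+
    obtain k :: int where k: "b \<otimes> a \<otimes> inv b = a [^] k" using a b normal_cyc_def by metis
    have "u \<otimes> v = a [^] i \<otimes> (b \<otimes> a [^] j \<otimes> inv b) \<otimes> (b \<otimes> d)"
      using u a b by (simp add: grp_simps)
    also have "\<dots> = a [^] (i + k * j) \<otimes> (b \<otimes> d)"
      using a b k by (simp add: conj_int_pow int_pow_pow int_pow_mult)
    finally show "u \<otimes> v \<in> P" using subgroup.m_closed[OF K u(2,4)] by (auto simp: P_def)
  qed
  have "a \<in> P"
    unfolding P_def using a(1) subgroup.one_closed[OF K]
    by (auto intro!: exI[of _ "1::int"] exI[of _ \<one>])
  moreover have "b \<in> P" if "b \<in> F" for b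
    unfolding P_def using F that generate.incl[OF that, of G]
    by (auto intro!: exI[of _ "0::int"] exI[of _ b])
  ultimately have "insert a F \<subseteq> P" by blast
  then have "generate G (insert a F) \<subseteq> P" using P by (rule generate_subgroup_incl)
  also have "P \<subseteq> (\<lambda>(i::nat, b). a [^] i \<otimes> b) ` ({..<n} \<times> ?K)"
  proof
    fix u assume "u \<in> P"
    then obtain i :: int and b where u: "u = a [^] i \<otimes> b" "b \<in> ?K" by (auto simp: P_def)
    obtain l :: nat where "l < n" "a [^] i = a [^] l" using int_pow_nat_ex[OF a(1) n a(3)] by blast
    then show "u \<in> (\<lambda>(i::nat, b). a [^] i \<otimes> b) ` ({..<n} \<times> ?K)" using u by force
  qed
  finally have sub: "generate G (insert a F) \<subseteq> (\<lambda>(i::nat, b). a [^] i \<otimes> b) ` ({..<n} \<times> ?K)" .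
  have fin: "finite ({..<n} \<times> ?K)" using IH by simp
  have "card (generate G (insert a F)) \<le> card ({..<n} \<times> ?K)"
    using sub fin by (meson card_image_le card_mono finite_imageI le_trans)
  also have "\<dots> \<le> n * n ^ card F" using IH by (simp add: card_cartesian_product)
  finally show ?case using sub fin insert.hyps by (auto intro: finite_subset)
qed

end

section \<open>Dedekind groups\<close>

locale dedekind = group +
  assumes cyc: "x \<in> carrier G \<Longrightarrow> normal_cyc G x"

lemma (in group) dedekind_subgroup:
  assumes "subgroup H G" "\<And>x. x \<in> H \<Longrightarrow> normal_cyc G x"
  shows "dedekind (G\<lparr>carrier := H\<rparr>)"
proof -
  interpret H: group "G\<lparr>carrier := H\<rparr>" using assms(1) by (rule subgroup_imp_group)
  have HG: "H \<subseteq> carrier G" using assms(1) by (rule subgroup.subset)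
  show ?thesis
  proof (unfold_locales)
    fix x assume "x \<in> carrier (G\<lparr>carrier := H\<rparr>)"
    then have x: "x \<in> H" by simp
    show "normal_cyc (G\<lparr>carrier := H\<rparr>) x"
      unfolding normal_cyc_def
    proof (intro conjI ballI)
      fix g assume "g \<in> carrier (G\<lparr>carrier := H\<rparr>)"
      then have g: "g \<in> H" by simp
      then obtain k :: int where "g \<otimes> x \<otimes> inv g = x [^] k"
        using HG assms(2)[OF x] unfolding normal_cyc_def by blast
      then show "\<exists>k::int. g \<otimes>\<^bsub>G\<lparr>carrier := H\<rparr>\<^esub> x \<otimes>\<^bsub>G\<lparr>carrier := H\<rparr>\<^esub> inv\<^bsub>G\<lparr>carrier := H\<rparr>\<^esub> g
          = x [^]\<^bsub>G\<lparr>carrier := H\<rparr>\<^esub> k"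
        using assms(1) x g by (auto simp flip: int_pow_consistent)
    qed (use x in simp)
  qed
qed

text \<open>A subgroup is the union of its cyclic subgroups, so it is enough that these are
  normal.\<close>

lemma dedekind_group_iff:
  fixes G (structure)
  shows "dedekind_group G \<longleftrightarrow> dedekind G"
proof
  assume G: "dedekind_group G"
  then interpret group G by (simp add: dedekind_group_def)
  show "dedekind G"
    using G by unfold_locales
      (simp add: dedekind_group_def generate_is_subgroup flip: normal_generate_iff_normal_cyc)
next
  assume "dedekind G"
  then interpret dedekind G .
  have "H \<lhd> G" if H: "subgroup H G" for H
    using H
  proof (rule normal_invI)
    fix g h assume g: "g \<in> carrier G" and h: "h \<in> H"
    then obtain k :: int where "g \<otimes> h \<otimes> inv g = h [^] k"
      using cyc[of h] subgroup.mem_carrier[OF H] unfolding normal_cyc_def by metis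
    then show "g \<otimes> h \<otimes> inv g \<in> H"
      using subgroup_int_pow_closed[OF H h] by simp
  qed
  then show "dedekind_group G"
    by (simp add: dedekind_group_def is_group)
qed

section \<open>Primary components and class 2\<close>

definition p_part :: "('a, 'b) monoid_scheme \<Rightarrow> nat \<Rightarrow> 'a set" where
  "p_part G p = {x \<in> carrier G. \<exists>n::nat. x [^]\<^bsub>G\<^esub> (p ^ n) = \<one>\<^bsub>G\<^esub>}"

lemma (in group) pow_dvd_eq_one:
  assumes "x \<in> carrier G" "x [^] (a::nat) = \<one>" "a dvd b"
  shows "x [^] b = \<one>"
  using assms pow_eq_id dvd_trans by blast

lemma (in group) ord_prime_power_iff:
  assumes "Factorial_Ring.prime (p::nat)" "x \<in> carrier G"
  shows "(\<exists>n. ord x = p ^ n) \<longleftrightarrow> (\<exists>n. x [^] (p ^ n) = \<one>)"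
proof
  assume "\<exists>n. ord x = p ^ n"
  then show "\<exists>n. x [^] (p ^ n) = \<one>" using assms(2) pow_ord_eq_1 by metis
next
  assume "\<exists>n. x [^] (p ^ n) = \<one>"
  then obtain n where "ord x dvd p ^ n" using assms(2) pow_eq_id by metis
  then show "\<exists>n. ord x = p ^ n" using assms(1) divides_primepow_nat by metis
qed

context dedekind begin

lemma conj_power:
  assumes "x \<in> carrier G" "g \<in> carrier G"
  obtains k :: int where "g \<otimes> x \<otimes> inv g = x [^] k"
  using cyc[OF assms(1)] assms(2) unfolding normal_cyc_def by blast

text \<open>On <z> both maps raise to powers, with exponents l and k, and these commute. The
  exponents may depend on z.\<close>

lemma power_hom_conj_commute:
  assumes f: "f \<in> hom G G" "\<And>x. x \<in> carrier G \<Longrightarrow> \<exists>k::int. f x = x [^] k"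
    and "y \<in> carrier G" "z \<in> carrier G"
  shows "f (y \<otimes> z \<otimes> inv y) = y \<otimes> f z \<otimes> inv y"
proof -
  obtain k :: int where k: "y \<otimes> z \<otimes> inv y = z [^] k" using assms conj_power by metis
  obtain l :: int where l: "f z = z [^] l" using assms by blast
  have "f (y \<otimes> z \<otimes> inv y) = (z [^] l) [^] k"
    using k l f(1) assms(4) by (simp add: hom_int_pow is_group)
  also have "\<dots> = y \<otimes> f z \<otimes> inv y"
    using k l assms by (simp add: conj_int_pow int_pow_pow mult.commute)
  finally show ?thesis .
qed

lemma commutator_central:
  assumes x: "x \<in> carrier G" and y: "y \<in> carrier G" and z: "z \<in> carrier G"
  shows "commutator G x y \<otimes> z = z \<otimes> commutator G x y"
proof -
  \<comment> \<open>Conjugating this element by y x returns z, and conjugating it by x y gives the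
    conjugate of z by the commutator.\<close>
  define w where "w = inv (y \<otimes> x) \<otimes> z \<otimes> (y \<otimes> x)"
  have w: "w \<in> carrier G" using assms by (simp add: w_def)
  have "\<exists>k::int. x \<otimes> u \<otimes> inv x = u [^] k" if "u \<in> carrier G" for u
    using conj_power[OF that x] by metis
  then have "x \<otimes> (y \<otimes> w \<otimes> inv y) \<otimes> inv x = y \<otimes> (x \<otimes> w \<otimes> inv x) \<otimes> inv y"
    using power_hom_conj_commute[OF conj_hom[OF x] _ y w] by blast
  moreover have "y \<otimes> (x \<otimes> w \<otimes> inv x) \<otimes> inv y = z"
    using assms by (simp add: w_def grp_simps)
  moreover have "x \<otimes> (y \<otimes> w \<otimes> inv y) \<otimes> inv x = commutator G x y \<otimes> z \<otimes> inv (commutator G x y)"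
    using assms by (simp add: w_def grp_simps)
  ultimately show ?thesis
    using assms conj_eq_iff[of "commutator G x y" z z] by simp
qed

text \<open>The commutator is x times a conjugate of the inverse of x. Together with
  \<open>commutator_in_right\<close> this places it in both cyclic subgroups.\<close>

lemma commutator_in_left:
  assumes "x \<in> carrier G" "y \<in> carrier G"
  obtains k :: int where "commutator G x y = x [^] k"
proof -
  obtain k :: int where k: "y \<otimes> inv x \<otimes> inv y = inv x [^] k"
    using assms conj_power[of "inv x" y] by auto
  have "commutator G x y = x \<otimes> (y \<otimes> inv x \<otimes> inv y)" using assms by (simp add: m_assoc)
  also have "\<dots> = x [^] (1 - k)"
    using assms by (simp only: k int_pow_diff int_pow_1 int_pow_inv)
  finally show thesis by (rule that)
qed

lemma commutator_in_right:
  assumes "x \<in> carrier G" "y \<in> carrier G"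
  obtains k :: int where "commutator G x y = y [^] k"
proof -
  obtain k :: int where k: "x \<otimes> y \<otimes> inv x = y [^] k"
    using assms conj_power by metis
  have "commutator G x y = y [^] (k - 1)"
    using assms by (simp add: k int_pow_diff)
  then show thesis by (rule that)
qed

lemma commutator_pow:
  assumes "x \<in> carrier G" "y \<in> carrier G"
  shows "commutator G (x [^] (n::nat)) y = commutator G x y [^] n"
    and "commutator G x (y [^] (n::nat)) = commutator G x y [^] n"
  using assms commutator_pow_left[of x y n] commutator_pow_right[of x y n] commutator_central
  by simp_all

lemma commute_swap_commutator:
  assumes "x \<in> carrier G" "y \<in> carrier G"
  shows "y \<otimes> x = x \<otimes> y \<otimes> commutator G (inv y) (inv x)"
  using assms by (simp add: grp_simps)

lemma pow_mult:
  assumes "x \<in> carrier G" "y \<in> carrier G"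
  shows "(x \<otimes> y) [^] (n::nat) = x [^] n \<otimes> y [^] n \<otimes> commutator G (inv y) (inv x) [^] (n * (n - 1) div 2)"
  using assms commutator_central[of "inv y" "inv x"]
  by (intro pow_mult_class2 commute_swap_commutator) simp_all

lemma subgroup_p_part:
  shows "subgroup (p_part G p) G"
proof (rule subgroupI)
  show "p_part G p \<subseteq> carrier G" by (auto simp: p_part_def)
  show "p_part G p \<noteq> {}" using one_closed by (force simp: p_part_def)
  show "inv x \<in> p_part G p" if "x \<in> p_part G p" for x
    using that by (auto simp: p_part_def nat_pow_inv)
  fix x y assume "x \<in> p_part G p" "y \<in> p_part G p"
  then obtain i j where *: "x \<in> carrier G" "y \<in> carrier G" "x [^] (p ^ i) = \<one>" "y [^] (p ^ j) = \<one>"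
    by (auto simp: p_part_def)
  \<comment> \<open>A common exponent of x and y, hence also of the commutator d. For p = 2 the
    correction with exponent m(m - 1)/2 can survive the m-th power, which is why the final exponent
    is the square of m.\<close>
  define m where "m = p ^ (i + j)"
  have m: "x [^] m = \<one>" "y [^] m = \<one>"
    using * pow_dvd_eq_one[of x "p ^ i" m] pow_dvd_eq_one[of y "p ^ j" m]
    by (simp_all add: m_def power_add)
  define d where "d = commutator G (inv y) (inv x)"
  have d: "d \<in> carrier G" using * by (simp add: d_def)
  have "d [^] m = \<one>"
    unfolding d_def using * m commutator_pow(2)[of "inv y" "inv x" m, symmetric] by (simp add: nat_pow_inv)
  then have "d [^] (m * (m - 1) div 2 * m) = \<one>"
    using d pow_dvd_eq_one[of d m "m * (m - 1) div 2 * m"] by simp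
  moreover have "(x \<otimes> y) [^] m = d [^] (m * (m - 1) div 2)"
    unfolding pow_mult[OF *(1,2)] d_def[symmetric] m using d by simp
  ultimately have "(x \<otimes> y) [^] (m * m) = \<one>"
    using * d nat_pow_pow[of "x \<otimes> y" m m] nat_pow_pow[of d "m * (m - 1) div 2" m] by simp
  then have "(x \<otimes> y) [^] (p ^ (i + j + (i + j))) = \<one>"
    unfolding m_def power_add .
  then show "x \<otimes> y \<in> p_part G p" using * unfolding p_part_def by blast
qed

text \<open>The primary part contains every p-subgroup, so it is the only maximal one and the
  description operator in \<open>sylow_component\<close> selects it.\<close>

lemma sylow_component_eq:
  assumes p: "Factorial_Ring.prime (p::nat)"
  shows "sylow_component G p = G\<lparr>carrier := p_part G p\<rparr>"
proof -
  have P: "p_subgroup p Q G \<longleftrightarrow> subgroup Q G \<and> Q \<subseteq> p_part G p" for Q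
  proof -
    have "(\<exists>n. ord x = p ^ n) \<longleftrightarrow> x \<in> p_part G p" if "subgroup Q G" "x \<in> Q" for x
      using ord_prime_power_iff[OF p] subgroup.mem_carrier[OF that] by (simp add: p_part_def)
    then show ?thesis unfolding p_subgroup_def by blast
  qed
  have "(THE Q. sylow_p_subgroup p Q G) = p_part G p"
  proof (rule the_equality)
    show "sylow_p_subgroup p (p_part G p) G"
      unfolding sylow_p_subgroup_def P using subgroup_p_part by blast
    show "Q = p_part G p" if "sylow_p_subgroup p Q G" for Q
      using that subgroup_p_part unfolding sylow_p_subgroup_def P by blast
  qed
  then show ?thesis by (simp add: sylow_component_def)
qed

end

text \<open>The units modulo 4 are 1 and -1. This limits what an injective power map can do to an
  element of order 4.\<close>

lemma (in group) pow4_cases: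
  assumes "x \<in> carrier G" "x [^] (4::nat) = \<one>" "(x [^] (k::int)) [^] (2::nat) \<noteq> \<one>"
  shows "x [^] k = x \<or> x [^] k = inv x"
proof -
  obtain l where l: "l < 4" "x [^] k = x [^] (l::nat)"
    using assms(1,2) int_pow_nat_ex[of x 4] by auto
  have x3: "x [^] (3::nat) = inv x"
    using assms(1,2) nat_pow_mult[OF assms(1), of 3 1] by (simp add: inv_equality)
  have "(x [^] (2::nat)) [^] (2::nat) = \<one>"
    using assms(1,2) by (simp add: nat_pow_pow)
  then have "l \<noteq> 2" using l assms(3) by auto
  moreover have "l \<noteq> 0"
  proof
    assume "l = 0"
    then show False using l assms(3) by simp
  qed
  ultimately have "l = 1 \<or> l = 3" using l(1) by arith
  then show ?thesis using l x3 assms(1) by auto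
qed

section \<open>Non-abelian Dedekind p-groups\<close>

lemma (in group) commute_commutes_inv_cancel:
  assumes "x \<in> carrier G" "y \<in> carrier G" "z \<in> carrier G"
    and "(x \<otimes> y) \<otimes> z = z \<otimes> (x \<otimes> y)" "y \<otimes> z = z \<otimes> y"
  shows "x \<otimes> z = z \<otimes> x"
proof -
  have "(x \<otimes> z) \<otimes> y = (z \<otimes> x) \<otimes> y" using assms by (simp add: m_assoc)
  then show ?thesis using assms by (metis m_closed right_cancel)
qed

text \<open>
  A non-central \<open>x\<close> of least order is adjusted by a power of an element \<open>y\<close> not commuting with it.
  The product would have smaller order than \<open>x\<close>, unless the correction term \<open>p\<^sup>i (p\<^sup>i - 1) / 2\<close> in
  the power formula for class 2 is prime to \<open>p\<close>, which only happens for \<open>p = 2\<close> and \<open>i = 1\<close>.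
\<close>

lemma (in dedekind) nonabelian_quaternion:
  assumes p: "Factorial_Ring.prime (p::nat)"
    and pgrp: "\<And>x. x \<in> carrier G \<Longrightarrow> \<exists>n. x [^] (p ^ n) = \<one>"
    and ab: "a \<in> carrier G" "b \<in> carrier G" "a \<otimes> b \<noteq> b \<otimes> a"
  obtains x y where "p = 2" "x \<in> carrier G" "y \<in> carrier G" "x [^] (4::nat) = \<one>" "x [^] (2::nat) \<noteq> \<one>"
    "y [^] (2::nat) = x [^] (2::nat)" "commutator G x y = x [^] (2::nat)"
    "\<And>w. \<lbrakk>w \<in> carrier G; w \<otimes> x = x \<otimes> w; w \<otimes> y = y \<otimes> w\<rbrakk> \<Longrightarrow> w [^] (2::nat) = \<one>"
proof -
  define nc where "nc = (\<lambda>x. x \<in> carrier G \<and> (\<exists>y\<in>carrier G. x \<otimes> y \<noteq> y \<otimes> x))"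
  have "nc a" using ab by (auto simp: nc_def)
  then obtain x where x_nc: "nc x" and x_min: "\<And>z. nc z \<Longrightarrow> ord x \<le> ord z"
    using ex_has_least_nat[of nc a ord] by blast
  then obtain y where x: "x \<in> carrier G" and y: "y \<in> carrier G" and xy: "x \<otimes> y \<noteq> y \<otimes> x"
    by (auto simp: nc_def)
  then have y_nc: "nc y" by (metis nc_def)
  have pp: "p > 1" using p prime_gt_1_nat by blast
  have central: "u \<otimes> v = v \<otimes> u" if "u \<in> carrier G" "v \<in> carrier G" "ord u < ord x" for u v
    using that x_min[of u] by (auto simp: nc_def)
  obtain n where n: "ord x = p ^ n" using ord_prime_power_iff[OF p x] pgrp[OF x] by blast
  have "n \<noteq> 0"
  proof
    assume "n = 0"
    then have "x = \<one>" using n x ord_eq_1 by simp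
    then show False using xy y by simp
  qed
  then obtain i where i: "ord x = p ^ Suc i" using n by (cases n) auto
  obtain m where "ord y = p ^ m" using ord_prime_power_iff[OF p y] pgrp[OF y] by blast
  moreover have "ord x \<le> ord y" using y_nc x_min by blast
  ultimately have "p ^ Suc i \<le> p ^ m" using i by simp
  then have "Suc i \<le> m" using pp by (rule power_le_imp_le_exp[rotated])
  then obtain j where j: "ord y = p ^ Suc j" "i \<le> j" using \<open>ord y = p ^ m\<close> by (cases m) auto
  \<comment> \<open>The p-th power of x has smaller order than x, so it is central by
    minimality.\<close>
  have "ord (x [^] p) = p ^ i" using x i pp by (simp add: ord_pow)
  then have xp: "x [^] p \<otimes> v = v \<otimes> x [^] p" if "v \<in> carrier G" for v
    using that x i pp by (intro central) simp_all
  have comm_p: "commutator G x v [^] p = \<one>" if v: "v \<in> carrier G" for v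
  proof -
    have "commutator G (x [^] p) v = \<one>"
      using commute_iff_commutator[of "x [^] p" v] xp[OF v] v x by simp
    then show ?thesis using commutator_pow(1)[OF x v, of p] by simp
  qed
  define c where "c = commutator G x y"
  have c: "c \<in> carrier G" "c \<noteq> \<one>" "c [^] p = \<one>"
    using x y xy comm_p[OF y] commute_iff_commutator[OF x y] by (simp_all add: c_def)
  define u where "u = x [^] (p ^ i)"
  define v where "v = y [^] (p ^ j)"
  have u: "u \<in> carrier G" "u [^] p = \<one>" "u \<noteq> \<one>"
    using x i pp pow_ord_eq_1[OF x] pow_eq_id[OF x, of "p ^ i"]
    by (auto simp: u_def nat_pow_pow mult.commute dest: dvd_imp_le)
  have v: "v \<in> carrier G" "v [^] p = \<one>"
    using y j pow_ord_eq_1[OF y] by (simp_all add: v_def nat_pow_pow mult.commute)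
  \<comment> \<open>As c has order p and lies in the cyclic p-group <z>, it lies in the only
    subgroup of order p there, which is generated by this power of z.\<close>
  have socle: "\<exists>k::int. c = (z [^] (p ^ e)) [^] k"
    if z: "z \<in> carrier G" "ord z = p ^ Suc e" and cz: "c = z [^] (k::int)" for z e k
  proof -
    have "z [^] (k * int p) = \<one>"
      using c cz z by (simp add: int_pow_int flip: int_pow_pow)
    then have "int (p ^ Suc e) dvd k * int p" using z int_pow_eq_id by metis
    then have "int (p ^ e) dvd k" using pp by (simp add: mult.commute)
    then obtain k' where k': "k = int (p ^ e) * k'" using dvdE by blast
    have "c = (z [^] int (p ^ e)) [^] k'"
      unfolding cz k' using int_pow_pow[of z "int (p ^ e)" k'] z(1) by simp
    then show ?thesis unfolding int_pow_int by blast
  qed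
  obtain k :: int where k: "c = u [^] k"
    using commutator_in_left[OF x y] socle[OF x i] unfolding u_def c_def by metis
  obtain l :: int where l: "c = v [^] l"
    using commutator_in_right[OF x y] socle[OF y j(1)] unfolding v_def c_def by metis
  \<comment> \<open>Now k is invertible modulo p, and with an inverse s the element u becomes the
    power c^s.\<close>
  have "\<not> int p dvd k"
  proof
    assume "int p dvd k"
    then have "u [^] k = u [^] (0::int)" using u by (intro int_pow_cong[of u p]) simp_all
    then show False using k c by simp
  qed
  then have "coprime k (int p)"
    using p by (metis coprime_commute prime_imp_coprime prime_nat_int_transfer)
  then obtain s t where st: "k * s + int p * t = 1"
    by (metis bezout_int coprime_imp_gcd_eq_1 mult.commute)
  have "c [^] s = u [^] (k * s)" using u k by (simp add: int_pow_pow mult.commute)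
  also have "\<dots> = u [^] (1::int)"
  proof (rule int_pow_cong[of u p])
    have "k * s = 1 - int p * t" using st by simp
    then show "k * s mod int p = 1 mod int p" by (simp add: mod_diff_eq[symmetric])
  qed (use u in simp_all)
  finally have uc: "u = c [^] s" using u by simp
  \<comment> \<open>Chosen so that the p^i-th power of y^r is v^(-l s) = c^(-s), the inverse of u.
    In the power formula for x y0 the two main factors then cancel and only the commutator term is
    left.\<close>
  define r where "r = - (l * s * int (p ^ (j - i)))"
  define y0 where "y0 = y [^] r"
  have y0: "y0 \<in> carrier G" using y by (simp add: y0_def)
  have "y0 [^] (p ^ i) = y [^] (r * int (p ^ i))"
    using y by (simp add: y0_def int_pow_pow mult.commute flip: int_pow_int)
  also have "r * int (p ^ i) = - (int (p ^ j) * (l * s))"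
    using j(2) by (simp add: r_def flip: power_add)
  also have "y [^] (- (int (p ^ j) * (l * s))) = inv (((y [^] int (p ^ j)) [^] l) [^] s)"
    using y by (simp add: int_pow_neg int_pow_pow mult.assoc)
  also have "\<dots> = inv u"
    unfolding uc l v_def int_pow_int ..
  finally have y0p: "y0 [^] (p ^ i) = inv u" .
  define d where "d = commutator G (inv y0) (inv x)"
  have d: "d \<in> carrier G" using x y0 by (simp add: d_def)
  define N where "N = p ^ i"
  have "(x \<otimes> y0) [^] N = d [^] (N * (N - 1) div 2)"
    unfolding pow_mult[OF x y0] d_def[symmetric] N_def u_def[symmetric] y0p using u d by simp
  \<comment> \<open>y0 commutes with y but x does not, so x y0 is again non-central; by minimality
    its order is at least that of x, which is p N.\<close>
  moreover have "(x \<otimes> y0) [^] N \<noteq> \<one>"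
  proof
    assume eq: "(x \<otimes> y0) [^] N = \<one>"
    have "y0 \<otimes> y = y \<otimes> y0" unfolding y0_def using y by (intro commute_int_pow) simp_all
    then have "(x \<otimes> y0) \<otimes> y \<noteq> y \<otimes> (x \<otimes> y0)"
      using commute_commutes_inv_cancel[OF x y0 y] xy by blast
    then have "nc (x \<otimes> y0)" using x y y0 by (auto simp: nc_def)
    then have "ord x \<le> N"
      using eq x y0 pp x_min ord_le_pow_eq_one(2)[of "x \<otimes> y0" N] by (fastforce simp: N_def)
    then show False using i pp by (simp add: N_def)
  qed
  moreover have dp: "d [^] p = \<one>"
  proof -
    have "inv y0 \<otimes> inv x [^] p = inv x [^] p \<otimes> inv y0"
      using commute_inv[of "x [^] p" "inv y0"] xp[of "inv y0"] x y0 by (simp add: nat_pow_inv)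
    then show ?thesis
      unfolding d_def using commutator_pow(2)[of "inv y0" "inv x" p]
        commute_iff_commutator[of "inv y0" "inv x [^] p"] x y0 by simp
  qed
  \<comment> \<open>This non-divisibility decides everything: it fails for N = 1, for odd p, and for
    N divisible by 4, which leaves p = 2 and N = 2.\<close>
  ultimately have ndvd: "\<not> p dvd N * (N - 1) div 2"
    using d pow_dvd_eq_one[OF d dp] by metis
  have even: "2 * (N * (N - 1) div 2) = N * (N - 1)"
    by (cases "even N") auto
  have i0: "i \<noteq> 0" using ndvd by (auto simp: N_def intro: Nat.gr0I)
  have p2: "p = 2"
  proof (rule ccontr)
    assume "p \<noteq> 2"
    have "p dvd N" using i0 by (simp add: N_def)
    then have "p dvd 2 * (N * (N - 1) div 2)" unfolding even by (rule dvd_mult2)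
    then have "p dvd 2" using ndvd p prime_dvd_mult_iff by blast
    then show False using \<open>p \<noteq> 2\<close> pp by (auto dest: dvd_imp_le)
  qed
  have i1: "i = 1"
  proof (rule ccontr)
    assume "i \<noteq> 1"
    then obtain i' where "i = Suc (Suc i')" using i0 by (metis One_nat_def not0_implies_Suc)
    then have "N = 4 * 2 ^ i'" by (simp add: N_def p2)
    then have "N * (N - 1) div 2 = 2 * (2 ^ i' * (N - 1))" by simp
    then show False using ndvd p2 by simp
  qed
  have d1: "d \<noteq> \<one>" using ndvd \<open>(x \<otimes> y0) [^] N = _\<close> \<open>(x \<otimes> y0) [^] N \<noteq> \<one>\<close> d by auto
  \<comment> \<open>If y had order above 4, then r would be even and y0 a power of the square of y,
    which commutes with x because c has order 2. Then d would be trivial.\<close>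
  have j1: "j = 1"
  proof (rule ccontr)
    assume "j \<noteq> 1"
    then have "even r" using j(2) i1 p2 by (simp add: r_def)
    then obtain r' where r': "r = int 2 * r'" using evenE by auto
    have "y0 = (y [^] int 2) [^] r'"
      unfolding y0_def r' using int_pow_pow[of y "int 2" r'] y by simp
    then have "y0 = (y [^] (2::nat)) [^] r'" unfolding int_pow_int .
    moreover have "x \<otimes> y [^] (2::nat) = y [^] (2::nat) \<otimes> x"
      using commutator_pow(2)[OF x y, of 2] c(3) commute_iff_commutator[of x "y [^] (2::nat)"] x y
      by (simp add: c_def p2)
    ultimately have "y0 \<otimes> x = x \<otimes> y0"
      using commute_int_pow[of "y [^] (2::nat)" x r'] x y by simp
    then have "inv y0 \<otimes> inv x = inv x \<otimes> inv y0"
      using x y0 by (metis inv_mult_group)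
    then show False using d1 commute_iff_commutator[of "inv y0" "inv x"] x y0 by (simp add: d_def)
  qed
  \<comment> \<open>A nontrivial power of an element of exponent 2 is that element itself; applied
    to u and v, the squares of x and y.\<close>
  have sq: "z = c" if z: "z \<in> carrier G" "z [^] (2::nat) = \<one>" and cz: "c = z [^] (q::int)" for z q
  proof -
    obtain q' where "q' < 2" "c = z [^] (q'::nat)" using int_pow_nat_ex[of z 2 q] z cz by auto
    then have "q' = 1" using c(2) by (cases q') auto
    then show ?thesis using \<open>c = z [^] q'\<close> z by simp
  qed
  have x2: "x [^] (2::nat) = c" using sq[of u k] u k by (simp add: u_def p2 i1)
  have y2: "y [^] (2::nat) = c" using sq[of v l] v l by (simp add: v_def p2 j1)
  have x4: "x [^] (4::nat) = \<one>" using pow_ord_eq_1[OF x] i i1 p2 by simp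
  have "w [^] (2::nat) = \<one>"
    if w: "w \<in> carrier G" "w \<otimes> x = x \<otimes> w" "w \<otimes> y = y \<otimes> w" for w
  proof (rule ccontr)
    assume w2: "w [^] (2::nat) \<noteq> \<one>"
    obtain m where m: "ord w = 2 ^ m" using ord_prime_power_iff[OF p w(1)] pgrp[OF w(1)] p2 by blast
    have "\<not> 2 ^ m dvd (2::nat)" using w2 w(1) m pow_eq_id by metis
    then have "m \<noteq> 0" "m \<noteq> 1" by (auto intro: Nat.gr0I)
    then obtain m' where m': "m = Suc (Suc m')" by (metis One_nat_def not0_implies_Suc)
    \<comment> \<open>An element of order 4 in <w>. Then x z has exponent 4 and the same commutator
      c with y, so c must be one of the four powers of x z; each of them is refuted.\<close>
    define z where "z = w [^] (2 ^ m' :: nat)"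
    have z: "z \<in> carrier G" "z \<otimes> x = x \<otimes> z" "z \<otimes> y = y \<otimes> z"
      using w x y commute_nat_pow by (auto simp: z_def)
    have "ord z = 4" using w(1) m m' by (simp add: z_def ord_pow)
    then have z4: "z [^] (4::nat) = \<one>" "z [^] (2::nat) \<noteq> \<one>"
      using z(1) pow_eq_id[of z 2] pow_ord_eq_1[of z] by auto
    have "commutator G (x \<otimes> z) y = c"
    proof -
      have "(x \<otimes> z) \<otimes> y = x \<otimes> y \<otimes> z" using x y z by (simp add: m_assoc)
      then show ?thesis using x y z by (simp add: c_def grp_simps)
    qed
    then obtain q :: int where q: "c = (x \<otimes> z) [^] q"
      using commutator_in_left[of "x \<otimes> z" y] x y z by (metis m_closed)
    have pw: "(x \<otimes> z) [^] (e::nat) = x [^] e \<otimes> z [^] e" for e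
      using pow_mult_distrib[of x z e] x z by simp
    have "(x \<otimes> z) [^] (4::nat) = \<one>" using pw[of 4] x4 z4 by simp
    then obtain e where e: "e < 4" "c = (x \<otimes> z) [^] (e::nat)"
      using int_pow_nat_ex[of "x \<otimes> z" 4 q] q x z by auto
    \<comment> \<open>Powers of z commute with y. Odd powers of x do not, since the square of x
      commutes with y and x does not.\<close>
    have nx: "z [^] f \<noteq> x \<otimes> x [^] (2 * g)" for f g :: nat
    proof
      assume "z [^] f = x \<otimes> x [^] (2 * g)"
      then have "x \<otimes> x [^] (2 * g) \<otimes> y = y \<otimes> (x \<otimes> x [^] (2 * g))"
        using commute_nat_pow[OF z(1) y z(3), of f] by simp
      moreover have "x [^] (2 * g) \<otimes> y = y \<otimes> x [^] (2 * g)"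
        using commute_nat_pow[of "x [^] (2::nat)" y g] xp[OF y] x y by (simp add: nat_pow_pow p2)
      ultimately show False
        using commute_commutes_inv_cancel[OF x _ y, of "x [^] (2 * g)"] xy x by simp
    qed
    have "e = 0 \<or> e = 1 \<or> e = 2 \<or> e = 3" using e(1) by arith
    then show False
    proof (elim disjE)
      assume "e = 0" then show False using e c by simp
    next
      assume "e = 1"
      then have "x \<otimes> z = x \<otimes> x [^] (1::nat)" using e x2 x z by (simp add: numeral_2_eq_2)
      then have "z [^] (1::nat) = x \<otimes> x [^] (2 * 0::nat)"
        using x z by (metis l_cancel mult_0_right nat_pow_0 nat_pow_closed nat_pow_eone r_one)
      then show False using nx by blast
    next
      assume "e = 2"
      then have "x [^] (2::nat) = x [^] (2::nat) \<otimes> z [^] (2::nat)" using e pw x2 by simp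
      then show False using z4 x z by (metis l_cancel_one' nat_pow_closed)
    next
      assume "e = 3"
      moreover have "x [^] (3::nat) = x [^] (2::nat) \<otimes> x"
        by (simp add: numeral_3_eq_3 numeral_2_eq_2)
      ultimately have "c = (c \<otimes> x) \<otimes> z [^] (3::nat)"
        using e(2) pw[of 3] x2 by metis
      then have "c \<otimes> \<one> = c \<otimes> (x \<otimes> z [^] (3::nat))"
        using c(1) x z(1) by (simp add: m_assoc)
      then have "x \<otimes> z [^] (3::nat) = \<one>" using x z c(1) by (metis l_cancel m_closed nat_pow_closed one_closed)
      then have "z [^] (3::nat) = inv x" using x z by (metis inv_equality inv_inv nat_pow_closed inv_closed)
      also have "inv x = x [^] (3::nat)"
        using x x4 nat_pow_mult[OF x, of 3 1] by (simp add: inv_equality)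
      also have "\<dots> = x \<otimes> x [^] (2 * 1 :: nat)" using x by (simp add: numeral_3_eq_3 numeral_2_eq_2 m_assoc)
      finally show False using nx by blast
    qed
  qed
  then show thesis
    using p2 x y x4 x2 y2 c(2) by (intro that[of x y]) (simp_all flip: c_def)
qed

context dedekind begin

text \<open>C is the centralizer of the quaternion generators x and y. Every power map with trivial
  kernel agrees on x and y with conjugation by some q. Applied to inner automorphisms this gives the
  decomposition G = Q C; applied to f it gives the inner description, because f is the identity on C
  and q centralises C.\<close>

lemma nonabelian_p_group:
  assumes p: "Factorial_Ring.prime (p::nat)"
    and pgrp: "\<And>x. x \<in> carrier G \<Longrightarrow> \<exists>n. x [^] (p ^ n) = \<one>"
    and ab: "a \<in> carrier G" "b \<in> carrier G" "a \<otimes> b \<noteq> b \<otimes> a"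
  obtains C where "p = 2" "subgroup C G" "\<And>w. w \<in> C \<Longrightarrow> w [^] (2::nat) = \<one>"
    "finite C \<Longrightarrow> finite (carrier G)"
    "\<And>f. \<lbrakk>f \<in> hom G G; \<And>x. x \<in> carrier G \<Longrightarrow> \<exists>k::int. f x = x [^] k;
       \<And>x. x \<in> carrier G \<Longrightarrow> f x = \<one> \<Longrightarrow> x = \<one>\<rbrakk>
      \<Longrightarrow> \<exists>q\<in>carrier G. \<forall>d\<in>carrier G. f d = q \<otimes> d \<otimes> inv q"
proof -
  obtain x y where p2: "p = 2" and x: "x \<in> carrier G" and y: "y \<in> carrier G"
    and x4: "x [^] (4::nat) = \<one>" and x2: "x [^] (2::nat) \<noteq> \<one>"
    and y2: "y [^] (2::nat) = x [^] (2::nat)" and c: "commutator G x y = x [^] (2::nat)"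
    and C2: "\<And>w. \<lbrakk>w \<in> carrier G; w \<otimes> x = x \<otimes> w; w \<otimes> y = y \<otimes> w\<rbrakk> \<Longrightarrow> w [^] (2::nat) = \<one>"
    using nonabelian_quaternion[OF p pgrp ab] by metis
  define C where "C = {w \<in> carrier G. w \<otimes> x = x \<otimes> w \<and> w \<otimes> y = y \<otimes> w}"
  \<comment> \<open>Representatives of the quaternion group <x, y> modulo its centre. The centre
    lies in C, so products of these four elements with C already exhaust G.\<close>
  define Q where "Q = {\<one>, x, y, x \<otimes> y}"
  have QG: "Q \<subseteq> carrier G" using x y by (simp add: Q_def)
  have CQ: "w \<otimes> q = q \<otimes> w" if "w \<in> C" "q \<in> Q" for w q
    using that x y commute_mult[of x y w] by (auto simp: C_def Q_def)
  have C: "subgroup C G"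
  proof (rule subgroupI)
    show "C \<noteq> {}" using x y by (auto simp: C_def intro!: exI[of _ \<one>])
    show "inv w \<in> C" if "w \<in> C" for w using that x y by (simp add: C_def commute_inv)
    show "v \<otimes> w \<in> C" if "v \<in> C" "w \<in> C" for v w
      using that x y by (simp add: C_def commute_mult)
  qed (auto simp: C_def)
  have sq: "z [^] (2::nat) = z \<otimes> z" if "z \<in> carrier G" for z
    using that by (simp add: numeral_2_eq_2)
  have sq2: "(z [^] (2::nat)) [^] (2::nat) = z [^] (4::nat)" if "z \<in> carrier G" for z
    using that by (simp add: nat_pow_pow)
  have y4: "y [^] (4::nat) = \<one>" using sq2[OF y] sq2[OF x] y2 x4 by simp
  have inv2: "inv (z [^] (2::nat)) = z [^] (2::nat)" if "z \<in> carrier G" "z [^] (4::nat) = \<one>" for z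
    using that sq2[OF that(1)] by (intro inv_equality) (simp_all add: sq)
  have xy: "x \<otimes> y \<otimes> inv x = inv y"
  proof -
    have "x \<otimes> y \<otimes> inv x = commutator G x y \<otimes> y" using x y by (simp add: m_assoc)
    also have "\<dots> = inv (y [^] (2::nat)) \<otimes> y" using c y2 inv2[OF y y4] by simp
    finally show ?thesis using y by (simp add: sq grp_simps)
  qed
  have yx: "y \<otimes> x \<otimes> inv y = inv x"
  proof -
    have "y \<otimes> x \<otimes> inv y = inv (commutator G x y) \<otimes> x" using x y by (simp add: grp_simps)
    also have "\<dots> = inv (x [^] (2::nat)) \<otimes> x" using c by simp
    finally show ?thesis using x by (simp add: sq grp_simps)
  qed
  \<comment> \<open>f can only invert or fix each of x and y, and the four patterns are realised by
    conjugation with 1, x, y and x y.\<close>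
  have inner: "\<exists>q\<in>Q. f x = q \<otimes> x \<otimes> inv q \<and> f y = q \<otimes> y \<otimes> inv q"
    if f: "f \<in> hom G G" "\<And>x. x \<in> carrier G \<Longrightarrow> \<exists>k::int. f x = x [^] k"
      "\<And>x. x \<in> carrier G \<Longrightarrow> f x = \<one> \<Longrightarrow> x = \<one>" for f
  proof -
    have *: "f z = z \<or> f z = inv z" if z: "z \<in> carrier G" "z [^] (4::nat) = \<one>" "z [^] (2::nat) \<noteq> \<one>" for z
    proof -
      obtain k :: int where k: "f z = z [^] k" using f(2) z by blast
      have "(f z) [^] (2::nat) \<noteq> \<one>"
        using f(3)[of "z [^] (2::nat)"] z hom_nat_pow[OF f(1) z(1) is_group is_group, of 2] by auto
      then show ?thesis using pow4_cases[OF z(1,2)] k by simp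
    qed
    have xyi: "(x \<otimes> y) \<otimes> x \<otimes> inv (x \<otimes> y) = inv x" "(x \<otimes> y) \<otimes> y \<otimes> inv (x \<otimes> y) = inv y"
    proof -
      have "(x \<otimes> y) \<otimes> x \<otimes> inv (x \<otimes> y) = x \<otimes> (y \<otimes> x \<otimes> inv y) \<otimes> inv x" using x y by (simp add: grp_simps)
      then show "(x \<otimes> y) \<otimes> x \<otimes> inv (x \<otimes> y) = inv x" using yx x by simp
      have "(x \<otimes> y) \<otimes> y \<otimes> inv (x \<otimes> y) = x \<otimes> y \<otimes> inv x" using x y by (simp add: grp_simps)
      then show "(x \<otimes> y) \<otimes> y \<otimes> inv (x \<otimes> y) = inv y" using xy by simp
    qed
    consider "f x = x" "f y = y" | "f x = x" "f y = inv y" | "f x = inv x" "f y = y"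
      | "f x = inv x" "f y = inv y"
      using *[OF x x4 x2] *[OF y y4] y2 x2 by auto
    then show ?thesis
    proof cases
      case 1 then show ?thesis using x y by (intro bexI[of _ \<one>]) (simp_all add: Q_def)
    next
      case 2 then show ?thesis using x y xy by (intro bexI[of _ x]) (simp_all add: Q_def m_assoc)
    next
      case 3 then show ?thesis using x y yx by (intro bexI[of _ y]) (simp_all add: Q_def m_assoc)
    next
      case 4 then show ?thesis using x y xyi by (intro bexI[of _ "x \<otimes> y"]) (simp_all add: Q_def)
    qed
  qed
  have QC: "\<exists>q\<in>Q. inv q \<otimes> d \<in> C" if d: "d \<in> carrier G" for d
  proof -
    have "\<exists>q\<in>Q. d \<otimes> x \<otimes> inv d = q \<otimes> x \<otimes> inv q \<and> d \<otimes> y \<otimes> inv d = q \<otimes> y \<otimes> inv q"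
    proof (rule inner)
      show "\<exists>k::int. d \<otimes> z \<otimes> inv d = z [^] k" if "z \<in> carrier G" for z
        using conj_power[OF that d] by metis
      show "z = \<one>" if "z \<in> carrier G" "d \<otimes> z \<otimes> inv d = \<one>" for z
        using that d by (simp add: conj_eq_iff)
    qed (rule conj_hom[OF d])
    then obtain q where q: "q \<in> Q" "d \<otimes> x \<otimes> inv d = q \<otimes> x \<otimes> inv q" "d \<otimes> y \<otimes> inv d = q \<otimes> y \<otimes> inv q"
      by blast
    have "(inv q \<otimes> d) \<otimes> z = z \<otimes> (inv q \<otimes> d)"
      if z: "z \<in> carrier G" "d \<otimes> z \<otimes> inv d = q \<otimes> z \<otimes> inv q" for z
    proof -
      have qG: "q \<in> carrier G" using q QG by blast
      have "(inv q \<otimes> d) \<otimes> z = inv q \<otimes> (d \<otimes> z \<otimes> inv d) \<otimes> d" using qG d z(1) by (simp add: grp_simps)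
      also have "\<dots> = z \<otimes> (inv q \<otimes> d)" unfolding z(2) using qG d z(1) by (simp add: grp_simps)
      finally show ?thesis .
    qed
    then show ?thesis using q x y d QG by (intro bexI[of _ q]) (auto simp: C_def)
  qed
  show thesis
  proof (rule that[OF p2 C])
    show "w [^] (2::nat) = \<one>" if "w \<in> C" for w using that C2 by (simp add: C_def)
    show "finite (carrier G)" if "finite C"
    proof (rule finite_subset)
      show "carrier G \<subseteq> (\<lambda>(q, w). q \<otimes> w) ` (Q \<times> C)"
      proof
        fix d assume d: "d \<in> carrier G"
        then obtain q where q: "q \<in> Q" "inv q \<otimes> d \<in> C" using QC by blast
        have "d = q \<otimes> (inv q \<otimes> d)" using q QG d by (simp add: subset_iff inv_cancel_left)
        then show "d \<in> (\<lambda>(q, w). q \<otimes> w) ` (Q \<times> C)" using q by force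
      qed
      show "finite ((\<lambda>(q, w). q \<otimes> w) ` (Q \<times> C))" using that by (simp add: Q_def)
    qed
    fix f assume f: "f \<in> hom G G" "\<And>x. x \<in> carrier G \<Longrightarrow> \<exists>k::int. f x = x [^] k"
      "\<And>x. x \<in> carrier G \<Longrightarrow> f x = \<one> \<Longrightarrow> x = \<one>"
    obtain q where q: "q \<in> Q" "f x = q \<otimes> x \<otimes> inv q" "f y = q \<otimes> y \<otimes> inv q" using inner[OF f] by blast
    have qG: "q \<in> carrier G" using q QG by blast
    \<comment> \<open>An element of order 2 has only one nontrivial power, so f fixes it;
      conjugation by q fixes it as well.\<close>
    have fC: "f w = q \<otimes> w \<otimes> inv q" if w: "w \<in> C" for w
    proof -
      have wG: "w \<in> carrier G" and w2: "w [^] (2::nat) = \<one>" using w C2 by (simp_all add: C_def)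
      obtain k :: int where k: "f w = w [^] k" using f(2) wG by blast
      obtain l where l: "l < 2" "f w = w [^] (l::nat)" using int_pow_nat_ex[OF wG _ w2, of k] k by auto
      have "f w = w"
      proof (cases "w = \<one>")
        case True then show ?thesis using k by simp
      next
        case False
        then have "l \<noteq> 0" using l f(3)[OF wG] by (metis nat_pow_0)
        then have "l = 1" using l(1) by simp
        then show ?thesis using l(2) wG by simp
      qed
      also have "w = q \<otimes> w \<otimes> inv q" using CQ[OF w q(1)] conj_eq_iff[OF qG wG wG] by simp
      finally show ?thesis .
    qed
    have fQ: "f r = q \<otimes> r \<otimes> inv q" if "r \<in> Q" for r
      using that unfolding Q_def
    proof (elim insertE emptyE)
      show ?thesis if "r = \<one>" using that qG hom_one[OF f(1) is_group is_group] by simp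
      show ?thesis if "r = x" using that q by simp
      show ?thesis if "r = y" using that q by simp
      show ?thesis if "r = x \<otimes> y" unfolding that using q x y qG hom_mult[OF f(1) x y] by (simp add: grp_simps)
    qed
    have "f d = q \<otimes> d \<otimes> inv q" if d: "d \<in> carrier G" for d
    proof -
      obtain r where r: "r \<in> Q" "inv r \<otimes> d \<in> C" using QC[OF d] by blast
      have rG: "r \<in> carrier G" using r QG by blast
      have "f d = f (r \<otimes> (inv r \<otimes> d))" using rG d by (simp add: inv_cancel_left)
      also have "\<dots> = (q \<otimes> r \<otimes> inv q) \<otimes> (q \<otimes> (inv r \<otimes> d) \<otimes> inv q)"
        using hom_mult[OF f(1) rG, of "inv r \<otimes> d"] fQ[OF r(1)] fC[OF r(2)] rG d by simp
      also have "\<dots> = q \<otimes> d \<otimes> inv q" using qG rG d by (simp add: grp_simps)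
      finally show ?thesis .
    qed
    then show "\<exists>q\<in>carrier G. \<forall>d\<in>carrier G. f d = q \<otimes> d \<otimes> inv q" using qG by blast
  qed
qed

end

section \<open>Finiteness and centrality from the primary components\<close>

lemma subset_generate: "S \<subseteq> generate G S"
  by (auto intro: generate.incl)

text \<open>The positive k with e^k in H are multiples of the least one, k0. A prime q dividing k0
  would divide the order of e, but the hypothesis for q puts a power of e with exponent prime to q
  into H. So k0 = 1, and no explicit primary decomposition of e is needed.\<close>

lemma (in group) mem_subgroup_of_primary_parts:
  assumes H: "subgroup H G" and e: "e \<in> carrier G" "ord e > 0"
    and prim: "\<And>q. Factorial_Ring.prime q \<Longrightarrow> q dvd ord e \<Longrightarrow> e [^] (ord e div q ^ multiplicity q (ord e)) \<in> H"
  shows "e \<in> H"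
proof -
  define P where "P = (\<lambda>k::nat. k > 0 \<and> e [^] k \<in> H)"
  define k0 where "k0 = (LEAST k. P k)"
  have PN: "P (ord e)" using e H by (simp add: P_def subgroup.one_closed)
  then have k0: "P k0" unfolding k0_def by (rule LeastI)
  have dvd: "k0 dvd k" if k: "P k" for k
  proof (rule ccontr)
    assume n: "\<not> k0 dvd k"
    have "k mod k0 < k0" using k0 by (simp add: P_def)
    moreover have "P (k mod k0)"
    proof -
      have "e [^] int k = (e [^] int k0) [^] int (k div k0) \<otimes> e [^] int (k mod k0)"
        using e by (simp add: int_pow_pow flip: int_pow_mult of_nat_mult of_nat_add)
      then have "e [^] int (k mod k0) = inv ((e [^] int k0) [^] int (k div k0)) \<otimes> e [^] int k"
        using e by (simp add: inv_cancel_left)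
      then have "e [^] (k mod k0) \<in> H"
        using k k0 H subgroup_int_pow_closed[OF H, of "e [^] int k0" "int (k div k0)"]
        by (simp add: P_def int_pow_int subgroup.m_closed subgroup.m_inv_closed)
      then show ?thesis using n by (auto simp: P_def mod_greater_zero_iff_not_dvd)
    qed
    ultimately show False using not_less_Least[of "k mod k0" P] by (simp add: k0_def)
  qed
  have "k0 = 1"
  proof (rule ccontr)
    assume "k0 \<noteq> 1"
    then obtain q where q: "Factorial_Ring.prime q" "q dvd k0" using prime_factor_nat by blast
    have qN: "q dvd ord e" using q(2) dvd[OF PN] by (rule dvd_trans)
    define M where "M = ord e div q ^ multiplicity q (ord e)"
    have M: "ord e = q ^ multiplicity q (ord e) * M" by (simp add: M_def multiplicity_dvd)
    then have "M > 0" using e(2) by (metis mult_0_right neq0_conv)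
    then have "P M" using prim[OF q(1) qN] by (simp add: P_def M_def)
    then have "q dvd M" using dvd q(2) dvd_trans by blast
    then have "q ^ Suc (multiplicity q (ord e)) dvd ord e"
      using M by (metis mult.commute mult_dvd_mono dvd_refl power_Suc2)
    then have "Suc (multiplicity q (ord e)) \<le> multiplicity q (ord e)"
      using q(1) e(2) not_prime_unit[of q] multiplicity_geI by blast
    then show False by simp
  qed
  then show ?thesis using k0 e by (simp add: P_def)
qed

lemma (in group) primary_part_pow:
  assumes e: "e \<in> carrier G" "ord e > 0" and q: "Factorial_Ring.prime q"
  shows "e [^] (ord e div q ^ multiplicity q (ord e)) \<in> p_part G q"
proof -
  have "(e [^] (ord e div q ^ multiplicity q (ord e))) [^] (q ^ multiplicity q (ord e)) = e [^] ord e"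
    using e by (simp add: nat_pow_pow multiplicity_dvd)
  then show ?thesis using e unfolding p_part_def by auto
qed

lemma (in group) prime_divisorsI:
  assumes "Factorial_Ring.prime p" "x \<in> carrier G" "x [^] p = \<one>" "x \<noteq> \<one>"
  shows "p \<in> prime_divisors G" "ord x = p"
proof -
  have "ord x dvd p" "ord x \<noteq> 1" using assms pow_eq_id ord_eq_1 by auto
  then show "ord x = p" using assms(1) prime_nat_iff by blast
  then show "p \<in> prime_divisors G" using assms(1,2) by (auto simp: prime_divisors_def intro!: bexI[of _ x])
qed

context dedekind begin

text \<open>Inside C, any r elements generate a group of order at most n^r, so the subgroup
  generated by n^r + 1 elements of C would contradict the rank bound r.\<close>

lemma finite_subgroup_of_finite_rank:
  assumes r: "finite_rank G" and C: "subgroup C G" and n: "n > 0" "\<And>x. x \<in> C \<Longrightarrow> x [^] (n::nat) = \<one>"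
  shows "finite C"
proof (rule ccontr)
  assume inf: "infinite C"
  obtain r where r: "\<forall>S. finite S \<and> S \<subseteq> carrier G \<longrightarrow>
      (\<exists>T. finite T \<and> T \<subseteq> carrier G \<and> card T \<le> r \<and> generate G T = generate G S)"
    using r[unfolded finite_rank_def] ..
  obtain S where S: "S \<subseteq> C" "finite S" "card S = Suc (n ^ r)"
    using inf infinite_arbitrarily_large by blast
  have SG: "S \<subseteq> carrier G" using S(1) C subgroup.subset by blast
  obtain T where T: "finite T" "T \<subseteq> carrier G" "card T \<le> r" "generate G T = generate G S"
    using r[rule_format, OF conjI[OF S(2) SG]] by metis
  have "T \<subseteq> generate G S" unfolding T(4)[symmetric] by (rule subset_generate)
  also have "\<dots> \<subseteq> C" using S(1) C by (rule generate_subgroup_incl)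
  finally have TC: "T \<subseteq> C" .
  have gen: "finite (generate G T) \<and> card (generate G T) \<le> n ^ card T"
    using T TC n cyc by (intro normal_cyc_torsion_generate) auto
  have "S \<subseteq> generate G T" unfolding T(4) by (rule subset_generate)
  then have "card S \<le> card (generate G T)" using gen by (intro card_mono) simp_all
  also have "\<dots> \<le> n ^ card T" using gen by simp
  also have "\<dots> \<le> n ^ r" using T(3) n(1) by (intro power_increasing) simp_all
  finally show False using S(3) by simp
qed

text \<open>E lies in the subgroup generated by its primary elements. There are finitely many of
  these, and in a Dedekind group they generate a finite group.\<close>

lemma finite_subgroup_of_finite_parts:
  assumes per: "\<And>x. x \<in> carrier G \<Longrightarrow> ord x > 0" and E: "subgroup E G"
    and fin: "finite (prime_divisors G)" "\<And>p. p \<in> prime_divisors G \<Longrightarrow> finite (E \<inter> p_part G p)"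
  shows "finite E"
proof -
  define F where "F = (\<Union>p\<in>prime_divisors G. E \<inter> p_part G p)"
  have F: "finite F" unfolding F_def using fin by (rule finite_UN_I)
  have FG: "F \<subseteq> carrier G" by (auto simp: F_def p_part_def)
  define n where "n = (\<Prod>x\<in>F. ord x)"
  have n: "n > 0" using F FG per by (auto simp: n_def intro!: prod_pos)
  have "x [^] n = \<one>" if "x \<in> F" for x
    using that F FG pow_eq_id[of x n] by (auto simp: n_def)
  then have "finite (generate G F)"
    using normal_cyc_torsion_generate[OF F _ n] cyc FG by blast
  moreover have "E \<subseteq> generate G F"
  proof
    fix e assume e: "e \<in> E"
    then have eG: "e \<in> carrier G" using E subgroup.subset by blast
    show "e \<in> generate G F"
    proof (rule mem_subgroup_of_primary_parts)
      show "subgroup (generate G F) G" using FG by (rule generate_is_subgroup)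
      fix q assume q: "Factorial_Ring.prime q" "q dvd ord e"
      let ?z = "e [^] (ord e div q ^ multiplicity q (ord e))"
      have "?z \<in> E" using subgroup_int_pow_closed[OF E e, of "int _"] by (simp add: int_pow_int)
      moreover have "?z \<in> p_part G q" using primary_part_pow eG per q(1) by blast
      moreover have "q \<in> prime_divisors G" using q eG by (auto simp: prime_divisors_def)
      ultimately show "?z \<in> generate G F" by (auto simp: F_def intro: generate.incl)
    qed (use eG per in auto)
  qed
  ultimately show ?thesis by (rule rev_finite_subset)
qed

text \<open>An abelian component is central in the whole group. Raising d to the p'-part b of its
  order lands in the component, so [d, e]^b = 1, while [d, e] is also killed by a power of
  p.\<close>

lemma p_part_commute_of_commute:
  assumes per: "\<And>x. x \<in> carrier G \<Longrightarrow> ord x > 0" and p: "Factorial_Ring.prime p"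
    and comm: "\<And>x y. x \<in> p_part G p \<Longrightarrow> y \<in> p_part G p \<Longrightarrow> x \<otimes> y = y \<otimes> x"
    and d: "d \<in> carrier G" and e: "e \<in> p_part G p"
  shows "d \<otimes> e = e \<otimes> d"
proof -
  have eG: "e \<in> carrier G" using e by (simp add: p_part_def)
  obtain j where j: "e [^] (p ^ j) = \<one>" using e by (auto simp: p_part_def)
  define b where "b = ord d div p ^ multiplicity p (ord d)"
  have "d [^] b \<in> p_part G p" using primary_part_pow[OF d per[OF d] p] by (simp add: b_def)
  then have "d [^] b \<otimes> e = e \<otimes> d [^] b" using comm e by blast
  then have "commutator G (d [^] b) e = \<one>" using commute_iff_commutator[of "d [^] b" e] d eG by blast
  then have 1: "commutator G d e [^] b = \<one>" using commutator_pow(1)[OF d eG] by simp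
  have "commutator G d e [^] (p ^ j) = \<one>"
    using commutator_pow(2)[OF d eG, of "p ^ j", symmetric] j d by simp
  moreover have "coprime b (p ^ j)"
  proof -
    have "\<not> p dvd b" unfolding b_def
      using multiplicity_decompose[of "ord d" p] per[OF d] p not_prime_unit by fastforce
    then show ?thesis using p by (metis coprime_commute coprime_power_left_iff prime_imp_coprime)
  qed
  ultimately show ?thesis
    using 1 pow_gcd_eq_one[of "commutator G d e" b "p ^ j"] d eG by (simp add: commute_iff_commutator)
qed

end

lemma (in group) comm_group_carrier_iff:
  assumes "subgroup P G"
  shows "comm_group (G\<lparr>carrier := P\<rparr>) \<longleftrightarrow> (\<forall>x\<in>P. \<forall>y\<in>P. x \<otimes> y = y \<otimes> x)"
proof
  assume "comm_group (G\<lparr>carrier := P\<rparr>)"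
  then interpret C: comm_group "G\<lparr>carrier := P\<rparr>" .
  show "\<forall>x\<in>P. \<forall>y\<in>P. x \<otimes> y = y \<otimes> x" using C.m_comm by simp
next
  assume "\<forall>x\<in>P. \<forall>y\<in>P. x \<otimes> y = y \<otimes> x"
  then show "comm_group (G\<lparr>carrier := P\<rparr>)"
    by (intro group.group_comm_groupI subgroup_imp_group[OF assms]) simp
qed

lemma (in group) ord_consistent:
  assumes "subgroup P G" "x \<in> P"
  shows "group.ord (G\<lparr>carrier := P\<rparr>) x = ord x"
proof -
  interpret P: group "G\<lparr>carrier := P\<rparr>" by (rule subgroup_imp_group[OF assms(1)])
  have "x [^]\<^bsub>G\<lparr>carrier := P\<rparr>\<^esub> (n::nat) = x [^] n" for n
    by (rule nat_pow_consistent[symmetric])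
  moreover have "x \<in> carrier G" using assms subgroup.mem_carrier by metis
  ultimately show ?thesis using P.ord_unique[of x "ord x"] pow_eq_id[of x] assms(2) by simp
qed

lemma (in dedekind) p_part_dedekind: "dedekind (G\<lparr>carrier := p_part G p\<rparr>)"
  using dedekind_subgroup[OF subgroup_p_part] cyc by (auto simp: p_part_def)

text \<open>\<open>nonabelian_p_group\<close> for a primary component, with powers, products and
  inverses expressed in the ambient group.\<close>

lemma (in dedekind) p_part_nonabelian:
  assumes p: "Factorial_Ring.prime p" and nc: "\<not> comm_group (G\<lparr>carrier := p_part G p\<rparr>)"
  obtains C where "p = 2" "subgroup C (G\<lparr>carrier := p_part G p\<rparr>)" "\<And>w. w \<in> C \<Longrightarrow> w [^] (2::nat) = \<one>"
    "finite C \<Longrightarrow> finite (p_part G p)"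
    "\<And>f. \<lbrakk>f \<in> hom (G\<lparr>carrier := p_part G p\<rparr>) (G\<lparr>carrier := p_part G p\<rparr>);
       \<And>x. x \<in> p_part G p \<Longrightarrow> \<exists>k::int. f x = x [^] k;
       \<And>x. x \<in> p_part G p \<Longrightarrow> f x = \<one> \<Longrightarrow> x = \<one>\<rbrakk>
      \<Longrightarrow> \<exists>q\<in>p_part G p. \<forall>d\<in>p_part G p. f d = q \<otimes> d \<otimes> inv q"
proof -
  let ?H = "G\<lparr>carrier := p_part G p\<rparr>"
  interpret H: dedekind ?H by (rule p_part_dedekind)
  note sub = subgroup_p_part[of p]
  obtain a b where ab: "a \<in> p_part G p" "b \<in> p_part G p" "a \<otimes> b \<noteq> b \<otimes> a"
    using nc comm_group_carrier_iff[OF sub] by blast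
  have pw: "x [^]\<^bsub>?H\<^esub> (n::nat) = x [^] n" for x n by (rule nat_pow_consistent[symmetric])
  have "\<exists>n. x [^]\<^bsub>?H\<^esub> (p ^ n) = \<one>\<^bsub>?H\<^esub>" if "x \<in> carrier ?H" for x
    using that unfolding pw by (simp add: p_part_def)
  note pg = this
  show thesis
  proof (rule H.nonabelian_p_group[OF p pg])
    show "a \<in> carrier ?H" "b \<in> carrier ?H" "a \<otimes>\<^bsub>?H\<^esub> b \<noteq> b \<otimes>\<^bsub>?H\<^esub> a" using ab by simp_all
    fix C assume C: "p = 2" "subgroup C ?H" "\<And>w. w \<in> C \<Longrightarrow> w [^]\<^bsub>?H\<^esub> (2::nat) = \<one>\<^bsub>?H\<^esub>"
      "finite C \<Longrightarrow> finite (carrier ?H)"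
      "\<And>f. \<lbrakk>f \<in> hom ?H ?H; \<And>x. x \<in> carrier ?H \<Longrightarrow> \<exists>k::int. f x = x [^]\<^bsub>?H\<^esub> k;
         \<And>x. x \<in> carrier ?H \<Longrightarrow> f x = \<one>\<^bsub>?H\<^esub> \<Longrightarrow> x = \<one>\<^bsub>?H\<^esub>\<rbrakk>
        \<Longrightarrow> \<exists>q\<in>carrier ?H. \<forall>d\<in>carrier ?H. f d = q \<otimes>\<^bsub>?H\<^esub> d \<otimes>\<^bsub>?H\<^esub> inv\<^bsub>?H\<^esub> q"
    show thesis
    proof (rule that[OF C(1,2)])
      show "w [^] (2::nat) = \<one>" if "w \<in> C" for w using C(3)[OF that] pw by simp
      show "finite (p_part G p)" if "finite C" using C(4)[OF that] by simp
      fix f assume f: "f \<in> hom ?H ?H" "\<And>x. x \<in> p_part G p \<Longrightarrow> \<exists>k::int. f x = x [^] k"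
         "\<And>x. x \<in> p_part G p \<Longrightarrow> f x = \<one> \<Longrightarrow> x = \<one>"
      have "\<exists>k::int. f x = x [^]\<^bsub>?H\<^esub> k" if "x \<in> carrier ?H" for x
        using f(2)[of x] that int_pow_consistent[OF sub, of x] by simp
      then obtain q where "q \<in> carrier ?H" "\<forall>d\<in>carrier ?H. f d = q \<otimes>\<^bsub>?H\<^esub> d \<otimes>\<^bsub>?H\<^esub> inv\<^bsub>?H\<^esub> q"
        using C(5)[OF f(1)] f(3) by auto
      then show "\<exists>q\<in>p_part G p. \<forall>d\<in>p_part G p. f d = q \<otimes> d \<otimes> inv q"
        using m_inv_consistent[OF sub] by auto
    qed
  qed
qed

section \<open>Exponents in the p-adic integers\<close>

lemma dvd_power_minus_one:
  assumes "(q::int) dvd a - 1"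
  shows "q dvd a ^ n - 1"
  using assms by (simp add: power_diff_1_eq)

text \<open>Every summand is 1 modulo p, so the sum is congruent to m.\<close>

lemma prime_not_dvd_geometric_sum:
  assumes p: "Factorial_Ring.prime (p::nat)" and a: "int p dvd a - 1" and m: "\<not> p dvd m"
  shows "coprime (int p) (\<Sum>i<m. a ^ i)"
proof -
  have "int p dvd (\<Sum>i<m. a ^ i - 1)"
    using a by (intro dvd_sum dvd_power_minus_one)
  then have "int p dvd (\<Sum>i<m. a ^ i) - int m" by (simp add: sum_subtractf)
  then have "int p dvd (\<Sum>i<m. a ^ i) \<longleftrightarrow> int p dvd int m"
    by (metis diff_add_cancel dvd_add_right_iff)
  then have "\<not> int p dvd (\<Sum>i<m. a ^ i)"
    using m by simp
  then show ?thesis using p by (simp add: prime_imp_coprime)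
qed

text \<open>Lifting the exponent, as an upper bound on the multiplicity of p in a^m - 1. If p does
  not divide m, the geometric sum is prime to p. If m = p k, then a^m - 1 is a^k - 1 times p times a
  number prime to p, so one factor p cancels against the p in m and the induction continues with
  k.\<close>

lemma prime_power_dvd_power_minus_one:
  assumes p: "Factorial_Ring.prime (p::nat)" and m: "m > 0"
    and a: "int p dvd a - 1" "p = 2 \<Longrightarrow> 4 dvd a - 1"
    and dvd: "int p ^ n dvd a ^ m - 1"
  shows "int p ^ n dvd int m * (a - 1)"
  using m dvd
proof (induction m arbitrary: n rule: less_induct)
  case (less m)
  have fac: "b ^ k - 1 = (b - 1) * (\<Sum>i<k. b ^ i)" for b :: int and k
    by (rule power_diff_1_eq)
  show ?case
  proof (cases "p dvd m")
    case False
    have "coprime (int p ^ n) (\<Sum>i<m. a ^ i)"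
      using prime_not_dvd_geometric_sum[OF p a(1) False] by simp
    then have "int p ^ n dvd a - 1"
      using less.prems(2) unfolding fac by (simp add: coprime_dvd_mult_left_iff)
    then show ?thesis by simp
  next
    case True
    then obtain k where k: "m = p * k" using dvdE by blast
    have pp: "p > 1" using p prime_gt_1_nat by blast
    have k0: "k > 0" "k < m" using less.prems(1) pp by (auto simp: k)
    define b where "b = a ^ k"
    obtain z where z: "b = 1 + int p * z"
      using dvd_power_minus_one[OF a(1), of k] unfolding b_def
      by (metis add.commute diff_add_cancel dvd_def)
    \<comment> \<open>Exactly one factor p occurs. For p = 2 the sum is 2 + 4 w. For odd p, b^i is 1
      + i p z modulo the square of p, and the sum of all i below p is itself divisible by p, so the
      linear terms vanish modulo that square.\<close>
    have "\<exists>s. (\<Sum>i<p. b ^ i) = int p * s \<and> coprime (int p) s"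
    proof (cases "p = 2")
      case True
      obtain w where "b = 1 + 4 * w"
        using dvd_power_minus_one[OF a(2)[OF True], of k] unfolding b_def
        by (metis add.commute diff_add_cancel dvd_def)
      then have "(\<Sum>i<p. b ^ i) = int p * (1 + 2 * w)" by (simp add: True numeral_2_eq_2)
      moreover have "coprime (int p) (1 + 2 * w)" by (simp add: True)
      ultimately show ?thesis by blast
    next
      case False
      then have odd: "odd p" using p prime_odd_nat pp by fastforce
      have bi: "\<exists>r. b ^ i = 1 + int i * int p * z + int p * int p * r" for i
      proof (induction i)
        case 0 then show ?case by (intro exI[of _ 0]) simp
      next
        case (Suc i)
        then obtain r where r: "b ^ i = 1 + int i * int p * z + int p * int p * r" by blast
        show ?case unfolding power_Suc r
          by (intro exI[of _ "r + int i * z * z + int p * z * r"]) (simp add: z algebra_simps)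
      qed
      then obtain r where r: "\<And>i. b ^ i = 1 + int i * int p * z + int p * int p * r i" by metis
      obtain h where h: "p - 1 = 2 * h" using odd by (metis even_diff_nat evenE odd_one less_imp_le pp dvdE odd_even_add)
      have "(\<Sum>i<p. int i) = int p * int h"
      proof -
        have "2 * (\<Sum>i<Suc k. i) = Suc k * k" for k
          by (induction k) simp_all
        from this[of "p - 1"] have "(\<Sum>i<p. i) = p * h" using h pp by simp
        then have "int (\<Sum>i<p. i) = int (p * h)" by simp
        then show ?thesis by simp
      qed
      then have "(\<Sum>i<p. b ^ i) = int p * (1 + int p * (z * int h + (\<Sum>i<p. r i)))"
        by (simp add: r sum.distrib algebra_simps flip: sum_distrib_left sum_distrib_right)
      moreover have "coprime (int p) (1 + int p * (z * int h + (\<Sum>i<p. r i)))"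
        by (rule coprimeI) (metis dvd_add_left_iff dvd_mult2)
      ultimately show ?thesis by blast
    qed
    then obtain s where s: "(\<Sum>i<p. b ^ i) = int p * s" "coprime (int p) s" by blast
    have "a ^ m - 1 = b ^ p - 1" by (simp add: b_def k power_mult mult.commute)
    also have "\<dots> = (b - 1) * int p * s" unfolding fac s(1) by simp
    finally have "int p ^ n dvd (b - 1) * int p * s" using less.prems(2) by simp
    then have d: "int p ^ n dvd (b - 1) * int p" using s(2) by (simp add: coprime_dvd_mult_left_iff)
    show ?thesis
    proof (cases n)
      case (Suc n')
      then have "int p ^ n' dvd a ^ k - 1" using d pp by (simp add: b_def mult.commute)
      then have "int p ^ n' dvd int k * (a - 1)" using less.IH k0 by blast
      then show ?thesis by (simp add: k Suc mult.assoc)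
    qed simp
  qed
qed

text \<open>Multiplicities add, so one of the two factors carries its share.\<close>

lemma prime_power_dvd_mult_cases:
  assumes p: "Factorial_Ring.prime (p::int)" and "p ^ (a + b) dvd x * y"
  shows "p ^ a dvd x \<or> p ^ b dvd y"
proof (cases "x = 0 \<or> y = 0")
  case False
  then have "a + b \<le> multiplicity p (x * y)"
    using assms by (intro multiplicity_geI) (auto dest: not_prime_unit)
  also have "\<dots> = multiplicity p x + multiplicity p y"
    using prime_elem_multiplicity_mult_distrib[OF Factorial_Ring.prime_imp_prime_elem[OF p], of x y] False
    by simp
  finally have "a \<le> multiplicity p x \<or> b \<le> multiplicity p y" by linarith
  then show ?thesis using multiplicity_dvd' by blast
qed auto

section \<open>Residues of p-adic integers\<close>

lemma padic_mod:
  assumes "t \<in> carrier (padic_ring p)" "k \<le> n"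
  shows "t n mod int p ^ k = t k"
  using assms(2)
proof (induction n rule: dec_induct)
  case base
  then show ?case using assms(1) by (auto simp: padic_ring_def)
next
  case (step n)
  have "t (Suc n) mod int p ^ k = (t (Suc n) mod int p ^ n) mod int p ^ k"
    using step.hyps by (simp add: mod_mod_cancel le_imp_power_dvd)
  also have "\<dots> = t n mod int p ^ k" using assms(1) by (simp add: padic_ring_def)
  finally show ?case using step.IH by simp
qed

lemma padic_uminus_one:
  assumes "p > 0"
  shows "\<ominus>\<^bsub>padic_ring p\<^esub> \<one>\<^bsub>padic_ring p\<^esub> = (\<lambda>n. (- 1) mod int p ^ n)"
proof -
  interpret R: cring "padic_ring p" using assms by (rule cring_padic_ring)
  have "(\<lambda>n. (- 1) mod int p ^ n) \<in> carrier (padic_ring p)"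
    using assms by (simp add: padic_ring_def mod_mod_cancel)
  moreover have "(\<lambda>n. (- 1) mod int p ^ n) \<oplus>\<^bsub>padic_ring p\<^esub> \<one>\<^bsub>padic_ring p\<^esub> = \<zero>\<^bsub>padic_ring p\<^esub>"
    by (simp add: padic_ring_def mod_simps)
  ultimately show ?thesis by (intro R.minus_equality) simp_all
qed

lemma padic_of_nat:
  "[k] \<cdot>\<^bsub>padic_ring p\<^esub> \<one>\<^bsub>padic_ring p\<^esub> = (\<lambda>n. int k mod int p ^ n)"
  by (induction k) (simp_all add: add_pow_def padic_ring_def mod_simps add.commute fun_eq_iff)

lemma padic_minus_one:
  assumes "p > 0" "t \<in> carrier (padic_ring p)"
  shows "t \<ominus>\<^bsub>padic_ring p\<^esub> \<one>\<^bsub>padic_ring p\<^esub> = (\<lambda>n. (t n - 1) mod int p ^ n)"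
  using assms by (simp add: a_minus_def padic_uminus_one) (simp add: padic_ring_def mod_simps)

text \<open>Translates divisibility in the ring into the first residue, the form in which the
  congruence is used from here on.\<close>

lemma padic_dvd_minus_one_iff:
  assumes p: "p > 1" and t: "t \<in> carrier (padic_ring p)"
  shows "([p] \<cdot>\<^bsub>padic_ring p\<^esub> \<one>\<^bsub>padic_ring p\<^esub>) divides\<^bsub>padic_ring p\<^esub>
      (t \<ominus>\<^bsub>padic_ring p\<^esub> \<one>\<^bsub>padic_ring p\<^esub>) \<longleftrightarrow> t 1 = 1"
proof
  assume "([p] \<cdot>\<^bsub>padic_ring p\<^esub> \<one>\<^bsub>padic_ring p\<^esub>) divides\<^bsub>padic_ring p\<^esub>
      (t \<ominus>\<^bsub>padic_ring p\<^esub> \<one>\<^bsub>padic_ring p\<^esub>)"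
  then obtain c where "t \<ominus>\<^bsub>padic_ring p\<^esub> \<one>\<^bsub>padic_ring p\<^esub>
      = ([p] \<cdot>\<^bsub>padic_ring p\<^esub> \<one>\<^bsub>padic_ring p\<^esub>) \<otimes>\<^bsub>padic_ring p\<^esub> c"
    by (auto simp: factor_def)
  then have "(\<lambda>n. (t n - 1) mod int p ^ n) = (\<lambda>n. (int p mod int p ^ n * c n) mod int p ^ n)"
    using p t by (simp add: padic_minus_one padic_of_nat) (simp add: padic_ring_def)
  then have "(t 1 - 1) mod int p ^ 1 = (int p mod int p ^ 1 * c 1) mod int p ^ 1" by (rule fun_cong)
  then have "int p dvd t 1 - 1" by (simp add: dvd_eq_mod_eq_0)
  then have "t 1 mod int p = 1 mod int p" by (simp add: mod_eq_dvd_iff)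
  moreover have "0 \<le> t 1" "t 1 < int p" using t by (auto simp: padic_ring_def dest: spec[of _ 1])
  ultimately show "t 1 = 1" using p by simp
next
  assume t1: "t 1 = 1"
  \<comment> \<open>Division by p loses one digit, so the quotient modulo p^n is read off from the
    residue of t modulo p^(n + 1).\<close>
  define c where "c = (\<lambda>n. ((t (Suc n) - 1) div int p) mod int p ^ n)"
  have pd: "int p dvd t (Suc n) - 1" for n
    using padic_mod[OF t, of 1 "Suc n"] t1 p by (simp add: mod_eq_dvd_iff[symmetric])
  have "c (Suc n) mod int p ^ n = c n" for n
  proof -
    have "int p ^ Suc n dvd t (Suc (Suc n)) - t (Suc n)"
      using padic_mod[OF t, of "Suc n" "Suc (Suc n)"] padic_mod[OF t, of "Suc n" "Suc n"]
      by (metis le_SucI mod_eq_dvd_iff order_refl)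
    also have "t (Suc (Suc n)) - t (Suc n) = int p * ((t (Suc (Suc n)) - 1) div int p - (t (Suc n) - 1) div int p)"
      using pd[of n] pd[of "Suc n"] by (simp add: right_diff_distrib)
    finally have "int p ^ n dvd (t (Suc (Suc n)) - 1) div int p - (t (Suc n) - 1) div int p"
      using p by simp
    then show ?thesis by (simp add: c_def mod_mod_cancel mod_eq_dvd_iff)
  qed
  then have "c \<in> carrier (padic_ring p)" using p by (auto simp: padic_ring_def c_def)
  moreover have "(t n - 1) mod int p ^ n = (int p mod int p ^ n * c n) mod int p ^ n" for n
  proof -
    have "(int p mod int p ^ n * c n) mod int p ^ n = (int p * ((t (Suc n) - 1) div int p)) mod int p ^ n"
      by (simp add: c_def mod_simps)
    also have "\<dots> = (t (Suc n) - 1) mod int p ^ n" using pd[of n] by simp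
    also have "\<dots> = (t n - 1) mod int p ^ n"
      using padic_mod[OF t, of n "Suc n"] by (metis le_SucI mod_diff_left_eq order_refl)
    finally show ?thesis ..
  qed
  ultimately show "([p] \<cdot>\<^bsub>padic_ring p\<^esub> \<one>\<^bsub>padic_ring p\<^esub>) divides\<^bsub>padic_ring p\<^esub>
      (t \<ominus>\<^bsub>padic_ring p\<^esub> \<one>\<^bsub>padic_ring p\<^esub>)"
    using p t unfolding factor_def
    by (intro bexI[of _ c]) (simp_all add: padic_minus_one padic_of_nat, simp add: padic_ring_def)
qed

text \<open>The exponents \<open>1\<close> and, for \<open>p = 2\<close>, \<open>-1\<close> are the only ones of finite multiplicative order.\<close>

lemma padic_power_bounded:
  assumes p: "Factorial_Ring.prime (p::nat)" and t: "t \<in> carrier (padic_ring p)" "t 1 = 1"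
    and ne: "t \<noteq> \<one>\<^bsub>padic_ring p\<^esub>" "p = 2 \<Longrightarrow> t \<noteq> \<ominus>\<^bsub>padic_ring p\<^esub> \<one>\<^bsub>padic_ring p\<^esub>"
    and m: "m > 0"
  obtains B where "\<And>n. int p ^ n dvd t n ^ m - 1 \<Longrightarrow> n \<le> B"
proof -
  have pp: "p > 1" using p prime_gt_1_nat by blast
  have pi: "Factorial_Ring.prime (int p)" using p by simp
  \<comment> \<open>Since m < p^m, the factor m absorbs fewer than m factors p. This is the origin
    of the summand m in both bounds.\<close>
  have ndvd: "\<not> int p ^ m dvd int m"
  proof
    assume "int p ^ m dvd int m"
    then have "p ^ m dvd m" by (metis int_dvd_int_iff of_nat_power)
    then have "p ^ m \<le> m" using m by (rule dvd_imp_le)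
    moreover have "m < p ^ m" using pp by (simp add: power_gt_expt)
    ultimately show False by simp
  qed
  \<comment> \<open>If t differs from the integer u at level k, then by coherence no later residue
    is congruent to u modulo p^k, so the multiplicity of p in the difference stays below k.\<close>
  have ndvd_one: "\<exists>k. \<forall>n\<ge>k. \<not> int p ^ k dvd t n - u" if ne': "\<exists>k. t k \<noteq> u mod int p ^ k" for u
  proof -
    obtain k where k: "t k \<noteq> u mod int p ^ k" using ne' by blast
    have "\<not> int p ^ k dvd t n - u" if "n \<ge> k" for n
      using k padic_mod[OF t(1) that] by (simp add: mod_eq_dvd_iff[symmetric])
    then show ?thesis by blast
  qed
  obtain k where k: "\<And>n. n \<ge> k \<Longrightarrow> \<not> int p ^ k dvd t n - 1"
    using ndvd_one[of 1] ne(1) by (auto simp: padic_ring_def fun_eq_iff)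
  have cong1: "int p dvd t n - 1" if "n > 0" for n
    using padic_mod[OF t(1), of 1 n] that t(2) pp by (simp add: mod_eq_dvd_iff[symmetric])
  show thesis
  proof (cases "p = 2")
    case False
    have "n \<le> m + k" if d: "int p ^ n dvd t n ^ m - 1" for n
    proof (rule ccontr)
      assume n: "\<not> n \<le> m + k"
      have "int p ^ n dvd int m * (t n - 1)"
        using d cong1 n False by (intro prime_power_dvd_power_minus_one[OF p m]) auto
      then have "int p ^ (m + k) dvd int m * (t n - 1)"
        using n by (meson dvd_trans le_imp_power_dvd nat_le_linear)
      then show False using prime_power_dvd_mult_cases[OF pi] ndvd k[of n] n by fastforce
    qed
    then show thesis by (rule that)
  next
    case True
    obtain k' where k': "\<And>n. n \<ge> k' \<Longrightarrow> \<not> int p ^ k' dvd t n - (- 1)"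
      using ndvd_one[of "- 1"] ne(2)[OF True] pp by (auto simp: padic_uminus_one fun_eq_iff)
    have "n \<le> m + (k + k')" if d: "int p ^ n dvd t n ^ m - 1" for n
    proof (rule ccontr)
      assume n: "\<not> n \<le> m + (k + k')"
      have odd: "odd (t n)" using cong1[of n] n True by simp
      then obtain w where w: "t n = 2 * w + 1" using oddE by blast
      \<comment> \<open>The square of an odd residue is 1 modulo 4, as lifting requires for p = 2.
        The price is the extra factor t + 1, whose multiplicity is bounded because t is not
        -1.\<close>
      have sq: "(t n)\<^sup>2 - 1 = 4 * (w * (w + 1))" by (simp add: w power2_eq_square algebra_simps)
      have "4 dvd (t n)\<^sup>2 - 1" unfolding sq by simp
      moreover have "int p dvd (t n)\<^sup>2 - 1" unfolding sq by (simp add: True)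
      moreover have "int p ^ n dvd ((t n)\<^sup>2) ^ m - 1"
      proof -
        have "((t n)\<^sup>2) ^ m - 1 = (t n ^ m - 1) * (t n ^ m + 1)"
          by (simp add: algebra_simps power2_eq_square power_mult_distrib)
        then show ?thesis using d by simp
      qed
      ultimately have "int p ^ n dvd int m * ((t n)\<^sup>2 - 1)"
        by (intro prime_power_dvd_power_minus_one[OF p m]) auto
      then have "int p ^ (m + (k + k')) dvd int m * ((t n)\<^sup>2 - 1)"
        using n by (meson dvd_trans le_imp_power_dvd nat_le_linear)
      then have "int p ^ (k + k') dvd (t n)\<^sup>2 - 1"
        using prime_power_dvd_mult_cases[OF pi] ndvd by blast
      also have "(t n)\<^sup>2 - 1 = (t n - 1) * (t n - (- 1))" by (simp add: algebra_simps power2_eq_square)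
      finally show False using prime_power_dvd_mult_cases[OF pi] k[of n] k'[of n] n by fastforce
    qed
    then show thesis by (rule that)
  qed
qed

section \<open>The semidirect product\<close>

lemma (in group) lower_central_subgroup: "subgroup (lower_central G n) G"
proof (induction n)
  case (Suc n)
  then have "lower_central G n \<subseteq> carrier G" by (rule subgroup.subset)
  then show ?case by (auto intro!: generate_is_subgroup)
qed (simp add: subgroup_self)

text \<open>Bounds one term of the series of a subgroup H by a subgroup of G, with commutators
  computed in G. Iterating it replaces any explicit determination of the series.\<close>

lemma (in group) lower_central_carrier_update_Suc:
  assumes H: "subgroup H G" and K: "subgroup K G"
    and comm: "\<And>x y. x \<in> lower_central (G\<lparr>carrier := H\<rparr>) n \<Longrightarrow> y \<in> H \<Longrightarrow> commutator G x y \<in> K"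
  shows "lower_central (G\<lparr>carrier := H\<rparr>) (Suc n) \<subseteq> K"
proof -
  let ?H = "G\<lparr>carrier := H\<rparr>"
  interpret H: group ?H using H by (rule subgroup_imp_group)
  have sub: "subgroup (lower_central ?H n) ?H" by (rule H.lower_central_subgroup)
  then have LH: "x \<in> H" if "x \<in> lower_central ?H n" for x
    using subgroup.mem_carrier[OF sub that] by simp
  define W where "W = {x \<otimes> y \<otimes> inv\<^bsub>?H\<^esub> x \<otimes> inv\<^bsub>?H\<^esub> y | x y. x \<in> lower_central ?H n \<and> y \<in> H}"
  have W: "lower_central ?H (Suc n) = generate ?H W" by (simp add: W_def)
  have WH: "W \<subseteq> H"
    using LH H by (auto simp: W_def subgroup.m_closed subgroup.m_inv_closed)
  have WK: "W \<subseteq> K"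
    using comm LH H by (auto simp: W_def)
  have "generate ?H W = generate G W" using generate_consistent[OF WH H] .
  also have "\<dots> \<subseteq> K" using WK K by (rule generate_subgroup_incl)
  finally show ?thesis unfolding W .
qed

section \<open>Integer powers of the power automorphism\<close>

locale fci_data = dedekind D for D (structure) +
  fixes \<phi> t
  assumes datum: "fci_datum D \<phi> t"
begin

interpretation A: group "AutoGroup D" by (rule AutoGroup)

lemma per: "x \<in> carrier D \<Longrightarrow> ord x > 0"
proof -
  assume x: "x \<in> carrier D"
  then obtain n :: nat where "n > 0" "x [^] n = \<one>"
    using datum unfolding fci_datum_def periodic_def by blast
  then show "ord x > 0" using ord_le_pow_eq_one(1) x by blast
qed

lemma phi_auto: "\<phi> \<in> auto D"
  using datum by (simp add: fci_datum_def power_automorphism_def)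

lemma phi_power: "x \<in> carrier D \<Longrightarrow> \<exists>k::int. \<phi> x = x [^] k"
  using datum by (simp add: fci_datum_def power_automorphism_def)

definition \<Phi> :: "int \<Rightarrow> 'a \<Rightarrow> 'a" where "\<Phi> m = \<phi> [^]\<^bsub>AutoGroup D\<^esub> m"

lemma carrier_A: "carrier (AutoGroup D) = auto D"
  by (simp add: AutoGroup_def)

lemma Phi_auto: "\<Phi> m \<in> auto D"
  using A.int_pow_closed[of \<phi> m] phi_auto by (simp add: \<Phi>_def carrier_A)

lemma Phi_hom: "\<Phi> m \<in> hom D D"
  using Phi_auto by (simp add: auto_def)

lemma Phi_closed [simp]: "x \<in> carrier D \<Longrightarrow> \<Phi> m x \<in> carrier D"
  using Phi_hom by (rule hom_in_carrier)

lemma A_mult: "f \<in> auto D \<Longrightarrow> h \<in> auto D \<Longrightarrow> x \<in> carrier D \<Longrightarrow> (f \<otimes>\<^bsub>AutoGroup D\<^esub> h) x = f (h x)"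
  by (simp add: AutoGroup_def BijGroup_def auto_def compose_eq)

lemma Phi_add: "x \<in> carrier D \<Longrightarrow> \<Phi> (m + n) x = \<Phi> m (\<Phi> n x)"
  using A.int_pow_mult[of \<phi> m n] phi_auto Phi_auto[of m] Phi_auto[of n]
  by (simp add: \<Phi>_def carrier_A A_mult)

lemma Phi_0 [simp]: "x \<in> carrier D \<Longrightarrow> \<Phi> 0 x = x"
  by (simp add: \<Phi>_def AutoGroup_def BijGroup_def)

lemma Phi_1: "\<Phi> 1 = \<phi>"
  using phi_auto by (simp add: \<Phi>_def carrier_A)

lemma Phi_minus: "x \<in> carrier D \<Longrightarrow> \<Phi> (- m) (\<Phi> m x) = x" "x \<in> carrier D \<Longrightarrow> \<Phi> m (\<Phi> (- m) x) = x"
  by (simp_all flip: Phi_add)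

lemma Phi_mult: "x \<in> carrier D \<Longrightarrow> y \<in> carrier D \<Longrightarrow> \<Phi> m (x \<otimes> y) = \<Phi> m x \<otimes> \<Phi> m y"
  using Phi_hom by (rule hom_mult)

lemma Phi_int_pow: "x \<in> carrier D \<Longrightarrow> \<Phi> m (x [^] (k::int)) = \<Phi> m x [^] k"
  using hom_int_pow[OF Phi_hom _ is_group is_group] .

lemma Phi_inv: "x \<in> carrier D \<Longrightarrow> \<Phi> m (inv x) = inv (\<Phi> m x)"
  using Phi_int_pow[of x m "-1"] by (simp add: int_pow_neg)

lemma Phi_one [simp]: "\<Phi> m \<one> = \<one>"
  using hom_one[OF Phi_hom is_group is_group] .

lemma Phi_inj: "x \<in> carrier D \<Longrightarrow> y \<in> carrier D \<Longrightarrow> \<Phi> m x = \<Phi> m y \<Longrightarrow> x = y"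
  using Phi_minus(1) by metis

lemma Phi_power_nat: "x \<in> carrier D \<Longrightarrow> \<exists>k::int. \<Phi> (int n) x = x [^] k"
proof (induction n)
  case 0
  then show ?case by (intro exI[of _ 1]) simp
next
  case (Suc n)
  then obtain k :: int where k: "\<Phi> (int n) x = x [^] k" by blast
  obtain l :: int where l: "\<phi> x = x [^] l" using phi_power Suc.prems by blast
  have "\<Phi> (int (Suc n)) x = \<Phi> (int n) (\<Phi> 1 x)"
    using Phi_add[OF Suc.prems, of "int n" 1] by (simp add: add.commute)
  also have "\<dots> = x [^] (k * l)" using Suc.prems by (simp add: Phi_1 l Phi_int_pow k int_pow_pow)
  finally show ?case ..
qed

text \<open>For negative m the inverse map sends the finite group <x> injectively into itself, hence
  onto itself, so x has its preimage in <x>. Finiteness of <x> comes from periodicity.\<close>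

lemma Phi_power: "x \<in> carrier D \<Longrightarrow> \<exists>k::int. \<Phi> m x = x [^] k"
proof (cases "m \<ge> 0")
  case True
  then show "x \<in> carrier D \<Longrightarrow> ?thesis" using Phi_power_nat[of x "nat m"] by simp
next
  assume x: "x \<in> carrier D"
  case False
  let ?X = "generate D {x}"
  have fin: "finite ?X" using normal_cyc_torsion_generate[of "{x}" "ord x"] cyc x per[OF x] by simp
  obtain k :: int where k: "\<Phi> (- m) x = x [^] k" using Phi_power_nat[of x "nat (- m)"] x False by auto
  have XD: "?X \<subseteq> carrier D" using x by (simp add: generate_incl)
  have "\<Phi> (- m) ` ?X \<subseteq> ?X"
    using x k by (auto simp: generate_pow Phi_int_pow int_pow_pow)
  moreover have "inj_on (\<Phi> (- m)) ?X" by (intro inj_onI) (meson Phi_inj subsetD XD)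
  ultimately have "\<Phi> (- m) ` ?X = ?X" using fin endo_inj_surj by blast
  then obtain y where y: "y \<in> ?X" "x = \<Phi> (- m) y" using generate.incl[of x "{x}" D] by blast
  then have "\<Phi> m x = y" using Phi_minus(2)[of y m] XD by blast
  then show ?thesis using y(1) x by (simp add: generate_singleton_iff)
qed

section \<open>Conjugation in the semidirect product\<close>

definition "G = cyclic_semidirect D \<phi>"

lemma carrier_G: "carrier G = UNIV \<times> carrier D" and one_G: "\<one>\<^bsub>G\<^esub> = (0, \<one>)"
  and mult_G: "(m, d) \<otimes>\<^bsub>G\<^esub> (n, e) = (m + n, \<Phi> n d \<otimes> e)"
  by (simp_all add: G_def cyclic_semidirect_def \<Phi>_def)

lemma group_G: "group G"
proof (rule groupI)
  fix x y z assume "x \<in> carrier G" "y \<in> carrier G" "z \<in> carrier G"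
  moreover obtain m d n e k f where "x = (m, d)" "y = (n, e)" "z = (k, f)" by (metis surj_pair)
  ultimately show "x \<otimes>\<^bsub>G\<^esub> y \<otimes>\<^bsub>G\<^esub> z = x \<otimes>\<^bsub>G\<^esub> (y \<otimes>\<^bsub>G\<^esub> z)"
    using Phi_add[of d k n] by (simp add: carrier_G mult_G Phi_mult m_assoc add.commute)
next
  fix x assume "x \<in> carrier G"
  moreover obtain m d where x: "x = (m, d)" by (metis surj_pair)
  ultimately have d: "d \<in> carrier D" by (simp add: carrier_G)
  show "\<exists>y\<in>carrier G. y \<otimes>\<^bsub>G\<^esub> x = \<one>\<^bsub>G\<^esub>"
    using d Phi_minus(2)[of "inv d" m]
    by (intro bexI[of _ "(- m, \<Phi> (- m) (inv d))"]) (simp_all add: x mult_G carrier_G one_G)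
qed (auto simp: carrier_G mult_G one_G)

interpretation G: group G by (rule group_G)

lemma embed_hom: "(\<lambda>d. (0, d)) \<in> hom D G"
  by (simp add: hom_def carrier_G mult_G)

lemma embed_int_pow: "d \<in> carrier D \<Longrightarrow> (0, d) [^]\<^bsub>G\<^esub> (k::int) = (0, d [^] k)"
  using hom_int_pow[OF embed_hom _ is_group group_G] by metis

lemma fst_hom: "fst \<in> hom G integer_group"
  by (auto simp: hom_def mult_G)

lemma fst_int_pow: "x \<in> carrier G \<Longrightarrow> fst (x [^]\<^bsub>G\<^esub> (k::int)) = k * fst x"
  using hom_int_pow[OF fst_hom _ group_G group_integer_group] by simp

lemma fst_mult: "x \<in> carrier G \<Longrightarrow> y \<in> carrier G \<Longrightarrow> fst (x \<otimes>\<^bsub>G\<^esub> y) = fst x + fst y"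
  using hom_mult[OF fst_hom] by simp

lemma fst_inv: "x \<in> carrier G \<Longrightarrow> fst (inv\<^bsub>G\<^esub> x) = - fst x"
  using fst_int_pow[of x "- 1"] by (simp add: G.int_pow_neg)

text \<open>The sign of the exponent comes from the convention that g acts by d to g^-1 d g, while
  conjugation here is by the element on the left.\<close>

lemma G_conj:
  assumes "x \<in> carrier D" "d \<in> carrier D"
  shows "(m, d) \<otimes>\<^bsub>G\<^esub> (0, x) \<otimes>\<^bsub>G\<^esub> inv\<^bsub>G\<^esub> (m, d) = (0, \<Phi> (- m) (d \<otimes> x \<otimes> inv d))"
proof -
  have "(m, d) \<otimes>\<^bsub>G\<^esub> (0, x) = (0, \<Phi> (- m) (d \<otimes> x \<otimes> inv d)) \<otimes>\<^bsub>G\<^esub> (m, d)"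
    using assms by (simp add: mult_G Phi_minus m_assoc)
  then show ?thesis using assms G.conj_eq_iff[of "(m, d)" "(0, x)"] by (simp add: carrier_G)
qed

text \<open>Leaves only elements with nonzero integer component to be examined for the FCI
  condition.\<close>

lemma normal_cyc_embed:
  assumes x: "x \<in> carrier D"
  shows "normal_cyc G (0, x)"
  unfolding normal_cyc_def
proof (intro conjI ballI)
  show "(0, x) \<in> carrier G" using x by (simp add: carrier_G)
  fix g assume "g \<in> carrier G"
  moreover obtain m d where g: "g = (m, d)" by (metis surj_pair)
  ultimately have d: "d \<in> carrier D" by (simp add: carrier_G)
  obtain k :: int where k: "d \<otimes> x \<otimes> inv d = x [^] k" using conj_power[OF x d] by metis
  obtain l :: int where l: "\<Phi> (- m) x = x [^] l" using Phi_power x by blast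
  have "g \<otimes>\<^bsub>G\<^esub> (0, x) \<otimes>\<^bsub>G\<^esub> inv\<^bsub>G\<^esub> g = (0, x) [^]\<^bsub>G\<^esub> (l * k)"
    unfolding g using x d by (simp add: G_conj k Phi_int_pow l int_pow_pow embed_int_pow)
  then show "\<exists>k::int. g \<otimes>\<^bsub>G\<^esub> (0, x) \<otimes>\<^bsub>G\<^esub> inv\<^bsub>G\<^esub> g = (0, x) [^]\<^bsub>G\<^esub> k" ..
qed

lemma sylow: "Factorial_Ring.prime p \<Longrightarrow> sylow_component D p = D\<lparr>carrier := p_part D p\<rparr>"
  by (rule sylow_component_eq)

lemma pi_prime: "p \<in> prime_divisors D \<Longrightarrow> Factorial_Ring.prime p"
  by (simp add: prime_divisors_def)

lemma p_part_finite_of_nonabelian: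
  assumes p: "p \<in> prime_divisors D" and nc: "\<not> comm_group (D\<lparr>carrier := p_part D p\<rparr>)"
  shows "finite (p_part D p)"
proof -
  let ?H = "D\<lparr>carrier := p_part D p\<rparr>"
  interpret H: dedekind ?H by (rule p_part_dedekind)
  obtain C where C: "subgroup C ?H" "\<And>w. w \<in> C \<Longrightarrow> w [^] (2::nat) = \<one>" "finite C \<Longrightarrow> finite (p_part D p)"
    using p_part_nonabelian[OF pi_prime[OF p] nc] by metis
  have "finite_rank ?H" using datum p sylow[OF pi_prime[OF p]] unfolding fci_datum_def by auto
  then have "finite C"
    using C(2) by (intro H.finite_subgroup_of_finite_rank[OF _ C(1), of 2]) (simp_all flip: nat_pow_consistent)
  then show ?thesis by (rule C(3))
qed

lemma exponent:
  assumes p: "p \<in> prime_divisors D" and c: "comm_group (D\<lparr>carrier := p_part D p\<rparr>)"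
  shows "t p \<in> carrier (padic_ring p)"
    and "\<And>a n. a \<in> carrier D \<Longrightarrow> ord a = p ^ n \<Longrightarrow> \<phi> a = a [^] t p n"
    and "t p 1 = 1"
proof -
  note pp = pi_prime[OF p]
  let ?H = "D\<lparr>carrier := p_part D p\<rparr>"
  have ex: "is_exponent ?H p (restrict \<phi> (p_part D p)) (t p)"
    using datum p c sylow[OF pp] unfolding fci_datum_def by auto
  then show tc: "t p \<in> carrier (padic_ring p)"
    by (simp add: is_exponent_def Units_def)
  show "\<phi> a = a [^] t p n" if a: "a \<in> carrier D" "ord a = p ^ n" for a n
  proof -
    have aP: "a \<in> p_part D p" using a pow_ord_eq_1[of a] by (auto simp: p_part_def)
    have "multiplicity p (ord a) = n" using a pp not_prime_unit[of p] by (auto simp: multiplicity_same_power)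
    then show ?thesis
      using ex aP int_pow_consistent[OF subgroup_p_part aP]
      by (auto simp: is_exponent_def padic_pow_def ord_consistent[OF subgroup_p_part aP])
  qed
  \<comment> \<open>For odd p this is the assumed congruence. For p = 2 it only says that a unit has
    an odd residue.\<close>
  show "t p 1 = 1"
  proof (cases "p = 2")
    case True
    obtain s where "s \<in> carrier (padic_ring p)" "s \<otimes>\<^bsub>padic_ring p\<^esub> t p = \<one>\<^bsub>padic_ring p\<^esub>"
      using ex by (auto simp: is_exponent_def Units_def)
    then have "(\<lambda>n. (s n * t p n) mod int p ^ n) = (\<lambda>n. 1 mod int p ^ n)" by (simp add: padic_ring_def)
    then have "(s 1 * t p 1) mod int p ^ 1 = 1 mod int p ^ 1" by (rule fun_cong)
    then have "odd (t p 1)" by (auto simp: True)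
    moreover have "0 \<le> t p 1" "t p 1 < 2" using tc by (auto simp: padic_ring_def True dest: spec[of _ 1])
    ultimately show ?thesis by presburger
  next
    case False
    then have "p > 2" using pp prime_ge_2_nat[of p] by simp
    then show ?thesis
      using datum p padic_dvd_minus_one_iff[of p "t p"] tc unfolding fci_datum_def by simp
  qed
qed

text \<open>On an element of order p the exponent acts through its first residue, which is 1; on a
  non-abelian 2-component the automorphism is the identity by assumption.\<close>

lemma prime_order_fixed:
  assumes p: "Factorial_Ring.prime (p::nat)" and z: "z \<in> carrier D" "z [^] p = \<one>"
  shows "\<Phi> m z = z"
proof -
  have 1: "\<phi> z = z"
  proof (cases "z = \<one>")
    case True then show ?thesis using Phi_one[of 1] by (simp add: Phi_1)
  next
    case False
    then have pi: "p \<in> prime_divisors D" "ord z = p ^ 1" using prime_divisorsI[OF p z] by simp_all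
    show ?thesis
    proof (cases "comm_group (D\<lparr>carrier := p_part D p\<rparr>)")
      case True
      show ?thesis using exponent(2)[OF pi(1) True z(1) pi(2)] exponent(3)[OF pi(1) True] z by simp
    next
      case nc: False
      have p2: "p = 2" using p_part_nonabelian[OF p nc] by metis
      have "z \<in> p_part D 2" using z(2) z(1) p2 by (auto simp: p_part_def intro!: exI[of _ 1])
      then show ?thesis using datum nc pi(1) sylow[OF p] unfolding fci_datum_def p2 by auto
    qed
  qed
  have n: "\<Phi> (int n) z = z" for n
  proof (induction n)
    case (Suc n)
    have "\<Phi> (int (Suc n)) z = \<Phi> (int n) (\<Phi> 1 z)"
      using Phi_add[OF z(1), of "int n" 1] by (simp add: add.commute)
    then show ?case using Suc 1 by (simp add: Phi_1)
  qed (use z in simp)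
  show ?thesis
  proof (cases "m \<ge> 0")
    case True then show ?thesis using n[of "nat m"] by simp
  next
    case False
    then have "\<Phi> (- m) z = z" using n[of "nat (- m)"] by simp
    then show ?thesis using Phi_minus(2)[OF z(1), of m] Phi_minus(1)[OF z(1), of "- m"] by simp
  qed
qed

section \<open>Fixed points and the FCI condition\<close>

lemma Phi_exponent:
  assumes e: "e \<in> carrier D" "\<phi> e = e [^] (u::int)"
  shows "\<Phi> (int n) e = e [^] (u ^ n)"
proof (induction n)
  case (Suc n)
  have "\<Phi> (int (Suc n)) e = \<Phi> (int n) (\<Phi> 1 e)"
    using Phi_add[OF e(1), of "int n" 1] by (simp add: add.commute)
  also have "\<dots> = (e [^] (u ^ n)) [^] u"
    using e Suc Phi_int_pow by (simp add: Phi_1)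
  finally show ?case using e(1) by (simp add: int_pow_pow mult.commute)
qed (use e in simp)

text \<open>The elements e of D for which (0, e) commutes with (m, d).\<close>

definition fixer :: "int \<Rightarrow> 'a \<Rightarrow> 'a set" where
  "fixer m d = {e \<in> carrier D. d \<otimes> e \<otimes> inv d = \<Phi> m e}"

lemma subgroup_fixer:
  assumes d: "d \<in> carrier D"
  shows "subgroup (fixer m d) D"
proof (rule subgroupI)
  show "fixer m d \<noteq> {}" using d by (auto simp: fixer_def intro!: exI[of _ \<one>])
  show "inv x \<in> fixer m d" if "x \<in> fixer m d" for x
    using that d conj_int_pow[of d x "- 1"] by (simp add: fixer_def Phi_inv int_pow_neg)
  show "x \<otimes> y \<in> fixer m d" if "x \<in> fixer m d" "y \<in> fixer m d" for x y
    using that d by (simp add: fixer_def Phi_mult conj_mult)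
qed (auto simp: fixer_def)

text \<open>It suffices to treat an infinite component. It is abelian, hence central in D, so d
  drops out and an element of order p^n is fixed only if p^n divides t^|m| - 1. As t is neither 1
  nor, for p = 2, -1, this bounds n, and elements of bounded order are finite in number by finite
  rank.\<close>

lemma finite_fixer:
  assumes d: "d \<in> carrier D" and m: "m \<noteq> 0"
  shows "finite (fixer m d)"
proof (rule finite_subgroup_of_finite_parts[OF per subgroup_fixer[OF d]])
  show "finite (prime_divisors D)" using datum by (simp add: fci_datum_def)
  fix p assume p: "p \<in> prime_divisors D"
  note pp = pi_prime[OF p]
  let ?P = "p_part D p" and ?H = "D\<lparr>carrier := p_part D p\<rparr>"
  show "finite (fixer m d \<inter> ?P)"
  proof (cases "finite ?P")
    case False
    then have c: "comm_group ?H" using p_part_finite_of_nonabelian[OF p] by blast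
    have P: "subgroup ?P D" by (rule subgroup_p_part)
    have comm: "x \<otimes> y = y \<otimes> x" if "x \<in> ?P" "y \<in> ?P" for x y
      using c that comm_group_carrier_iff[OF P] by blast
    have ne: "t p \<noteq> \<one>\<^bsub>padic_ring p\<^esub>" "p = 2 \<Longrightarrow> t p \<noteq> \<ominus>\<^bsub>padic_ring p\<^esub> \<one>\<^bsub>padic_ring p\<^esub>"
    proof -
      have inf: "infinite (carrier (sylow_component D p))" using False sylow[OF pp] by simp
      show "p = 2 \<Longrightarrow> t p \<noteq> \<ominus>\<^bsub>padic_ring p\<^esub> \<one>\<^bsub>padic_ring p\<^esub>"
        using datum p inf unfolding fci_datum_def by blast
      have "p = 2 \<or> p > 2" using pp prime_ge_2_nat[of p] by linarith
      then show "t p \<noteq> \<one>\<^bsub>padic_ring p\<^esub>"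
        using datum p inf unfolding fci_datum_def by blast
    qed
    have M: "nat \<bar>m\<bar> > 0" using m by simp
    obtain B where B: "\<And>n. int p ^ n dvd t p n ^ nat \<bar>m\<bar> - 1 \<Longrightarrow> n \<le> B"
      using padic_power_bounded[OF pp exponent(1)[OF p c] exponent(3)[OF p c] ne M] by metis
    define C where "C = {x \<in> ?P. x [^] (p ^ B) = \<one>}"
    interpret H: dedekind ?H by (rule p_part_dedekind)
    have "subgroup C ?H"
    proof (rule H.subgroupI)
      show "C \<noteq> {}" using subgroup.one_closed[OF P] by (auto simp: C_def)
      show "inv\<^bsub>?H\<^esub> x \<in> C" if "x \<in> C" for x
        using that P subgroup.mem_carrier[OF P] by (auto simp: C_def subgroup.m_inv_closed nat_pow_inv)
      show "x \<otimes>\<^bsub>?H\<^esub> y \<in> C" if "x \<in> C" "y \<in> C" for x y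
        using that P subgroup.mem_carrier[OF P] comm[of x y]
        by (auto simp: C_def subgroup.m_closed pow_mult_distrib)
    qed (auto simp: C_def)
    moreover have "finite_rank ?H" using datum p sylow[OF pp] unfolding fci_datum_def by auto
    ultimately have "finite C"
      using pp prime_gt_0_nat[of p]
      by (intro H.finite_subgroup_of_finite_rank[of C "p ^ B"]) (simp_all add: C_def flip: nat_pow_consistent)
    moreover have "fixer m d \<inter> ?P \<subseteq> C"
    proof
      fix e assume e: "e \<in> fixer m d \<inter> ?P"
      then have eD: "e \<in> carrier D" and eP: "e \<in> ?P" by (auto simp: fixer_def)
      have "d \<otimes> e = e \<otimes> d" using p_part_commute_of_commute[OF per pp comm d eP] .
      then have "d \<otimes> e \<otimes> inv d = e" using conj_eq_iff d eD by blast
      then have 1: "\<Phi> m e = e" using e by (simp add: fixer_def)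
      have fixm: "\<Phi> (int (nat \<bar>m\<bar>)) e = e"
      proof (cases "m \<ge> 0")
        case True then show ?thesis using 1 by simp
      next
        case False then show ?thesis using Phi_minus(1)[OF eD, of m] 1 by simp
      qed
      obtain n where n: "ord e = p ^ n" using eP ord_prime_power_iff[OF pp eD] by (auto simp: p_part_def)
      have "e [^] (t p n ^ nat \<bar>m\<bar>) = e"
        using fixm Phi_exponent[OF eD exponent(2)[OF p c eD n], of "nat \<bar>m\<bar>"] by metis
      then have "e [^] (t p n ^ nat \<bar>m\<bar> - 1) = \<one>" using eD by (simp add: int_pow_diff)
      then have "int p ^ n dvd t p n ^ nat \<bar>m\<bar> - 1" using int_pow_eq_id[OF eD] n by simp
      then have "n \<le> B" by (rule B)
      then have "ord e dvd p ^ B" using n by (simp add: le_imp_power_dvd)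
      then show "e \<in> C" using eD eP pow_eq_id by (simp add: C_def)
    qed
    ultimately show ?thesis by (rule rev_finite_subset)
  qed simp
qed

text \<open>Elements of the centralizer with equal integer component differ by an element of the
  finite fixer, and modulo powers of x the integer component can be reduced modulo m.\<close>

lemma fci_group_G: "fci_group G"
  unfolding fci_group_def
proof (intro conjI ballI impI)
  show "group G" by (rule group_G)
  fix x assume x: "x \<in> carrier G" and nn: "\<not> generate G {x} \<lhd> G"
  obtain m d where md: "x = (m, d)" by (metis surj_pair)
  have d: "d \<in> carrier D" using x by (simp add: md carrier_G)
  have m: "m \<noteq> 0"
    using nn normal_cyc_embed[OF d] G.normal_generate_iff_normal_cyc[OF x] by (auto simp: md)
  let ?C = "centralizer G x" and ?X = "generate G {x}"
  have X: "subgroup ?X G" using x by (simp add: G.generate_is_subgroup)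
  have C: "?C \<subseteq> carrier G" by (auto simp: centralizer_def)
  have Cm: "c \<otimes>\<^bsub>G\<^esub> c' \<in> ?C" if "c \<in> ?C" "c' \<in> ?C" for c c'
    using that x G.commute_mult[of c c' x] by (simp add: centralizer_def)
  have Ci: "inv\<^bsub>G\<^esub> c \<in> ?C" if "c \<in> ?C" for c
    using that x G.commute_inv[of c x] by (simp add: centralizer_def)
  have Cx: "x [^]\<^bsub>G\<^esub> (k::int) \<in> ?C" for k
    using x G.commute_int_pow[of x x k] by (simp add: centralizer_def)
  have finr: "finite {c \<in> ?C. fst c = r}" for r
  proof (cases "{c \<in> ?C. fst c = r} = {}")
    case False
    then obtain c0 where c0: "c0 \<in> ?C" "fst c0 = r" by blast
    have "{c \<in> ?C. fst c = r} \<subseteq> (\<lambda>e. c0 \<otimes>\<^bsub>G\<^esub> (0, e)) ` fixer m d"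
    proof
      fix c assume c: "c \<in> {c \<in> ?C. fst c = r}"
      define c' where "c' = inv\<^bsub>G\<^esub> c0 \<otimes>\<^bsub>G\<^esub> c"
      have cG: "c \<in> carrier G" "c0 \<in> carrier G" using c c0 C by auto
      have c': "c' \<in> ?C" using c c0 Cm Ci by (simp add: c'_def)
      have "fst c' = 0" using cG c c0 by (simp add: c'_def fst_mult fst_inv)
      then obtain e where e: "c' = (0, e)" by (metis surj_pair fst_conv)
      have "e \<in> carrier D" "(0, e) \<otimes>\<^bsub>G\<^esub> (m, d) = (m, d) \<otimes>\<^bsub>G\<^esub> (0, e)"
        using c' by (simp_all add: e centralizer_def carrier_G md)
      then have eD: "e \<in> carrier D" "\<Phi> m e \<otimes> d = d \<otimes> e" using d by (simp_all add: mult_G)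
      then have "e \<in> fixer m d" using d conj_eq_iff[of d e "\<Phi> m e"] by (simp add: fixer_def)
      moreover have "c = c0 \<otimes>\<^bsub>G\<^esub> (0, e)" using cG by (simp add: c'_def G.inv_cancel_left flip: e)
      ultimately show "c \<in> (\<lambda>e. c0 \<otimes>\<^bsub>G\<^esub> (0, e)) ` fixer m d" by blast
    qed
    then show ?thesis using finite_fixer[OF d m] finite_surj by blast
  qed (metis finite.emptyI)
  \<comment> \<open>The symmetric range covers remainders modulo m of either sign, since
    \<open>mod\<close> follows the sign of m.\<close>
  define R where "R = (\<Union>r\<in>{- \<bar>m\<bar>..\<bar>m\<bar>}. {c \<in> ?C. fst c = r})"
  have "finite R" unfolding R_def using finr by (intro finite_UN_I) simp_all
  moreover have "rcosets\<^bsub>G\<lparr>carrier := ?C\<rparr>\<^esub> ?X \<subseteq> (\<lambda>c. ?X #>\<^bsub>G\<^esub> c) ` R"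
  proof
    fix K assume "K \<in> rcosets\<^bsub>G\<lparr>carrier := ?C\<rparr>\<^esub> ?X"
    then obtain c where c: "c \<in> ?C" "K = ?X #>\<^bsub>G\<^esub> c" by (auto simp: RCOSETS_def)
    define q where "q = x [^]\<^bsub>G\<^esub> (- (fst c div m))"
    have q: "q \<in> ?X" "q \<in> ?C" "q \<in> carrier G"
      using G.generate_singleton_iff[OF x] Cx x by (auto simp: q_def)
    have cG: "c \<in> carrier G" using c C by blast
    have "fst (q \<otimes>\<^bsub>G\<^esub> c) = fst c mod m"
      using cG q x fst_int_pow[OF x] by (simp add: fst_mult q_def md minus_div_mult_eq_mod[symmetric])
    moreover have "- \<bar>m\<bar> \<le> fst c mod m \<and> fst c mod m \<le> \<bar>m\<bar>"
      using m by (metis abs_le_iff abs_mod_less less_eq_real_def less_imp_le minus_le_iff)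
    ultimately have "q \<otimes>\<^bsub>G\<^esub> c \<in> R" using Cm[OF q(2) c(1)] by (auto simp: R_def)
    moreover have "K = ?X #>\<^bsub>G\<^esub> (q \<otimes>\<^bsub>G\<^esub> c)"
    proof -
      have "q \<otimes>\<^bsub>G\<^esub> c \<in> ?X #>\<^bsub>G\<^esub> c" using q by (auto simp: r_coset_def)
      then show ?thesis unfolding c(2) using cG X by (rule G.repr_independence)
    qed
    ultimately show "K \<in> (\<lambda>c. ?X #>\<^bsub>G\<^esub> c) ` R" by blast
  qed
  ultimately show "finite (rcosets\<^bsub>G\<lparr>carrier := ?C\<rparr>\<^esub> ?X)" by (meson finite_imageI finite_subset)
qed

text \<open>This is the D-component of the commutator of (0, b) with (-n, d). Since
  \<open>\<Phi> n\<close> commutes with inner automorphisms, b and its image f under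
  \<open>\<Phi> n\<close> induce the same inner automorphism, so they differ by a central factor;
  everything else is a commutator in D, which is central too.\<close>

lemma central_action:
  assumes b: "b \<in> carrier D" and d: "d \<in> carrier D" and z: "z \<in> carrier D"
  shows "(b \<otimes> \<Phi> n (d \<otimes> inv b \<otimes> inv d)) \<otimes> z = z \<otimes> (b \<otimes> \<Phi> n (d \<otimes> inv b \<otimes> inv d))"
proof -
  define f where "f = \<Phi> n b"
  have f: "f \<in> carrier D" using b by (simp add: f_def)
  define w where "w = \<Phi> (- n) z"
  have w: "w \<in> carrier D" "\<Phi> n w = z" using z Phi_minus(2) by (simp_all add: w_def)
  have "\<Phi> n (b \<otimes> w \<otimes> inv b) = b \<otimes> \<Phi> n w \<otimes> inv b"
    using Phi_power by (intro power_hom_conj_commute[OF Phi_hom _ b w(1)]) blast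
  then have eq: "f \<otimes> z \<otimes> inv f = b \<otimes> z \<otimes> inv b" if "z = \<Phi> n w"
    using b w by (simp add: Phi_mult Phi_inv f_def)
  have bf: "(inv f \<otimes> b) \<otimes> z = z \<otimes> (inv f \<otimes> b)"
  proof -
    have "(inv f \<otimes> b) \<otimes> z = inv f \<otimes> (b \<otimes> z \<otimes> inv b) \<otimes> b" using b f z by (simp add: grp_simps)
    also have "\<dots> = inv f \<otimes> (f \<otimes> z \<otimes> inv f) \<otimes> b" using eq w(2) by simp
    also have "\<dots> = z \<otimes> (inv f \<otimes> b)" using b f z by (simp add: grp_simps)
    finally show ?thesis .
  qed
  have cD: "commutator D x y \<otimes> z = z \<otimes> commutator D x y" if "x \<in> carrier D" "y \<in> carrier D" for x y
    using commutator_central that z by blast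
  define e where "e = \<Phi> n d"
  have e: "e \<in> carrier D" using d by (simp add: e_def)
  have "b \<otimes> \<Phi> n (d \<otimes> inv b \<otimes> inv d) = b \<otimes> (e \<otimes> inv f \<otimes> inv e)"
    using b d by (simp add: Phi_mult Phi_inv e_def f_def)
  also have "\<dots> = commutator D b (e \<otimes> inv f) \<otimes> (e \<otimes> (inv f \<otimes> b) \<otimes> inv e)"
    using b e f by (simp add: grp_simps)
  also have "\<dots> = commutator D b (e \<otimes> inv f) \<otimes> (commutator D e (inv f \<otimes> b) \<otimes> (inv f \<otimes> b))"
    using b e f by (simp add: grp_simps)
  finally have *: "b \<otimes> \<Phi> n (d \<otimes> inv b \<otimes> inv d)
    = commutator D b (e \<otimes> inv f) \<otimes> (commutator D e (inv f \<otimes> b) \<otimes> (inv f \<otimes> b))" .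
  show ?thesis unfolding *
    using b e f z by (intro commute_mult cD bf) simp_all
qed

text \<open>The first term of the series falls into a finite subgroup B of D, the second into the
  centre of D. From there each step removes one prime factor q from the exponent: if M = M' q, then
  a^M' has exponent q and is fixed by the action, so the commutator of a is killed by M'.\<close>

lemma locally_nilpotent_G: "locally_nilpotent_group G"
  unfolding locally_nilpotent_group_def
proof (intro conjI allI impI)
  show "group G" by (rule group_G)
  fix S assume S: "finite S \<and> S \<subseteq> carrier G"
  define H where "H = generate G S"
  let ?H = "G\<lparr>carrier := H\<rparr>"
  have H: "subgroup H G" using S by (simp add: H_def G.generate_is_subgroup)
  interpret H: group ?H using H by (rule G.subgroup_imp_group)
  \<comment> \<open>Finite because D is periodic and Dedekind, and invariant under the action
    because that is by powers; so the generated subgroup has all its D-components in B.\<close>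
  define B where "B = generate D (snd ` S)"
  have sS: "snd ` S \<subseteq> carrier D" "finite (snd ` S)" using S by (auto simp: carrier_G)
  have B: "subgroup B D" using sS by (simp add: B_def generate_is_subgroup)
  have BD: "B \<subseteq> carrier D" using B by (rule subgroup.subset)
  define N where "N = (\<Prod>x\<in>snd ` S. ord x)"
  have N: "N > 0" using sS per by (auto simp: N_def intro!: prod_pos)
  have "x [^] N = \<one>" if "x \<in> snd ` S" for x
    using that sS pow_eq_id[of x N] by (auto simp: N_def)
  then have finB: "finite B"
    unfolding B_def using normal_cyc_torsion_generate[OF sS(2) _ N] cyc sS(1) by blast
  have PB: "\<Phi> n b \<in> B" if "b \<in> B" for n b
  proof -
    have "b \<in> carrier D" using that BD by blast
    then obtain k :: int where "\<Phi> n b = b [^] k" using Phi_power by blast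
    then show ?thesis using subgroup_int_pow_closed[OF B that] by simp
  qed
  have GB: "subgroup (UNIV \<times> B) G"
  proof (rule G.subgroupI)
    show "UNIV \<times> B \<subseteq> carrier G" using BD by (auto simp: carrier_G)
    show "UNIV \<times> B \<noteq> {}" using subgroup.one_closed[OF B] by auto
    show "x \<otimes>\<^bsub>G\<^esub> y \<in> UNIV \<times> B" if "x \<in> UNIV \<times> B" "y \<in> UNIV \<times> B" for x y
      using that PB subgroup.m_closed[OF B] by (auto simp: mult_G)
    show "inv\<^bsub>G\<^esub> x \<in> UNIV \<times> B" if x: "x \<in> UNIV \<times> B" for x
    proof -
      obtain m d where md: "x = (m, d)" "d \<in> B" using x by auto
      have dD: "d \<in> carrier D" using md BD by blast
      have "(- m, \<Phi> (- m) (inv d)) \<otimes>\<^bsub>G\<^esub> x = \<one>\<^bsub>G\<^esub>"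
        using md dD Phi_minus(2)[of "inv d" m] by (simp add: mult_G one_G)
      then have "inv\<^bsub>G\<^esub> x = (- m, \<Phi> (- m) (inv d))"
        using dD by (intro G.inv_equality) (simp_all add: carrier_G md)
      then show ?thesis using PB subgroup.m_inv_closed[OF B md(2)] by simp
    qed
  qed
  have "S \<subseteq> UNIV \<times> B" using subset_generate[of "snd ` S" D] by (force simp: B_def)
  then have HB: "H \<subseteq> UNIV \<times> B" unfolding H_def using GB by (rule G.generate_subgroup_incl)
  have HG: "H \<subseteq> carrier G" using H by (rule subgroup.subset)
  have GB0: "subgroup ({0} \<times> A) G" if "subgroup A D" for A
  proof -
    have "(\<lambda>d. (0::int, d)) ` A = {0} \<times> A" by auto
    then show ?thesis
      using group_hom.subgroup_img_is_subgroup[of D G "\<lambda>d. (0, d)" A] that embed_hom is_group group_G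
      by (simp add: group_hom_def group_hom_axioms_def)
  qed
  define L where "L = lower_central ?H"
  have L1: "L (Suc 0) \<subseteq> {0} \<times> B" unfolding L_def
  proof (rule G.lower_central_carrier_update_Suc[OF H GB0[OF B]])
    fix x y assume "x \<in> lower_central ?H 0" "y \<in> H"
    then have xy: "x \<in> H" "y \<in> H" by simp_all
    have "commutator G x y \<in> H"
      using xy H by (simp add: subgroup.m_closed subgroup.m_inv_closed)
    moreover have "x \<in> carrier G" "y \<in> carrier G" using xy HG by blast+
    then have "fst (commutator G x y) = 0" by (simp add: fst_mult fst_inv)
    ultimately show "commutator G x y \<in> {0} \<times> B" using HB by (cases "commutator G x y") auto
  qed
  have comm: "commutator G (0, a) y = (0, a \<otimes> \<Phi> (- fst y) (snd y \<otimes> inv a \<otimes> inv (snd y)))"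
    if a: "a \<in> carrier D" and y: "y \<in> carrier G" for a y
  proof -
    obtain m d where md: "y = (m, d)" by (metis surj_pair)
    have d: "d \<in> carrier D" using y by (simp add: md carrier_G)
    have i: "inv\<^bsub>G\<^esub> (0, a) = (0, inv a)"
      using embed_int_pow[OF a, of "- 1"] a by (simp add: carrier_G G.int_pow_neg int_pow_neg)
    have "(0, a) \<in> carrier G" using a by (simp add: carrier_G)
    then have "commutator G (0, a) y = (0, a) \<otimes>\<^bsub>G\<^esub> (y \<otimes>\<^bsub>G\<^esub> (0, inv a) \<otimes>\<^bsub>G\<^esub> inv\<^bsub>G\<^esub> y)"
      using y unfolding i[symmetric] by (simp add: G.m_assoc)
    also have "y \<otimes>\<^bsub>G\<^esub> (0, inv a) \<otimes>\<^bsub>G\<^esub> inv\<^bsub>G\<^esub> y = (0, \<Phi> (- m) (d \<otimes> inv a \<otimes> inv d))"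
      unfolding md using a d by (intro G_conj) simp_all
    finally show ?thesis using a d by (simp add: md mult_G)
  qed
  \<comment> \<open>Central elements of D killed by M. On them conjugation by D disappears and only
    the power automorphism acts.\<close>
  define Z where "Z = (\<lambda>M::nat. {a \<in> carrier D. (\<forall>d\<in>carrier D. a \<otimes> d = d \<otimes> a) \<and> a [^] M = \<one>})"
  have Z: "subgroup (Z M) D" for M
  proof (rule subgroupI)
    show "Z M \<noteq> {}" by (auto simp: Z_def intro!: exI[of _ \<one>])
    show "inv a \<in> Z M" if "a \<in> Z M" for a using that by (auto simp: Z_def commute_inv nat_pow_inv)
    show "a \<otimes> b \<in> Z M" if "a \<in> Z M" "b \<in> Z M" for a b
    proof -
      have ab: "a \<in> carrier D" "b \<in> carrier D" using that by (simp_all add: Z_def)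
      moreover have "(a \<otimes> b) \<otimes> d = d \<otimes> (a \<otimes> b)" if "d \<in> carrier D" for d
        using ab that \<open>a \<in> Z M\<close> \<open>b \<in> Z M\<close> by (intro commute_mult) (simp_all add: Z_def)
      moreover have "a \<otimes> b = b \<otimes> a" "a [^] M = \<one>" "b [^] M = \<one>"
        using that ab(2) unfolding Z_def by blast+
      then have "(a \<otimes> b) [^] M = \<one>" using pow_mult_distrib[of a b M] ab by simp
      ultimately show ?thesis unfolding Z_def by blast
    qed
  qed (auto simp: Z_def)
  define M where "M = (\<Prod>b\<in>B. ord b)"
  have M: "M > 0" using BD per finB by (auto simp: M_def intro!: prod_pos)
  have L2: "L (Suc (Suc 0)) \<subseteq> {0} \<times> Z M" unfolding L_def
  proof (rule G.lower_central_carrier_update_Suc[OF H GB0[OF Z]])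
    fix x y assume x: "x \<in> lower_central ?H (Suc 0)" and y: "y \<in> H"
    obtain b where b: "x = (0, b)" "b \<in> B" using x L1 by (auto simp: L_def)
    have yG: "y \<in> carrier G" "snd y \<in> carrier D" using y HG by (auto simp: carrier_G)
    have bD: "b \<in> carrier D" using b BD by blast
    define c where "c = b \<otimes> \<Phi> (- fst y) (snd y \<otimes> inv b \<otimes> inv (snd y))"
    have cc: "commutator G x y = (0, c)" using comm[OF bD yG(1)] by (simp add: b c_def)
    have "lower_central ?H (Suc 0) \<subseteq> H" using H.lower_central_subgroup[of "Suc 0"] subgroup.subset by fastforce
    then have "x \<in> H" using x by blast
    then have "commutator G x y \<in> H"
      using y H by (simp add: subgroup.m_closed subgroup.m_inv_closed)
    then have "c \<in> B" using HB cc by auto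
    then have "ord c dvd M" unfolding M_def using finB by (rule dvd_prodI[rotated])
    then have "c [^] M = \<one>" using \<open>c \<in> B\<close> BD pow_eq_id by blast
    then show "commutator G x y \<in> {0} \<times> Z M"
      unfolding cc using \<open>c \<in> B\<close> BD central_action[OF bD yG(2)] by (auto simp: Z_def c_def)
  qed
  have step: "\<exists>j. L (n + j) = {\<one>\<^bsub>G\<^esub>}" if "M > 0" "L n \<subseteq> {0} \<times> Z M" for M n
    using that
  proof (induction M arbitrary: n rule: less_induct)
    case (less M)
    show ?case
    proof (cases "M = 1")
      case True
      have "subgroup (L n) ?H" unfolding L_def by (rule H.lower_central_subgroup)
      then have "\<one>\<^bsub>G\<^esub> \<in> L n" using subgroup.one_closed by fastforce
      moreover have "Z M \<subseteq> {\<one>}" by (auto simp: Z_def True)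
      ultimately show ?thesis using less.prems(2) by (intro exI[of _ 0]) (auto simp: one_G)
    next
      case False
      then obtain q where q: "Factorial_Ring.prime q" "q dvd M" using prime_factor_nat by blast
      then obtain M' where M': "M = M' * q" by (metis dvd_def mult.commute)
      have "M' > 0" "M' < M" using M' less.prems(1) prime_gt_1_nat[of q] q(1) by auto
      moreover have "L (Suc n) \<subseteq> {0} \<times> Z M'" unfolding L_def
      proof (rule G.lower_central_carrier_update_Suc[OF H GB0[OF Z]])
        fix x y assume x: "x \<in> lower_central ?H n" and y: "y \<in> H"
        obtain a where a: "x = (0, a)" "a \<in> Z M" using x less.prems(2) by (auto simp: L_def)
        have aD: "a \<in> carrier D" and ac: "\<And>d. d \<in> carrier D \<Longrightarrow> a \<otimes> d = d \<otimes> a"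
          using a(2) by (auto simp: Z_def)
        have yG: "y \<in> carrier G" "snd y \<in> carrier D" using y HG by (auto simp: carrier_G)
        define f where "f = \<Phi> (- fst y) (inv a)"
        define c where "c = a \<otimes> f"
        have cD: "c \<in> carrier D" "f \<in> carrier D" using aD by (simp_all add: c_def f_def)
        have "snd y \<otimes> inv a \<otimes> inv (snd y) = inv a"
          using aD yG ac commute_inv[OF aD yG(2)] conj_eq_iff by simp
        then have cc: "commutator G x y = (0, c)" and ceq: "c = a \<otimes> \<Phi> (- fst y) (snd y \<otimes> inv a \<otimes> inv (snd y))"
          using comm[OF aD yG(1)] by (simp_all add: a c_def f_def)
        have "(a [^] M') [^] q = \<one>" using a(2) aD by (simp add: nat_pow_pow Z_def M')
        then have "\<Phi> (- fst y) (a [^] M') = a [^] M'" using aD q(1) by (intro prime_order_fixed) simp_all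
        moreover have "f [^] M' = inv (\<Phi> (- fst y) (a [^] M'))"
          using aD Phi_int_pow[of "inv a" "- fst y" "int M'"] Phi_inv[of "a [^] M'"]
          by (simp add: f_def int_pow_int nat_pow_inv)
        ultimately have "c [^] M' = \<one>"
          using aD cD ac by (simp add: c_def pow_mult_distrib)
        then show "commutator G x y \<in> {0} \<times> Z M'"
          unfolding cc using cD central_action[OF aD yG(2)] by (auto simp: Z_def ceq)
      qed
      ultimately obtain j where "L (Suc n + j) = {\<one>\<^bsub>G\<^esub>}" using less.IH by blast
      then show ?thesis by (intro exI[of _ "Suc j"]) simp
    qed
  qed
  obtain k where "L k = {\<one>\<^bsub>G\<^esub>}" using step[OF M L2] by blast
  then have "nilpotent_group ?H" using H.is_group by (auto simp: nilpotent_group_def L_def)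
  then show "nilpotent_group (G\<lparr>carrier := generate G S\<rparr>)" by (simp add: H_def)
qed

end

lemma fci_datum_imp:
  assumes "fci_datum D \<phi> t"
  shows "locally_nilpotent_group (cyclic_semidirect D \<phi>) \<and> fci_group (cyclic_semidirect D \<phi>)"
proof -
  interpret D: dedekind D using assms by (simp add: fci_datum_def dedekind_group_iff)
  interpret fci_data D \<phi> t using assms by unfold_locales
  show ?thesis using locally_nilpotent_G fci_group_G by (simp add: G_def)
qed

section \<open>Nilpotent groups and abelian p-groups\<close>

text \<open>The lower central series of a finitely generated subgroup, presented inside G with
  commutators of G. The last property says that each term is the least subgroup containing the
  relevant commutators, which allows arguments running from the end of the series to its
  start.\<close>

lemma (in group) nilpotent_series:
  assumes ln: "locally_nilpotent_group G" and S: "finite S" "S \<subseteq> carrier G"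
  obtains L c where "L 0 = generate G S" "L c = {\<one>}"
    "\<And>n. subgroup (L n) G" "\<And>n. L n \<subseteq> generate G S" "\<And>n. L (Suc n) \<subseteq> L n"
    "\<And>n a h. \<lbrakk>a \<in> L n; h \<in> generate G S\<rbrakk> \<Longrightarrow> commutator G a h \<in> L (Suc n)"
    "\<And>n K. \<lbrakk>subgroup K G; \<And>a h. \<lbrakk>a \<in> L n; h \<in> generate G S\<rbrakk> \<Longrightarrow> commutator G a h \<in> K\<rbrakk> \<Longrightarrow> L (Suc n) \<subseteq> K"
proof -
  define H where "H = generate G S"
  let ?H = "G\<lparr>carrier := H\<rparr>"
  have H: "subgroup H G" using S(2) by (simp add: H_def generate_is_subgroup)
  interpret H: group ?H using H by (rule subgroup_imp_group)
  define L where "L = lower_central ?H"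
  have sub: "subgroup (L n) ?H" for n unfolding L_def by (rule H.lower_central_subgroup)
  have subG: "subgroup (L n) G" for n by (rule incl_subgroup[OF H sub])
  have LH: "L n \<subseteq> H" for n using subgroup.subset[OF sub[of n]] by simp
  obtain c where c: "L c = {\<one>}"
    using ln S unfolding locally_nilpotent_group_def nilpotent_group_def by (auto simp: L_def H_def)
  have up: "L (Suc n) \<subseteq> K"
    if "subgroup K G" "\<And>a h. \<lbrakk>a \<in> L n; h \<in> H\<rbrakk> \<Longrightarrow> commutator G a h \<in> K" for n K
    using that unfolding L_def by (rule lower_central_carrier_update_Suc[OF H])
  have cm: "commutator G a h \<in> L (Suc n)" if a: "a \<in> L n" and h: "h \<in> H" for a h n
  proof -
    have "a \<in> H" using a LH by blast
    then have "commutator G a h = commutator ?H a h" using H h by simp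
    then show ?thesis using a h unfolding L_def by (auto intro!: generate.incl)
  qed
  have dec: "L (Suc n) \<subseteq> L n" for n
  proof (induction n)
    case 0
    then show ?case using LH[of "Suc 0"] by (simp add: L_def)
  next
    case (Suc n)
    show ?case using Suc cm by (intro up[OF subG]) blast
  qed
  show thesis
    using that[of L c] c subG LH dec cm up by (simp add: H_def L_def)
qed

text \<open>Taking commutators with g multiplies the exponent of x by 1 - l, so up to inversion the
  power with exponent (l - 1)^n lies in the n-th term of the series of <x, g>.\<close>

lemma (in group) power_conj_unipotent:
  assumes ln: "locally_nilpotent_group G" and g: "g \<in> carrier G" and x: "x \<in> carrier G"
    and l: "g \<otimes> x \<otimes> inv g = x [^] (l::int)"
  obtains n where "x [^] ((l - 1) ^ n) = \<one>"
proof -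
  obtain L c where L: "L 0 = generate G {x, g}" "L c = {\<one>}" "\<And>n. subgroup (L n) G"
    "\<And>n a h. \<lbrakk>a \<in> L n; h \<in> generate G {x, g}\<rbrakk> \<Longrightarrow> commutator G a h \<in> L (Suc n)"
    using nilpotent_series[OF ln, of "{x, g}"] g x by (metis empty_subsetI finite.emptyI finite.insertI insert_subset)
  have gg: "g \<in> generate G {x, g}" "x \<in> generate G {x, g}" by (simp_all add: generate.incl)
  have "x [^] ((l - 1) ^ n) \<in> L n" for n
  proof (induction n)
    case 0
    then show ?case using gg x by (simp add: L(1))
  next
    case (Suc n)
    define e where "e = (l - 1) ^ n"
    have "commutator G (x [^] e) g = x [^] e \<otimes> (g \<otimes> x [^] (- e) \<otimes> inv g)"
      using g x by (simp add: m_assoc int_pow_neg)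
    also have "\<dots> = x [^] (e + l * (- e))"
      using g x by (simp only: conj_int_pow l int_pow_pow int_pow_mult)
    finally have "x [^] (e + l * (- e)) \<in> L (Suc n)" using L(4)[of "x [^] e" n g] Suc gg by (simp add: e_def)
    then have "inv (x [^] (e + l * (- e))) \<in> L (Suc n)" by (rule subgroup.m_inv_closed[OF L(3)])
    moreover have "inv (x [^] (e + l * (- e))) = x [^] ((l - 1) ^ Suc n)"
      using x by (simp add: e_def algebra_simps flip: int_pow_neg)
    ultimately show ?case by simp
  qed
  then show thesis using that[of c] L(2) by blast
qed

text \<open>In the quotient by N the image of [x, h] commutes with those of x and h, so taking
  commutators commutes with powers there. It is used with N a later term of a lower central series,
  or the torsion subgroup.\<close>

lemma (in group) commutator_pow_mod_normal:
  assumes N: "N \<lhd> G" and x: "x \<in> carrier G" and h: "h \<in> carrier G"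
    and cx: "commutator G (commutator G x h) x \<in> N" and ch: "commutator G (commutator G x h) h \<in> N"
  shows "commutator G x (h [^] (m::nat)) \<in> N \<longleftrightarrow> commutator G x h [^] m \<in> N"
    and "commutator G (x [^] (m::nat)) h \<in> N \<longleftrightarrow> commutator G x h [^] m \<in> N"
proof -
  interpret N: normal N G by (rule N)
  interpret Q: group "G Mod N" by (rule N.factorgroup_is_group)
  define f where "f = (\<lambda>a. N #> a)"
  interpret f: group_hom G "G Mod N" f
    unfolding group_hom_def group_hom_axioms_def f_def using N.r_coset_hom_Mod is_group Q.is_group by blast
  have ker: "f a = \<one>\<^bsub>G Mod N\<^esub> \<longleftrightarrow> a \<in> N" if "a \<in> carrier G" for a
    using that N.rcos_const coset_join1[of N a] N.subset N.subgroup_axioms by (auto simp: f_def)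
  define u where "u = commutator G x h"
  have u: "u \<in> carrier G" using x h by (simp add: u_def)
  have fc: "f (commutator G a b) = commutator (G Mod N) (f a) (f b)"
    if "a \<in> carrier G" "b \<in> carrier G" for a b
    using that by simp
  have comm: "f u \<otimes>\<^bsub>G Mod N\<^esub> f b = f b \<otimes>\<^bsub>G Mod N\<^esub> f u"
    if "b \<in> carrier G" "commutator G u b \<in> N" for b
  proof -
    have "commutator (G Mod N) (f u) (f b) = \<one>\<^bsub>G Mod N\<^esub>"
      using that u ker[of "commutator G u b"] fc[of u b] by simp
    then show ?thesis using that u Q.commute_iff_commutator[of "f u" "f b"] by simp
  qed
  have fu: "f u = commutator (G Mod N) (f x) (f h)" unfolding u_def using x h by (rule fc)
  have c1: "f u \<otimes>\<^bsub>G Mod N\<^esub> f x = f x \<otimes>\<^bsub>G Mod N\<^esub> f u" using comm[OF x] cx by (simp add: u_def)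
  have c2: "f u \<otimes>\<^bsub>G Mod N\<^esub> f h = f h \<otimes>\<^bsub>G Mod N\<^esub> f u" using comm[OF h] ch by (simp add: u_def)
  have fx: "f x \<in> carrier (G Mod N)" "f h \<in> carrier (G Mod N)" using x h by simp_all
  have um: "u [^] m \<in> N \<longleftrightarrow> f u [^]\<^bsub>G Mod N\<^esub> m = \<one>\<^bsub>G Mod N\<^esub>"
    using u ker[of "u [^] m"] f.hom_nat_pow[OF u] by simp
  have "f (commutator G x (h [^] m)) = f u [^]\<^bsub>G Mod N\<^esub> m"
    using Q.commutator_pow_right[OF fx c1[unfolded fu] c2[unfolded fu], of m] fc[of x "h [^] m"] x h
      f.hom_nat_pow[OF h] unfolding fu by simp
  then show "commutator G x (h [^] m) \<in> N \<longleftrightarrow> commutator G x h [^] m \<in> N"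
    using um ker[of "commutator G x (h [^] m)"] x h by (simp add: u_def)
  have "f (commutator G (x [^] m) h) = f u [^]\<^bsub>G Mod N\<^esub> m"
    using Q.commutator_pow_left[OF fx c1[unfolded fu] c2[unfolded fu], of m] fc[of "x [^] m" h] x h
      f.hom_nat_pow[OF x] unfolding fu by simp
  then show "commutator G (x [^] m) h \<in> N \<longleftrightarrow> commutator G x h [^] m \<in> N"
    using um ker[of "commutator G (x [^] m) h"] x h by (simp add: u_def)
qed

text \<open>Each further factor m in the exponent of g pushes the commutator one term down the
  series: with h = g^(m^k), modulo the next term [x, h^m] is [x, h]^m, which is [x^m, h] =
  1.\<close>

lemma (in group) torsion_commutes_with_power:
  assumes ln: "locally_nilpotent_group G" and x: "x \<in> carrier G" "m > 0" "x [^] (m::nat) = \<one>"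
    and g: "g \<in> carrier G"
  obtains n :: nat where "n > 0" "g [^] n \<otimes> x = x \<otimes> g [^] n"
proof -
  define H where "H = generate G {x, g}"
  obtain L c where L: "L 0 = H" "L c = {\<one>}" "\<And>n. subgroup (L n) G" "\<And>n. L n \<subseteq> H"
    "\<And>n. L (Suc n) \<subseteq> L n"
    "\<And>n a h. \<lbrakk>a \<in> L n; h \<in> H\<rbrakk> \<Longrightarrow> commutator G a h \<in> L (Suc n)"
    using nilpotent_series[OF ln, of "{x, g}"] g x unfolding H_def
    by (metis empty_subsetI finite.emptyI finite.insertI insert_subset)
  have H: "subgroup H G" using g x by (simp add: H_def generate_is_subgroup)
  let ?H = "G\<lparr>carrier := H\<rparr>"
  interpret H: group ?H using H by (rule subgroup_imp_group)
  have HG: "H \<subseteq> carrier G" using H by (rule subgroup.subset)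
  have gg: "g \<in> H" "x \<in> H" by (simp_all add: generate.incl H_def)
  have nor: "L n \<lhd> ?H" for n
  proof (rule H.normal_invI)
    show "subgroup (L n) ?H" by (rule subgroup_incl[OF L(3) H L(4)])
    fix h a assume h: "h \<in> carrier ?H" and a: "a \<in> L n"
    have aG: "a \<in> carrier G" "h \<in> carrier G" using a h HG L(4) by auto
    have "commutator G a h \<in> L n" using L(6)[OF a, of h] L(5)[of n] h by auto
    then have "inv (commutator G a h) \<otimes> a \<in> L n"
      using a subgroup.m_closed[OF L(3)] subgroup.m_inv_closed[OF L(3)] by blast
    moreover have "inv (commutator G a h) \<otimes> a = h \<otimes> a \<otimes> inv h" using aG by (simp add: grp_simps)
    ultimately show "h \<otimes>\<^bsub>?H\<^esub> a \<otimes>\<^bsub>?H\<^esub> inv\<^bsub>?H\<^esub> h \<in> L n" using H h by simp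
  qed
  have cH: "commutator ?H a b = commutator G a b" if "a \<in> H" "b \<in> H" for a b
    using that H by simp
  have Hcl: "commutator G a b \<in> H" "a [^] (k::nat) \<in> H" if "a \<in> H" "b \<in> H" for a b k
    using that H H.nat_pow_closed[of a k]
    by (simp_all add: subgroup.m_closed subgroup.m_inv_closed flip: nat_pow_consistent)
  have "commutator G x (g [^] (m ^ k)) \<in> L (Suc k)" for k
  proof (induction k)
    case 0
    then show ?case using L(1) L(6)[of x 0 g] gg g by simp
  next
    case (Suc k)
    define h where "h = g [^] (m ^ k)"
    have h: "h \<in> H" unfolding h_def using Hcl(2) gg by blast
    define u where "u = commutator G x h"
    have u: "u \<in> L (Suc k)" using Suc by (simp add: u_def h_def)
    have uH: "u \<in> H" using u L(4) by blast
    have "commutator G u x \<in> L (Suc (Suc k))" "commutator G u h \<in> L (Suc (Suc k))"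
      using L(6) u gg h by blast+
    then have 1: "commutator ?H (commutator ?H x h) x \<in> L (Suc (Suc k))"
        "commutator ?H (commutator ?H x h) h \<in> L (Suc (Suc k))"
      using cH gg h uH by (simp_all add: u_def)
    have xm: "x [^]\<^bsub>?H\<^esub> m = \<one>\<^bsub>?H\<^esub>" using x(3) by (simp flip: nat_pow_consistent)
    have hH: "h \<in> carrier ?H" using h by simp
    have e: "commutator ?H \<one>\<^bsub>?H\<^esub> h = \<one>\<^bsub>?H\<^esub>"
      using H.commute_iff_commutator[OF H.one_closed hH] H.l_one[OF hH] H.r_one[OF hH] by metis
    have "commutator ?H (x [^]\<^bsub>?H\<^esub> m) h \<in> L (Suc (Suc k))"
      unfolding xm e using subgroup.one_closed[OF L(3)] by simp
    then have "commutator ?H x (h [^]\<^bsub>?H\<^esub> m) \<in> L (Suc (Suc k))"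
      using H.commutator_pow_mod_normal[OF nor _ _ 1, of m] gg h by simp
    then have "commutator G x (h [^] m) \<in> L (Suc (Suc k))"
      using cH[of x "h [^] m"] gg h Hcl(2)[OF h h] by (simp flip: nat_pow_consistent)
    moreover have "h [^] m = g [^] (m ^ Suc k)" using g by (simp add: h_def nat_pow_pow mult.commute)
    ultimately show ?case by simp
  qed
  then have "commutator G x (g [^] (m ^ c)) \<in> L c" using L(5) by blast
  then have "x \<otimes> g [^] (m ^ c) = g [^] (m ^ c) \<otimes> x"
    using commute_iff_commutator[of x "g [^] (m ^ c)"] L(2) x g by simp
  then show thesis using that[of "m ^ c"] x(2) by simp
qed

text \<open>Conjugates of x by powers of w stay in the finite set <c> x with c = [w, x], as <c> is
  normal. So two of them coincide.\<close>

lemma (in group) power_commutes_of_torsion_commutator: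
  assumes w: "w \<in> carrier G" and x: "x \<in> carrier G"
    and t: "normal_cyc G (commutator G w x)" "m > 0" "commutator G w x [^] (m::nat) = \<one>"
  obtains n :: nat where "n > 0" "w [^] n \<otimes> x = x \<otimes> w [^] n"
proof -
  define c where "c = commutator G w x"
  have c: "c \<in> carrier G" using w x by (simp add: c_def)
  define f where "f = (\<lambda>j::nat. w [^] j \<otimes> x \<otimes> inv (w [^] j))"
  have "\<exists>i::int. f j = c [^] i \<otimes> x" for j
  proof (induction j)
    case 0
    then show ?case using w x by (intro exI[of _ 0]) (simp add: f_def)
  next
    case (Suc j)
    then obtain i :: int where i: "f j = c [^] i \<otimes> x" by blast
    obtain k :: int where k: "w \<otimes> c \<otimes> inv w = c [^] k"
      using t(1) w unfolding c_def normal_cyc_def by blast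
    have "f (Suc j) = w \<otimes> f j \<otimes> inv w"
      using w x nat_pow_Suc2[OF w, of j] by (simp add: f_def grp_simps del: nat_pow_Suc)
    also have "\<dots> = (w \<otimes> c [^] i \<otimes> inv w) \<otimes> (w \<otimes> x \<otimes> inv w)"
      unfolding i using w x c by (simp add: conj_mult)
    also have "w \<otimes> c [^] i \<otimes> inv w = c [^] (k * i)" using w c k by (simp add: conj_int_pow int_pow_pow)
    also have "w \<otimes> x \<otimes> inv w = c \<otimes> x" using w x by (simp add: c_def grp_simps)
    also have "c [^] (k * i) \<otimes> (c \<otimes> x) = c [^] (k * i + 1) \<otimes> x" using c x by (simp add: int_pow_mult m_assoc)
    finally show ?case ..
  qed
  note f_eq = this
  have "range f \<subseteq> (\<lambda>i::nat. c [^] i \<otimes> x) ` {..<m}"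
  proof
    fix v assume "v \<in> range f"
    then obtain j where "v = f j" by blast
    then obtain i :: int where i: "v = c [^] i \<otimes> x" using f_eq[of j] by blast
    obtain l where "l < m" "c [^] i = c [^] (l::nat)"
      using int_pow_nat_ex[OF c t(2), of i] t(3) by (auto simp: c_def)
    then show "v \<in> (\<lambda>i::nat. c [^] i \<otimes> x) ` {..<m}" using i by auto
  qed
  then have "finite (range f)" using finite_surj by blast
  then have "\<not> inj f" using finite_imageD infinite_UNIV_nat by blast
  then obtain i j where "i < j" "f i = f j" unfolding inj_def by (metis linorder_neqE_nat)
  then obtain n where n: "n > 0" "j = i + n" using less_imp_add_positive by blast
  define v where "v = w [^] i"
  have v: "v \<in> carrier G" using w by (simp add: v_def)
  have "v \<otimes> x \<otimes> inv v = (v \<otimes> w [^] n) \<otimes> x \<otimes> inv (v \<otimes> w [^] n)"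
    using \<open>f i = f j\<close> w by (simp add: f_def n v_def nat_pow_mult)
  also have "\<dots> = v \<otimes> (w [^] n \<otimes> x \<otimes> inv (w [^] n)) \<otimes> inv v" using v w x by (simp add: grp_simps)
  finally have "x = w [^] n \<otimes> x \<otimes> inv (w [^] n)"
    using v w x by (metis inv_closed l_cancel m_closed nat_pow_closed right_cancel)
  then have "w [^] n \<otimes> x = x \<otimes> w [^] n" using conj_eq_iff[of "w [^] n" x x] w x by simp
  then show thesis using that n(1) by blast
qed

section \<open>Counting, groups of rank one and groups of finite rank\<close>

lemma large_fibre:
  assumes "finite A" "finite B" "f ` A \<subseteq> B" "c * card B < card A"
  shows "\<exists>v\<in>B. c < card {a \<in> A. f a = v}"
proof (rule ccontr)
  assume "\<not> (\<exists>v\<in>B. c < card {a \<in> A. f a = v})"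
  then have le: "card {a \<in> A. f a = v} \<le> c" if "v \<in> B" for v using that by (meson not_le)
  have "A = (\<Union>v\<in>B. {a \<in> A. f a = v})" using assms(3) by blast
  then have "card A \<le> (\<Sum>v\<in>B. card {a \<in> A. f a = v})" using card_UN_le[OF assms(2)] by metis
  also have "\<dots> \<le> (\<Sum>v\<in>B. c)" using le by (rule sum_mono)
  finally show False using assms(4) by (simp add: mult.commute)
qed

text \<open>The N-th power map embeds the torsion-free group into the cyclic group <x>. A generator
  is an element whose image has least positive exponent m, by division with remainder.\<close>

lemma (in comm_group) cyclic_of_bounded_rank_one:
  assumes tf: "\<And>z n. \<lbrakk>z \<in> carrier G; n > 0; z [^] (n::nat) = \<one>\<rbrakk> \<Longrightarrow> z = \<one>"
    and x: "x \<in> carrier G" and N: "N > 0" "\<And>y. y \<in> carrier G \<Longrightarrow> \<exists>k::int. y [^] (N::nat) = x [^] k"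
  shows "\<exists>g\<in>carrier G. \<forall>y\<in>carrier G. \<exists>q::int. y = g [^] q"
proof (cases "x = \<one>")
  case True
  then have "y = \<one>" if "y \<in> carrier G" for y using N(2)[OF that] tf[OF that N(1)] by simp
  then show ?thesis by (intro bexI[of _ \<one>]) (auto intro: exI[of _ "1::int"])
next
  case False
  define P where "P = (\<lambda>k::nat. k > 0 \<and> (\<exists>y\<in>carrier G. y [^] N = x [^] k))"
  define m where "m = (LEAST k. P k)"
  have "P N" using x N(1) by (auto simp: P_def)
  then have "P m" unfolding m_def by (rule LeastI)
  then obtain g where m: "m > 0" and g: "g \<in> carrier G" "g [^] N = x [^] m" by (auto simp: P_def)
  have "\<exists>q::int. y = g [^] q" if y: "y \<in> carrier G" for y
  proof -
    obtain k :: int where k: "y [^] N = x [^] k" using N(2)[OF y] by blast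
    define q where "q = k div int m"
    define z where "z = y \<otimes> g [^] (- q)"
    have z: "z \<in> carrier G" using y g by (simp add: z_def)
    have "z [^] N = y [^] N \<otimes> (g [^] (- q)) [^] N" using y g by (simp add: z_def nat_pow_distrib)
    also have "(g [^] (- q)) [^] N = (g [^] N) [^] (- q)"
      using g int_pow_pow[of g "- q" "int N"] int_pow_pow[of g "int N" "- q"]
      by (simp add: int_pow_int mult.commute)
    also have "y [^] N \<otimes> (g [^] N) [^] (- q) = x [^] (k + int m * (- q))"
      by (simp only: k g(2) int_pow_mult[OF x] int_pow_pow[OF x, symmetric] int_pow_int)
    also have "k + int m * (- q) = k mod int m" by (simp add: q_def minus_mult_div_eq_mod)
    finally have zk: "z [^] N = x [^] (k mod int m)" .
    define n0 where "n0 = nat (k mod int m)"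
    have zN: "z [^] N = x [^] n0" using m zk by (simp add: n0_def)
    have "n0 < m" using m by (simp add: n0_def nat_less_iff)
    then have "\<not> P n0" unfolding m_def by (rule not_less_Least)
    then have "n0 = 0" using z zN by (auto simp: P_def)
    then have "z = \<one>" using zN tf[OF z N(1)] by simp
    then have "y = g [^] q" using y g by (simp add: z_def int_pow_neg) (metis inv_inv inv_unique' int_pow_closed inv_closed m_comm inv_equality)
    then show ?thesis ..
  qed
  then show ?thesis using g(1) by blast
qed

lemma int_pow_int_power: "x [^]\<^bsub>G\<^esub> (int p ^ j) = x [^]\<^bsub>G\<^esub> (p ^ j)"
  using int_pow_int[of G x "p ^ j"] by simp

text \<open>
  A finite subgroup \<open>B\<close> is generated by coset representatives of \<open>B\<^sup>p\<close>, and the index of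
  \<open>B\<^sup>p\<close> in \<open>B\<close> is the number of solutions of \<open>z\<^sup>p = 1\<close> in \<open>B\<close>.
\<close>

lemma (in comm_group) finite_rank_of_finite_socle:
  assumes p: "Factorial_Ring.prime (p::nat)"
    and pgrp: "\<And>x. x \<in> carrier G \<Longrightarrow> \<exists>n. x [^] (p ^ n) = \<one>"
    and fin: "finite {z \<in> carrier G. z [^] p = \<one>}"
  shows "finite_rank G"
  unfolding finite_rank_def
proof (intro exI[of _ "card {z \<in> carrier G. z [^] p = \<one>}"] allI impI)
  fix S assume S: "finite S \<and> S \<subseteq> carrier G"
  define W where "W = {z \<in> carrier G. z [^] p = \<one>}"
  define B where "B = generate G S"
  have B: "subgroup B G" using S by (simp add: B_def generate_is_subgroup)
  have BG: "B \<subseteq> carrier G" using B by (rule subgroup.subset)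
  have pp: "p > 1" using p prime_gt_1_nat by blast
  obtain e where e: "\<And>x. x \<in> carrier G \<Longrightarrow> x [^] (p ^ e x) = \<one>" using pgrp by metis
  define k where "k = (\<Sum>x\<in>S. e x)"
  have xk: "x [^] (p ^ k) = \<one>" if "x \<in> S" for x
  proof (rule pow_dvd_eq_one[OF _ e])
    have "e x \<le> k" unfolding k_def using S that by (intro member_le_sum) auto
    then show "p ^ e x dvd p ^ k" by (rule le_imp_power_dvd)
  qed (use S that in auto)
  have nc: "normal_cyc G x" if "x \<in> carrier G" for x
    unfolding normal_cyc_def using that
  proof (intro conjI ballI)
    fix g assume "g \<in> carrier G"
    then have "g \<otimes> x \<otimes> inv g = x [^] (1::int)" using that conj_eq_iff[of g x x] m_comm[of g x] by simp
    then show "\<exists>k::int. g \<otimes> x \<otimes> inv g = x [^] k" ..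
  qed (use that in simp)
  have finB: "finite B"
    unfolding B_def using S xk nc pp normal_cyc_torsion_generate[of S "p ^ k"] by auto
  have BK: "b [^] (p ^ k) = \<one>" if "b \<in> B" for b
  proof -
    have "subgroup {b \<in> carrier G. b [^] (p ^ k) = \<one>} G"
      by (rule subgroupI) (auto simp: nat_pow_inv nat_pow_distrib intro!: exI[of _ \<one>])
    then have "B \<subseteq> {b \<in> carrier G. b [^] (p ^ k) = \<one>}"
      unfolding B_def using S xk by (intro generate_subgroup_incl) auto
    then show ?thesis using that by blast
  qed
  define C where "C = (\<lambda>b. b [^] p) ` B"
  have CB: "C \<subseteq> B"
    using subgroup_int_pow_closed[OF B, of _ "int p"] by (auto simp: C_def int_pow_int)
  have C: "subgroup C G"
  proof (rule subgroupI)
    show "C \<noteq> {}" using subgroup.one_closed[OF B] by (auto simp: C_def)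
    show "inv c \<in> C" if "c \<in> C" for c
      using that BG subgroup.m_inv_closed[OF B] by (auto simp: C_def subset_iff simp flip: nat_pow_inv)
    show "c \<otimes> d \<in> C" if "c \<in> C" "d \<in> C" for c d
      using that BG subgroup.m_closed[OF B] by (auto simp: C_def subset_iff simp flip: nat_pow_distrib)
    show "C \<subseteq> carrier G" using CB BG by (rule subset_trans)
  qed
  \<comment> \<open>Two elements with the same p-th power differ by a solution of z^p = 1, so the
    fibres of the p-th power map on B have at most |W| elements.\<close>
  have card_B: "card B \<le> card W * card C"
  proof (rule ccontr)
    assume "\<not> ?thesis"
    then obtain v where v: "v \<in> C" "card W < card {a \<in> B. a [^] p = v}"
      using large_fibre[OF finB, of C "\<lambda>a. a [^] p" "card W"] finB by (auto simp: C_def)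
    then obtain b0 where b0: "b0 \<in> B" "b0 [^] p = v" by (auto simp: C_def)
    have "(\<lambda>a. inv b0 \<otimes> a) ` {a \<in> B. a [^] p = v} \<subseteq> W"
      using b0 BG by (auto simp: W_def nat_pow_distrib nat_pow_inv subset_iff)
    moreover have "inj_on (\<lambda>a. inv b0 \<otimes> a) {a \<in> B. a [^] p = v}"
      using b0 BG by (intro inj_onI) (auto simp: subset_iff)
    ultimately have "card {a \<in> B. a [^] p = v} \<le> card W"
      using fin by (intro card_inj_on_le) (simp_all add: W_def)
    then show False using v by simp
  qed
  \<comment> \<open>Sets of elements lying in pairwise different cosets of C. One of greatest size
    is a transversal, and it has at most |W| elements because |R| |C| is at most |B|.\<close>
  define P where "P = (\<lambda>R. R \<subseteq> B \<and> (\<forall>r\<in>R. \<forall>r'\<in>R. inv r \<otimes> r' \<in> C \<longrightarrow> r = r'))"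
  have "P {}" by (simp add: P_def)
  moreover have "card R \<le> card B" if "P R" for R using that finB card_mono by (auto simp: P_def)
  ultimately obtain R where R: "P R" "\<And>R'. P R' \<Longrightarrow> card R' \<le> card R"
    using ex_has_greatest_nat[of P "{}" card "Suc (card B)"] by (auto simp: less_Suc_eq_le)
  have RB: "R \<subseteq> B" and Rd: "\<And>r r'. \<lbrakk>r \<in> R; r' \<in> R; inv r \<otimes> r' \<in> C\<rbrakk> \<Longrightarrow> r = r'"
    using R(1) by (auto simp: P_def)
  have finR: "finite R" using RB finB finite_subset by blast
  have "card R * card C \<le> card B"
  proof -
    have "inj_on (\<lambda>(r, c). r \<otimes> c) (R \<times> C)"
    proof (rule inj_onI, clarify)
      fix r c r' c' assume *: "r \<in> R" "c \<in> C" "r' \<in> R" "c' \<in> C" "r \<otimes> c = r' \<otimes> c'"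
      have G: "r \<in> carrier G" "r' \<in> carrier G" "c \<in> carrier G" "c' \<in> carrier G" using * RB CB BG by blast+
      have "inv r \<otimes> r' = inv r \<otimes> (r' \<otimes> c') \<otimes> inv c'" using G by (simp add: m_assoc)
      also have "\<dots> = c \<otimes> inv c'" unfolding *(5)[symmetric] using G by (simp add: grp_simps)
      also have "\<dots> \<in> C" using * C by (simp add: subgroup.m_closed subgroup.m_inv_closed)
      finally have "r = r'" using Rd * by blast
      then show "r = r' \<and> c = c'" using * G by simp
    qed
    moreover have "(\<lambda>(r, c). r \<otimes> c) ` (R \<times> C) \<subseteq> B"
      using RB CB subgroup.m_closed[OF B] by auto
    ultimately have "card (R \<times> C) \<le> card B" using finB by (metis card_inj_on_le)
    then show ?thesis by (simp add: card_cartesian_product)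
  qed
  then have "card R * card C \<le> card W * card C" using card_B by linarith
  moreover have "card C > 0"
    using C CB finB finite_subset subgroup.one_closed by (metis card_gt_0_iff empty_iff)
  ultimately have cR: "card R \<le> card W" by simp
  have near: "\<exists>r\<in>R. inv r \<otimes> b \<in> C" if b: "b \<in> B" for b
  proof (rule ccontr)
    assume n: "\<not> ?thesis"
    have bG: "b \<in> carrier G" using b BG by blast
    have "b \<notin> R"
    proof
      assume "b \<in> R"
      moreover have "inv b \<otimes> b \<in> C" using bG subgroup.one_closed[OF C] by simp
      ultimately show False using n by blast
    qed
    have sym: "inv b \<otimes> r \<in> C \<longleftrightarrow> inv r \<otimes> b \<in> C" if r: "r \<in> R" for r
    proof -
      have rG: "r \<in> carrier G" using r RB BG by blast
      have "inv (inv b \<otimes> r) = inv r \<otimes> b" "inv (inv r \<otimes> b) = inv b \<otimes> r"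
        using rG bG by (simp_all add: inv_mult_group)
      then show ?thesis using subgroup.m_inv_closed[OF C] by metis
    qed
    have "P (insert b R)"
      unfolding P_def using b RB Rd n sym by auto
    then have "card (insert b R) \<le> card R" by (rule R(2))
    then show False using \<open>b \<notin> R\<close> finR by simp
  qed
  have gR: "subgroup (generate G R) G" using RB BG by (intro generate_is_subgroup) blast
  \<comment> \<open>Modulo <R> every element of B is a p-th power of an element of B, and iterating
    gives a p^n-th power. At n = k this factor is trivial.\<close>
  have "\<exists>h\<in>generate G R. \<exists>c\<in>B. b = h \<otimes> c [^] (p ^ n)" if b: "b \<in> B" for b n
    using b
  proof (induction n arbitrary: b)
    case 0
    have "b = \<one> \<otimes> b [^] (p ^ 0)" using 0 BG by (simp add: subset_iff)
    then show ?case using 0 subgroup.one_closed[OF gR] by blast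
  next
    case (Suc n)
    then obtain h c where h: "h \<in> generate G R" "c \<in> B" "b = h \<otimes> c [^] (p ^ n)" by blast
    obtain r where r: "r \<in> R" "inv r \<otimes> c \<in> C" using near h(2) by blast
    then obtain c' where c': "c' \<in> B" "inv r \<otimes> c = c' [^] p" by (auto simp: C_def)
    have G: "c \<in> carrier G" "c' \<in> carrier G" "r \<in> carrier G" "h \<in> carrier G"
      using h(1,2) c'(1) r(1) RB BG subgroup.subset[OF gR] by blast+
    have "c = r \<otimes> c' [^] p" using G c'(2) by (metis inv_cancel_left(2))
    then have "b = (h \<otimes> r [^] (p ^ n)) \<otimes> c' [^] (p ^ Suc n)"
      using h(3) G by (simp add: nat_pow_distrib nat_pow_pow m_assoc)
    moreover have "h \<otimes> r [^] (p ^ n) \<in> generate G R"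
      using h(1) r(1) subgroup.m_closed[OF gR] subgroup_int_pow_closed[OF gR, of r "int (p ^ n)"]
      unfolding int_pow_int by (simp add: generate.incl)
    ultimately show ?case using c'(1) by blast
  qed
  from this[of _ k] have "B \<subseteq> generate G R"
    using BK subgroup.subset[OF gR] by fastforce
  moreover have "generate G R \<subseteq> B" using RB B by (rule generate_subgroup_incl)
  ultimately show "\<exists>T. finite T \<and> T \<subseteq> carrier G \<and> card T \<le> card {z \<in> carrier G. z [^] p = \<one>} \<and>
      generate G T = generate G S"
    using finR RB BG cR by (intro exI[of _ R]) (auto simp: B_def W_def)
qed

section \<open>Existence of p-adic exponents\<close>

lemma padic_unitI:
  assumes p: "Factorial_Ring.prime (p::nat)" and t: "t \<in> carrier (padic_ring p)" and t1: "\<not> int p dvd t 1"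
  shows "t \<in> Units (padic_ring p)"
proof -
  interpret R: cring "padic_ring p" using p prime_gt_0_nat by (intro cring_padic_ring) blast
  have pp: "p > 1" using p prime_gt_1_nat by blast
  have "\<exists>s. (t n * s) mod int p ^ n = 1 mod int p ^ n" for n
  proof (cases "n = 0")
    case False
    then have "t n mod int p = t 1 mod int p"
      using padic_mod[OF t, of 1 n] padic_mod[OF t, of 1 1] by simp
    then have "\<not> int p dvd t n" using t1 by (simp add: dvd_eq_mod_eq_0)
    then have "coprime (t n) (int p ^ n)"
      using p by (metis coprime_commute coprime_power_right_iff prime_imp_coprime prime_nat_int_transfer)
    then obtain a b where ab: "t n * a + int p ^ n * b = 1"
      by (metis bezout_int coprime_imp_gcd_eq_1 mult.commute)
    then have "t n * a = 1 - int p ^ n * b" by simp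
    then have "(t n * a) mod int p ^ n = 1 mod int p ^ n" by (simp add: mod_diff_eq[symmetric])
    then show ?thesis by blast
  qed simp
  then obtain s0 where s0: "\<And>n. (t n * s0 n) mod int p ^ n = 1 mod int p ^ n" by metis
  define s where "s = (\<lambda>n. s0 n mod int p ^ n)"
  have ts: "(t n * s n) mod int p ^ n = 1 mod int p ^ n" for n
    using s0[of n] by (simp add: s_def mod_simps)
  \<comment> \<open>The Bezout inverses are found level by level; uniqueness modulo p^n makes them
    coherent.\<close>
  have uniq: "int p ^ n dvd u - v" if "int p ^ n dvd t n * u - 1" "int p ^ n dvd t n * v - 1" for n u v
  proof -
    have "int p ^ n dvd u * (t n * v - 1) - v * (t n * u - 1)" using that by simp
    also have "u * (t n * v - 1) - v * (t n * u - 1) = - (u - v)" by (simp add: algebra_simps)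
    finally show ?thesis by (simp add: dvd_diff_commute)
  qed
  have "s (Suc n) mod int p ^ n = s n" for n
  proof -
    have "int p ^ Suc n dvd t (Suc n) * s (Suc n) - 1" using ts[of "Suc n"] by (simp only: mod_eq_dvd_iff)
    then have "int p ^ n dvd t (Suc n) * s (Suc n) - 1"
      by (rule dvd_trans[rotated]) (simp add: le_imp_power_dvd)
    then have "(t (Suc n) * s (Suc n)) mod int p ^ n = 1 mod int p ^ n" by (simp add: mod_eq_dvd_iff)
    moreover have "t (Suc n) mod int p ^ n = t n" using padic_mod[OF t] by simp
    ultimately have "(t n * s (Suc n)) mod int p ^ n = 1 mod int p ^ n" by (metis mod_mult_left_eq)
    then have "int p ^ n dvd t n * s (Suc n) - 1" by (simp only: mod_eq_dvd_iff)
    moreover have "int p ^ n dvd t n * s n - 1" using ts[of n] by (simp only: mod_eq_dvd_iff)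
    ultimately have "int p ^ n dvd s (Suc n) - s n" by (rule uniq)
    then have "s (Suc n) mod int p ^ n = s n mod int p ^ n" by (simp add: mod_eq_dvd_iff)
    then show ?thesis by (simp add: s_def)
  qed
  then have "s \<in> carrier (padic_ring p)" using pp by (auto simp: padic_ring_def s_def)
  moreover have "t \<otimes>\<^bsub>padic_ring p\<^esub> s = \<one>\<^bsub>padic_ring p\<^esub>" using ts by (simp add: padic_ring_def)
  ultimately show ?thesis using t R.m_comm[of t s] unfolding Units_def by auto
qed

text \<open>After multiplication by a power of \<open>a\<close>, the element \<open>b\<close> generates a subgroup meeting \<open>\<langle>a\<rangle>\<close> trivially.\<close>

lemma (in comm_group) power_hom_uniform:
  assumes p: "Factorial_Ring.prime (p::nat)"
    and f: "f \<in> hom G G" "\<And>x. x \<in> carrier G \<Longrightarrow> \<exists>k::int. f x = x [^] k"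
    and a: "a \<in> carrier G" "ord a = p ^ n" "f a = a [^] (k::int)"
    and b: "b \<in> carrier G" "b [^] (p ^ n) = \<one>"
  shows "f b = b [^] k"
proof -
  have pp: "p > 1" using p prime_gt_1_nat by blast
  have an: "a [^] (p ^ n) = \<one>" using a pow_ord_eq_1 by metis
  \<comment> \<open>The least j for which b can be corrected by a power of a to an element killed by
    p^j. The value n is always possible, with no correction at all.\<close>
  define P where "P = (\<lambda>j::nat. \<exists>s::int. b [^] (p ^ j) = a [^] (int (p ^ j) * s))"
  define j where "j = (LEAST j. P j)"
  have "P n" using b by (auto simp: P_def intro!: exI[of _ 0])
  then have "P j" unfolding j_def by (rule LeastI)
  then obtain s where s: "b [^] (p ^ j) = a [^] (int (p ^ j) * s)" by (auto simp: P_def)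
  have jn: "j \<le> n" unfolding j_def using \<open>P n\<close> by (rule Least_le)
  define c where "c = b \<otimes> a [^] (- s)"
  have c: "c \<in> carrier G" using a b by (simp add: c_def)
  have cpow: "c [^] (i::int) = b [^] i \<otimes> a [^] (- (i * s))" for i
    using a b by (simp add: c_def int_pow_distrib int_pow_pow mult.commute)
  have cj: "c [^] (p ^ j) = \<one>"
    using cpow[of "int (p ^ j)"] s a b by (simp add: int_pow_int_power int_pow_neg)
  \<comment> \<open><c> meets <a> trivially. Otherwise a p^r-th power of c with r < j would be a
    power of a, and as a has order p^n with j at most n, its exponent is divisible by p^r, so that a
    smaller j would do.\<close>
  have triv: "c [^] i = \<one>" if i: "c [^] (i::int) = a [^] (l::int)" for i l
  proof (rule ccontr)
    assume ne: "c [^] i \<noteq> \<one>"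
    define q where "q = gcd i (int (p ^ j))"
    have "q dvd int (p ^ j)" by (simp add: q_def)
    then obtain r where r: "r \<le> j" "q = int (p ^ r)"
    proof -
      have "nat q dvd p ^ j" using \<open>q dvd int (p ^ j)\<close> by (simp add: q_def nat_dvd_iff)
      then obtain r where "r \<le> j" "nat q = p ^ r" using p divides_primepow_nat by blast
      moreover have "q \<ge> 0" by (simp add: q_def)
      ultimately show thesis using that[of r] by (metis int_nat_eq)
    qed
    obtain u v where uv: "u * i + v * int (p ^ j) = q" using bezout_int unfolding q_def by blast
    have "c [^] (p ^ r) = c [^] (i * u) \<otimes> c [^] (int (p ^ j) * v)"
      using c uv r by (simp add: mult.commute flip: int_pow_mult int_pow_int)
    also have "\<dots> = (c [^] i) [^] u \<otimes> (c [^] (p ^ j)) [^] v"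
      using c by (simp add: int_pow_pow flip: int_pow_int)
    also have "\<dots> = a [^] (l * u)" using c a i cj by (simp add: int_pow_pow)
    finally have cr: "c [^] (p ^ r) = a [^] (l * u)" .
    have "r < j"
    proof (rule ccontr)
      assume "\<not> r < j"
      then have "int (p ^ j) dvd i" using r by (simp add: q_def) (metis gcd_dvd1 q_def r(2))
      then obtain w where "i = int (p ^ j) * w" using dvdE by blast
      then have "c [^] i = (c [^] (p ^ j)) [^] w" using c by (simp add: int_pow_pow flip: int_pow_int)
      then show False using ne cj by simp
    qed
    have "(a [^] (l * u)) [^] int (p ^ (j - r)) = (c [^] int (p ^ r)) [^] int (p ^ (j - r))"
      using cr by (simp add: int_pow_int_power)
    also have "\<dots> = c [^] int (p ^ r * p ^ (j - r))" using c by (simp add: int_pow_pow)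
    also have "\<dots> = \<one>" using cj r(1) unfolding int_pow_int power_add[symmetric] by simp
    finally have "a [^] (l * u * int (p ^ (j - r))) = \<one>" using a by (simp add: int_pow_pow)
    then have "int (p ^ n) dvd l * u * int (p ^ (j - r))" using int_pow_eq_id[OF a(1)] a(2) by simp
    moreover have "p ^ n = p ^ (n - (j - r)) * p ^ (j - r)" using jn by (simp flip: power_add)
    ultimately have "int (p ^ (n - (j - r))) dvd l * u" using pp by simp
    moreover have "p ^ r dvd p ^ (n - (j - r))" using jn r(1) by (intro le_imp_power_dvd) simp
    ultimately have "int (p ^ r) dvd l * u" by (meson dvd_trans of_nat_dvd_iff)
    then obtain w where w: "l * u = int (p ^ r) * w" using dvdE by blast
    have "b [^] int (p ^ r) = c [^] int (p ^ r) \<otimes> a [^] (int (p ^ r) * s)"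
      using cpow[of "int (p ^ r)"] a b by (simp add: int_pow_neg m_assoc)
    also have "\<dots> = a [^] (int (p ^ r) * (w + s))"
      using cr a by (simp add: int_pow_int_power w distrib_left int_pow_mult)
    finally have "P r" by (auto simp: P_def int_pow_int_power)
    then show False using \<open>r < j\<close> not_less_Least by (auto simp: j_def)
  qed
  \<comment> \<open>The product a c links the two exponents: f acts on it by a single power l, and
    since <a> and <c> meet trivially, l agrees with k on a and with k' on c.\<close>
  obtain l :: int where l: "f (a \<otimes> c) = (a \<otimes> c) [^] l" using f(2)[of "a \<otimes> c"] a c by auto
  obtain k' :: int where k': "f c = c [^] k'" using f(2)[OF c] by blast
  have "a [^] k \<otimes> c [^] k' = a [^] l \<otimes> c [^] l"
    using l k' a c hom_mult[OF f(1) a(1) c] by (simp add: int_pow_distrib)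
  then have "inv (a [^] k) \<otimes> (a [^] k \<otimes> c [^] k') \<otimes> inv (c [^] l)
      = inv (a [^] k) \<otimes> (a [^] l \<otimes> c [^] l) \<otimes> inv (c [^] l)" by simp
  then have "c [^] k' \<otimes> inv (c [^] l) = inv (a [^] k) \<otimes> a [^] l"
    using a c by (simp add: grp_simps)
  then have e: "c [^] (k' - l) = a [^] (l - k)"
    using a c by (simp add: int_pow_diff m_comm)
  then have 1: "c [^] (k' - l) = \<one>" by (rule triv)
  then have "int (p ^ n) dvd l - k" using e a int_pow_eq_id[OF a(1), of "l - k"] by simp
  then obtain w where w: "l - k = int (p ^ n) * w" using dvdE by blast
  have cn: "c [^] (p ^ n) = \<one>" using cj c jn pow_dvd_eq_one le_imp_power_dvd by metis
  have "c [^] (l - k) = (c [^] (p ^ n)) [^] w" unfolding w using c by (simp add: int_pow_pow flip: int_pow_int)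
  then have "c [^] (l - k) = \<one>" using cn by simp
  then have "c [^] (k' - l) \<otimes> c [^] (l - k) = \<one>" using 1 by simp
  then have "c [^] (k' - k) = \<one>" using c by (simp flip: int_pow_mult)
  then have fc: "f c = c [^] k" using k' c by (simp add: int_pow_diff) (metis int_pow_closed inv_equality inv_inv inv_closed)
  have "b = c \<otimes> a [^] s" using a b by (simp add: c_def int_pow_neg m_assoc)
  then have "f b = f c \<otimes> f a [^] s"
    using hom_mult[OF f(1) c, of "a [^] s"] hom_int_pow[OF f(1) a(1) is_group is_group] a by simp
  also have "\<dots> = b [^] k"
    unfolding fc a(3) using a c \<open>b = c \<otimes> a [^] s\<close> by (simp add: int_pow_distrib int_pow_pow mult.commute)
  finally show ?thesis .
qed

text \<open>For each n, an element of greatest order among those killed by p^n provides one exponent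
  for all of them. These residues form a p-adic integer; it is a unit because f does not kill the
  element z of order p.\<close>

lemma (in comm_group) power_automorphism_exponent:
  assumes p: "Factorial_Ring.prime (p::nat)"
    and pgrp: "\<And>x. x \<in> carrier G \<Longrightarrow> \<exists>n. x [^] (p ^ n) = \<one>"
    and f: "f \<in> hom G G" "\<And>x. x \<in> carrier G \<Longrightarrow> \<exists>k::int. f x = x [^] k"
      "\<And>x. x \<in> carrier G \<Longrightarrow> f x = \<one> \<Longrightarrow> x = \<one>"
    and z: "z \<in> carrier G" "z \<noteq> \<one>" "z [^] p = \<one>"
  obtains t where "is_exponent G p f t"
proof -
  have pp: "p > 1" using p prime_gt_1_nat by blast
  have ex: "\<exists>k::int. \<forall>b\<in>carrier G. b [^] (p ^ n) = \<one> \<longrightarrow> f b = b [^] k" for n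
  proof -
    define P where "P = (\<lambda>b. b \<in> carrier G \<and> b [^] (p ^ n) = \<one>)"
    have "ord b \<le> p ^ n" if "P b" for b
      using that pp ord_le_pow_eq_one(2)[of b "p ^ n"] by (simp add: P_def)
    moreover have "P \<one>" by (simp add: P_def)
    ultimately obtain a where a: "P a" "\<And>b. P b \<Longrightarrow> ord b \<le> ord a"
      using ex_has_greatest_nat[of P \<one> ord "Suc (p ^ n)"] by (auto simp: less_Suc_eq_le)
    have aG: "a \<in> carrier G" using a(1) by (simp add: P_def)
    obtain m where m: "ord a = p ^ m" using ord_prime_power_iff[OF p aG] a(1) by (auto simp: P_def)
    obtain k :: int where k: "f a = a [^] k" using f(2)[OF aG] by blast
    have "f b = b [^] k" if b: "P b" for b
    proof (rule power_hom_uniform[OF p f(1,2) aG m k])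
      show bG: "b \<in> carrier G" using b by (simp add: P_def)
      obtain m' where m': "ord b = p ^ m'" using ord_prime_power_iff[OF p bG] b by (auto simp: P_def)
      have "p ^ m' \<le> p ^ m" using a(2)[OF b] m m' by simp
      then have "m' \<le> m" using pp by simp
      then show "b [^] (p ^ m) = \<one>" using pow_eq_id[OF bG] m' le_imp_power_dvd by metis
    qed
    then show ?thesis by (auto simp: P_def)
  qed
  have "\<exists>k::nat \<Rightarrow> int. (\<forall>n. \<forall>b\<in>carrier G. b [^] (p ^ n) = \<one> \<longrightarrow> f b = b [^] k n) \<and>
      (\<forall>n. int p ^ n dvd k (Suc n) - k n)"
  \<comment> \<open>With bounded exponent the residues k n would not be determined beyond it, so a
    constant sequence is taken. With unbounded exponent there is an element a of order exactly p^n
    for every n, and comparing both exponents on a gives coherence.\<close>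
  proof (cases "\<exists>N. \<forall>b\<in>carrier G. b [^] (p ^ N) = \<one>")
    case True
    then obtain k where "\<forall>b\<in>carrier G. f b = b [^] (k::int)" using ex by metis
    then show ?thesis by (intro exI[of _ "\<lambda>_. k"]) simp
  next
    case False
    obtain k :: "nat \<Rightarrow> int" where k: "\<And>n b. b \<in> carrier G \<Longrightarrow> b [^] (p ^ n) = \<one> \<Longrightarrow> f b = b [^] k n"
      using ex by metis
    have "int p ^ n dvd k (Suc n) - k n" for n
    proof -
      obtain b where b: "b \<in> carrier G" "b [^] (p ^ n) \<noteq> \<one>" using False by blast
      obtain m where m: "ord b = p ^ m" using ord_prime_power_iff[OF p b(1)] pgrp[OF b(1)] by blast
      have "\<not> p ^ m dvd p ^ n" using b m pow_eq_id by metis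
      then have nm: "n \<le> m" by (metis le_imp_power_dvd nat_le_linear)
      define a where "a = b [^] (p ^ (m - n))"
      have a: "a \<in> carrier G" using b by (simp add: a_def)
      have "ord a = p ^ m div p ^ (m - n)"
        unfolding a_def using b m pp by (subst ord_pow) (auto simp: le_imp_power_dvd)
      also have "\<dots> = p ^ n" using nm pp by (simp flip: power_diff)
      finally have oa: "ord a = p ^ n" .
      have an: "a [^] (p ^ n) = \<one>" using oa a pow_ord_eq_1 by metis
      moreover have "a [^] (p ^ Suc n) = \<one>" using an a pow_dvd_eq_one[of a "p ^ n" "p ^ Suc n"] by simp
      ultimately have "a [^] k (Suc n) = a [^] k n" using k[OF a, of n] k[OF a, of "Suc n"] by simp
      then have "a [^] (k (Suc n) - k n) = \<one>" using a by (simp add: int_pow_diff)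
      then show ?thesis using int_pow_eq_id[OF a] oa by simp
    qed
    then show ?thesis using k by blast
  qed
  then obtain k :: "nat \<Rightarrow> int" where k: "\<And>n b. b \<in> carrier G \<Longrightarrow> b [^] (p ^ n) = \<one> \<Longrightarrow> f b = b [^] k n"
    and kk: "\<And>n. int p ^ n dvd k (Suc n) - k n" by blast
  define t where "t = (\<lambda>n. k n mod int p ^ n)"
  have tc: "t \<in> carrier (padic_ring p)"
    using kk pp by (auto simp: padic_ring_def t_def mod_mod_cancel mod_eq_dvd_iff)
  have tp: "f a = padic_pow G p a t" if a: "a \<in> carrier G" for a
  proof -
    obtain n where n: "ord a = p ^ n" using ord_prime_power_iff[OF p a] pgrp[OF a] by blast
    have an: "a [^] (p ^ n) = \<one>" using n a pow_ord_eq_1 by metis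
    have "multiplicity p (ord a) = n" using n p not_prime_unit[of p] by (auto simp: multiplicity_same_power)
    then have "padic_pow G p a t = a [^] (k n mod int (p ^ n))" by (simp add: padic_pow_def t_def)
    also have "\<dots> = a [^] k n" using a an by (rule int_pow_mod)
    finally show ?thesis using k[OF a an] by simp
  qed
  have "\<not> int p dvd t 1"
  proof
    assume d: "int p dvd t 1"
    have "ord z = p ^ 1" using prime_divisorsI(2)[OF p z(1,3,2)] by simp
    then have "multiplicity p (ord z) = 1" using p not_prime_unit[of p] by (auto simp: multiplicity_same_power)
    then have "f z = z [^] t 1" using tp[OF z(1)] by (simp add: padic_pow_def)
    also have "\<dots> = z [^] (0::int)" using z d by (intro int_pow_cong[of z p]) simp_all
    finally show False using f(3)[OF z(1)] z(2) by simp
  qed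
  then have "is_exponent G p f t" using padic_unitI[OF p tc] tp by (simp add: is_exponent_def)
  then show thesis by (rule that)
qed

section \<open>Non-periodic FCI-groups modulo torsion\<close>

locale nonperiodic_fci = group G for G (structure) +
  assumes ln: "locally_nilpotent_group G"
    and fci: "fci_group G"
    and nonper: "\<not> periodic G"
    and nonab: "\<not> comm_group G"
begin

section \<open>The torsion subgroup and centralizers\<close>

definition T where "T = torsion_elements G"

lemma T_iff: "x \<in> T \<longleftrightarrow> x \<in> carrier G \<and> (\<exists>n::nat. n > 0 \<and> x [^] n = \<one>)"
  by (simp add: T_def torsion_elements_def)

lemma TG: "T \<subseteq> carrier G"
  by (auto simp: T_iff)

lemma torsion_of_pow:
  assumes "x \<in> carrier G" "x [^] (n::nat) \<in> T" "n > 0"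
  shows "x \<in> T"
proof -
  obtain m :: nat where "m > 0" "(x [^] n) [^] m = \<one>" using assms T_iff by blast
  then have "x [^] (n * m) = \<one>" "n * m > 0" using assms by (simp_all add: nat_pow_pow)
  then show ?thesis using assms(1) T_iff by blast
qed

lemma torsion_of_int_pow:
  assumes "x \<in> carrier G" "x [^] (k::int) = \<one>" "k \<noteq> 0"
  shows "x \<in> T"
proof -
  have "int (ord x) dvd k" using assms int_pow_eq_id by blast
  then have "ord x \<noteq> 0" using assms(3) by auto
  then show ?thesis using pow_ord_eq_1[OF assms(1)] assms(1) T_iff by blast
qed

lemma inf_int_pow:
  assumes "x \<in> carrier G" "x \<notin> T" "(k::int) \<noteq> 0"
  shows "x [^] k \<notin> T"
proof
  assume "x [^] k \<in> T"
  then obtain n :: nat where "n > 0" "(x [^] k) [^] n = \<one>" using T_iff by blast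
  then have "x [^] (k * int n) = \<one>" using assms(1) by (simp add: int_pow_int flip: int_pow_pow)
  then show False using torsion_of_int_pow[OF assms(1), of "k * int n"] assms(2,3) \<open>n > 0\<close> by simp
qed

lemma finite_cosets:
  assumes x: "x \<in> carrier G" "\<not> normal_cyc G x"
  shows "finite ((\<lambda>y. generate G {x} #> y) ` centralizer G x)"
proof -
  have "finite (rcosets\<^bsub>G\<lparr>carrier := centralizer G x\<rparr>\<^esub> (generate G {x}))"
    using fci x unfolding fci_group_def by (simp add: normal_generate_iff_normal_cyc)
  moreover have "(\<lambda>y. generate G {x} #> y) ` centralizer G x
      \<subseteq> rcosets\<^bsub>G\<lparr>carrier := centralizer G x\<rparr>\<^esub> (generate G {x})"
    by (auto simp: RCOSETS_def)
  ultimately show ?thesis by (rule rev_finite_subset)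
qed

lemma coset_eq_imp:
  assumes x: "x \<in> carrier G" and yz: "y \<in> carrier G" "z \<in> carrier G"
    and eq: "generate G {x} #> y = generate G {x} #> z"
  shows "\<exists>k::int. y = x [^] k \<otimes> z"
proof -
  have "subgroup (generate G {x}) G" using x by (simp add: generate_is_subgroup)
  then have "y \<in> generate G {x} #> z" using rcos_self[OF yz(1)] eq by blast
  then show ?thesis using x by (auto simp: r_coset_def generate_singleton_iff)
qed

text \<open>Among y^0, ..., y^c two lie in the same coset of <x>, where c is the number of cosets in
  the centralizer. The resulting exponent is at most c but depends on y; the factorial of c serves
  all y.\<close>

lemma fci_power:
  assumes x: "x \<in> carrier G" "\<not> normal_cyc G x"
  shows "\<exists>N::nat. N > 0 \<and> (\<forall>y\<in>carrier G. y \<otimes> x = x \<otimes> y \<longrightarrow> (\<exists>k::int. y [^] N = x [^] k))"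
proof -
  define c where "c = card ((\<lambda>y. generate G {x} #> y) ` centralizer G x)"
  have "\<exists>k::int. y [^] (fact c :: nat) = x [^] k" if y: "y \<in> carrier G" "y \<otimes> x = x \<otimes> y" for y
  proof -
    define f where "f = (\<lambda>j::nat. generate G {x} #> (y [^] j))"
    have "f ` {0..c} \<subseteq> (\<lambda>y. generate G {x} #> y) ` centralizer G x"
      using y x commute_nat_pow[of y x] by (auto simp: f_def centralizer_def)
    then have "card (f ` {0..c}) \<le> c" unfolding c_def using finite_cosets[OF x] by (rule card_mono[rotated])
    then have "\<not> inj_on f {0..c}" using card_image by fastforce
    then obtain i j where ij: "i \<le> c" "j \<le> c" "i < j" "f i = f j"
      unfolding inj_on_def by (metis atLeastAtMost_iff linorder_neqE_nat)
    then obtain n where n: "n > 0" "j = i + n" using less_imp_add_positive by blast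
    obtain k :: int where "y [^] j = x [^] k \<otimes> y [^] i"
      using coset_eq_imp[of x "y [^] j" "y [^] i"] ij(4) x y by (auto simp: f_def)
    then have "y [^] n \<otimes> y [^] i = x [^] k \<otimes> y [^] i" using y by (simp add: n nat_pow_mult add.commute)
    then have yn: "y [^] n = x [^] k" using x y by simp
    have "n dvd fact c" using n ij by (intro dvd_fact) auto
    then obtain q where "fact c = n * q" using dvdE by blast
    then have "y [^] (fact c :: nat) = x [^] (k * int q)"
      using y x yn by (simp add: int_pow_int flip: nat_pow_pow int_pow_pow)
    then show ?thesis ..
  qed
  then show ?thesis by (intro exI[of _ "fact c"]) simp
qed

lemma torsion_normal_cyc:
  assumes x: "x \<in> T"
  shows "normal_cyc G x"
proof (rule ccontr)
  assume n: "\<not> normal_cyc G x"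
  have xG: "x \<in> carrier G" using x TG by blast
  obtain m :: nat where m: "m > 0" "x [^] m = \<one>" using x T_iff by blast
  obtain g where g: "g \<in> carrier G" "g \<notin> T"
    using nonper is_group unfolding periodic_def T_iff by blast
  obtain k :: nat where k: "k > 0" "g [^] k \<otimes> x = x \<otimes> g [^] k"
    using torsion_commutes_with_power[OF ln xG m g(1)] by blast
  obtain N :: nat where N: "N > 0"
      "\<forall>y\<in>carrier G. y \<otimes> x = x \<otimes> y \<longrightarrow> (\<exists>k::int. y [^] N = x [^] k)"
    using fci_power[OF xG n] by blast
  obtain l :: int where l: "(g [^] k) [^] N = x [^] l" using N(2) k(2) g by blast
  have "(x [^] l) [^] int m = (x [^] int m) [^] l" using xG by (simp add: int_pow_pow mult.commute)
  then have "(x [^] l) [^] m = \<one>" using m(2) by (simp add: int_pow_int)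
  then have "(g [^] k) [^] N \<in> T" using l xG m T_iff by auto
  then have "g [^] k \<in> T" using torsion_of_pow[of "g [^] k" N] g(1) N(1) by simp
  then show False using torsion_of_pow[OF g(1) _ k(1)] g(2) by blast
qed

lemma finite_elem_torsion:
  assumes K: "subgroup K G" "finite K" and z: "z \<in> K"
  shows "z \<in> T"
proof -
  have zG: "z \<in> carrier G" using K z subgroup.mem_carrier by metis
  have zK: "z [^] (i::nat) \<in> K" for i
    using subgroup_int_pow_closed[OF K(1) z, of "int i"] by (simp add: int_pow_int)
  have "\<not> inj (\<lambda>i::nat. z [^] i)"
  proof
    assume "inj (\<lambda>i::nat. z [^] i)"
    moreover have "finite (range (\<lambda>i::nat. z [^] i))" using zK K(2) by (meson finite_subset image_subsetI)
    ultimately show False using finite_imageD infinite_UNIV_nat by blast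
  qed
  then obtain i j :: nat where "i < j" "z [^] i = z [^] j" unfolding inj_def by (metis linorder_neqE_nat)
  then have "z [^] (int j - int i) = \<one>" using zG by (simp add: int_pow_diff int_pow_int)
  then show ?thesis using torsion_of_int_pow[OF zG] \<open>i < j\<close> by auto
qed

lemma torsion_generate:
  assumes "finite F" "F \<subseteq> T"
  shows "finite (generate G F)" "generate G F \<subseteq> T"
proof -
  define n where "n = (\<Prod>x\<in>F. ord x)"
  have o: "ord x > 0" if "x \<in> F" for x
    using that assms T_iff ord_le_pow_eq_one(1) by blast
  have n: "n > 0" using assms(1) o by (auto simp: n_def intro!: prod_pos)
  have "x [^] n = \<one>" if "x \<in> F" for x
    using that assms TG pow_eq_id[of x n] by (auto simp: n_def)
  then show fin: "finite (generate G F)"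
    using normal_cyc_torsion_generate[OF assms(1) _ n] torsion_normal_cyc assms(2) by blast
  have "subgroup (generate G F) G" using assms TG by (intro generate_is_subgroup) blast
  then show "generate G F \<subseteq> T" using finite_elem_torsion fin by blast
qed

lemma subgroup_T: "subgroup T G"
proof (rule subgroupI)
  show "T \<subseteq> carrier G" by (rule TG)
  show "T \<noteq> {}" using T_iff[of \<one>] by auto
  show "inv x \<in> T" if "x \<in> T" for x using that by (auto simp: T_iff nat_pow_inv)
  show "x \<otimes> y \<in> T" if "x \<in> T" "y \<in> T" for x y
    using torsion_generate(2)[of "{x, y}"] that generate.eng[of x G "{x, y}" y] generate.incl[of _ "{x, y}" G]
    by blast
qed

lemma conj_T: "g \<in> carrier G \<Longrightarrow> x \<in> T \<Longrightarrow> g \<otimes> x \<otimes> inv g \<in> T"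
  unfolding T_iff by (auto simp: conj_nat_pow[symmetric] simp del: m_assoc)

lemma normal_T: "T \<lhd> G"
  using subgroup_T conj_T by (intro normal_invI) auto

lemma normal_of_subset_T:
  assumes "subgroup K G" "K \<subseteq> T" "g \<in> carrier G" "x \<in> K"
  shows "g \<otimes> x \<otimes> inv g \<in> K"
proof -
  obtain k :: int where "g \<otimes> x \<otimes> inv g = x [^] k"
    using torsion_normal_cyc[of x] assms unfolding normal_cyc_def by blast
  then show ?thesis using subgroup_int_pow_closed[OF assms(1,4)] by simp
qed

text \<open><x> meets T trivially, so distinct torsion elements of the centralizer lie in distinct
  cosets of <x>, of which FCI allows finitely many.\<close>

lemma finite_centralizer_T:
  assumes x: "x \<in> carrier G" "x \<notin> T" "\<not> normal_cyc G x"
  shows "finite {s \<in> T. s \<otimes> x = x \<otimes> s}"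
proof (rule finite_imageD)
  show "finite ((\<lambda>y. generate G {x} #> y) ` {s \<in> T. s \<otimes> x = x \<otimes> s})"
    using TG by (intro finite_subset[OF image_mono finite_cosets[OF x(1,3)]]) (auto simp: centralizer_def)
  show "inj_on (\<lambda>y. generate G {x} #> y) {s \<in> T. s \<otimes> x = x \<otimes> s}"
  proof (rule inj_onI)
    fix y z assume *: "y \<in> {s \<in> T. s \<otimes> x = x \<otimes> s}" "z \<in> {s \<in> T. s \<otimes> x = x \<otimes> s}"
      "generate G {x} #> y = generate G {x} #> z"
    then have yz: "y \<in> T" "z \<in> T" "y \<in> carrier G" "z \<in> carrier G" using TG by auto
    obtain k :: int where k: "y = x [^] k \<otimes> z" using coset_eq_imp[OF x(1) yz(3,4)] * by blast
    then have "x [^] k = y \<otimes> inv z" using yz x(1) by (simp add: m_assoc)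
    also have "\<dots> \<in> T" using yz subgroup_T by (simp add: subgroup.m_closed subgroup.m_inv_closed)
    finally have "k = 0" using inf_int_pow[OF x(1,2)] by blast
    then show "y = z" using k yz by simp
  qed
qed

text \<open>The conjugation exponent l satisfies (l - 1)^n = 0, as x has infinite order. So among
  elements of infinite order, those to which the FCI bound applies are exactly the non-central
  ones.\<close>

lemma inf_normal_central:
  assumes x: "x \<in> carrier G" "x \<notin> T" "normal_cyc G x" and g: "g \<in> carrier G"
  shows "g \<otimes> x = x \<otimes> g"
proof -
  obtain l :: int where l: "g \<otimes> x \<otimes> inv g = x [^] l" using x(3) g unfolding normal_cyc_def by blast
  obtain n where "x [^] ((l - 1) ^ n) = \<one>" using power_conj_unipotent[OF ln g x(1) l] .
  then have "(l - 1) ^ n = 0" using torsion_of_int_pow[OF x(1)] x(2) by blast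
  then have "l = 1" by simp
  then show ?thesis using l x(1) g conj_eq_iff by simp
qed

section \<open>Non-central elements of infinite order and common powers\<close>

definition nonnormal_inf where "nonnormal_inf x \<longleftrightarrow> x \<in> carrier G \<and> x \<notin> T \<and> \<not> normal_cyc G x"

lemma nonnormal_infI:
  assumes "x \<in> carrier G" "x \<notin> T" "g \<in> carrier G" "g \<otimes> x \<noteq> x \<otimes> g"
  shows "nonnormal_inf x"
  using assms inf_normal_central by (auto simp: nonnormal_inf_def)

text \<open>If all elements of infinite order were central, then so would be x and s x for torsion
  s, hence s, and G would be abelian.\<close>

lemma ex_nonnormal_inf: "\<exists>x. nonnormal_inf x"
proof (rule ccontr)
  assume nw: "\<nexists>x. nonnormal_inf x"
  have c: "g \<otimes> x = x \<otimes> g" if "x \<in> carrier G" "x \<notin> T" "g \<in> carrier G" for x g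
    using that nonnormal_infI nw by blast
  obtain x where x: "x \<in> carrier G" "x \<notin> T"
    using nonper is_group unfolding periodic_def T_iff by blast
  have "g \<otimes> s = s \<otimes> g" if s: "s \<in> T" and g: "g \<in> carrier G" for s g
  proof -
    have sG: "s \<in> carrier G" using s TG by blast
    have "s \<otimes> x \<notin> T"
    proof
      assume "s \<otimes> x \<in> T"
      then have "inv s \<otimes> (s \<otimes> x) \<in> T" using s subgroup_T by (simp add: subgroup.m_closed subgroup.m_inv_closed)
      then show False using x sG by (simp add: inv_cancel_left)
    qed
    then have "(s \<otimes> x) \<otimes> g = g \<otimes> (s \<otimes> x)" using c[of "s \<otimes> x" g] sG x g by simp
    moreover have "x \<otimes> g = g \<otimes> x" using c[OF x g] by simp
    ultimately show ?thesis using commute_commutes_inv_cancel[OF sG x(1) g] by simp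
  qed
  then have "comm_group G" using c by (intro group_comm_groupI) blast
  then show False using nonab by blast
qed

text \<open>Supplies a link between elements that need not commute. The element w has infinite order
  and lies in the last term not contained in T, so its commutators with x and y are torsion, and
  suitable powers of w commute with each of them.\<close>

lemma commuting_partner:
  assumes x: "x \<in> carrier G" "x \<notin> T" and y: "y \<in> carrier G"
  obtains z where "z \<in> carrier G" "z \<notin> T" "z \<otimes> x = x \<otimes> z" "z \<otimes> y = y \<otimes> z"
proof -
  define H where "H = generate G {x, y}"
  obtain L c where L: "L 0 = H" "L c = {\<one>}" "\<And>n. L n \<subseteq> H"
    "\<And>n a h. \<lbrakk>a \<in> L n; h \<in> H\<rbrakk> \<Longrightarrow> commutator G a h \<in> L (Suc n)"
    using nilpotent_series[OF ln, of "{x, y}"] y x unfolding H_def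
    by (metis empty_subsetI finite.emptyI finite.insertI insert_subset)
  have H: "subgroup H G" using x y by (simp add: H_def generate_is_subgroup)
  have xy: "x \<in> H" "y \<in> H" by (simp_all add: H_def generate.incl)
  define n where "n = (LEAST n. L n \<subseteq> T)"
  have "L c \<subseteq> T" using L(2) subgroup.one_closed[OF subgroup_T] by simp
  then have n: "L n \<subseteq> T" unfolding n_def by (rule LeastI)
  have "n \<noteq> 0" using n L(1) xy x by (metis subsetD)
  then obtain i where i: "n = Suc i" by (cases n) auto
  have "\<not> L i \<subseteq> T" using not_less_Least[of i "\<lambda>n. L n \<subseteq> T"] i by (simp add: n_def)
  then obtain w where w: "w \<in> L i" "w \<notin> T" by blast
  have wG: "w \<in> carrier G" using w L(3) subgroup.subset[OF H] by blast
  have "\<exists>k>0. w [^] (k::nat) \<otimes> v = v \<otimes> w [^] k" if v: "v \<in> H" for v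
  proof -
    have vG: "v \<in> carrier G" using v subgroup.subset[OF H] by blast
    have "commutator G w v \<in> T" using L(4)[OF w(1) v] n i by blast
    then obtain m :: nat where "m > 0" "commutator G w v [^] m = \<one>" "normal_cyc G (commutator G w v)"
      using T_iff torsion_normal_cyc by blast
    then show ?thesis using power_commutes_of_torsion_commutator[OF wG vG] by blast
  qed
  then obtain k l :: nat where k: "k > 0" "w [^] k \<otimes> x = x \<otimes> w [^] k"
    and l: "l > 0" "w [^] l \<otimes> y = y \<otimes> w [^] l" using xy by metis
  define z where "z = w [^] (k * l)"
  have "z = (w [^] k) [^] l" "z = (w [^] l) [^] k" using wG by (simp_all add: z_def nat_pow_pow mult.commute)
  then have "z \<otimes> x = x \<otimes> z" "z \<otimes> y = y \<otimes> z"
    using commute_nat_pow[OF _ x(1) k(2), of l] commute_nat_pow[OF _ y l(2), of k] wG by simp_all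
  moreover have "z \<notin> T" using torsion_of_pow[OF wG, of "k * l"] w(2) k l by (auto simp: z_def)
  ultimately show thesis using that[of z] wG by (simp add: z_def)
qed

lemma fci_power_inf:
  assumes x: "nonnormal_inf x" and y: "y \<in> carrier G" "y \<notin> T" "y \<otimes> x = x \<otimes> y"
  shows "\<exists>(k::int) (l::int). k \<noteq> 0 \<and> l \<noteq> 0 \<and> y [^] k = x [^] l"
proof -
  obtain N :: nat where N: "N > 0"
      "\<forall>y\<in>carrier G. y \<otimes> x = x \<otimes> y \<longrightarrow> (\<exists>k::int. y [^] N = x [^] k)"
    using fci_power[of x] x unfolding nonnormal_inf_def by blast
  then obtain l :: int where l: "y [^] int N = x [^] l" using y by (auto simp: int_pow_int)
  moreover have "l \<noteq> 0" using l inf_int_pow[OF y(1,2), of "int N"] N(1) subgroup.one_closed[OF subgroup_T] by auto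
  ultimately have "int N \<noteq> 0 \<and> l \<noteq> 0 \<and> y [^] int N = x [^] l" using N(1) by simp
  then show ?thesis by (intro exI)
qed

lemma int_pow_trans:
  assumes "x \<in> carrier G" "y \<in> carrier G" "z \<in> carrier G"
    and "x [^] (a::int) = y [^] (b::int)" "y [^] (c::int) = z [^] (d::int)"
  shows "x [^] (a * c) = z [^] (d * b)"
proof -
  have "x [^] (a * c) = (x [^] a) [^] c" using assms(1) by (rule int_pow_pow[symmetric])
  also have "\<dots> = (y [^] c) [^] b" unfolding assms(4) using assms(2) by (simp add: int_pow_pow mult.commute)
  also have "\<dots> = z [^] (d * b)" unfolding assms(5) using assms(3) by (rule int_pow_pow)
  finally show ?thesis .
qed

text \<open>The link z has a common power with x. If z is non-central, the FCI bound for z compares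
  it with y; if z is central and y is not, the bound for y compares them; if both are central, y
  commutes with x and the bound for x applies directly.\<close>

lemma commensurable:
  assumes x: "nonnormal_inf x" and y: "y \<in> carrier G" "y \<notin> T"
  shows "\<exists>(k::int) (l::int). k \<noteq> 0 \<and> l \<noteq> 0 \<and> y [^] k = x [^] l"
proof -
  have xG: "x \<in> carrier G" "x \<notin> T" using x by (simp_all add: nonnormal_inf_def)
  obtain z where z: "z \<in> carrier G" "z \<notin> T" "z \<otimes> x = x \<otimes> z" "z \<otimes> y = y \<otimes> z"
    using commuting_partner[OF xG y(1)] .
  obtain a b :: int where ab: "a \<noteq> 0" "b \<noteq> 0" "z [^] a = x [^] b" using fci_power_inf[OF x z(1-3)] by blast
  show ?thesis
  proof (cases "nonnormal_inf z")
    case True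
    then obtain c d :: int where cd: "c \<noteq> 0" "d \<noteq> 0" "y [^] c = z [^] d"
      using fci_power_inf[of z y] y z by metis
    then have "y [^] (c * a) = x [^] (b * d)" using int_pow_trans[OF y(1) z(1) xG(1)] ab by blast
    then have "c * a \<noteq> 0 \<and> b * d \<noteq> 0 \<and> y [^] (c * a) = x [^] (b * d)" using ab cd by simp
    then show ?thesis by (intro exI)
  next
    case False
    then have zc: "z \<otimes> g = g \<otimes> z" if "g \<in> carrier G" for g using nonnormal_infI[OF z(1,2) that] by metis
    show ?thesis
    proof (cases "nonnormal_inf y")
      case True
      then obtain c d :: int where cd: "c \<noteq> 0" "d \<noteq> 0" "z [^] c = y [^] d"
        using fci_power_inf[of y z] y z by metis
      then have "y [^] (d * a) = x [^] (b * c)" using int_pow_trans[OF y(1) z(1) xG(1), of d c a b] ab by simp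
      then have "d * a \<noteq> 0 \<and> b * c \<noteq> 0 \<and> y [^] (d * a) = x [^] (b * c)" using ab cd by simp
      then show ?thesis by (intro exI)
    next
      case False
      then have "y \<otimes> x = x \<otimes> y" using nonnormal_infI[OF y xG(1)] by metis
      then show ?thesis using fci_power_inf[OF x y] by blast
    qed
  qed
qed

text \<open>Two elements of infinite order both share a power with one fixed x, so some power of y
  is a power of g.\<close>

lemma power_commutes:
  assumes y: "y \<in> carrier G" and g: "g \<in> carrier G"
  obtains K :: nat where "K > 0" "y [^] K \<otimes> g = g \<otimes> y [^] K"
proof (cases "y \<in> T \<or> g \<in> T")
  case True
  then show thesis
  proof
    assume "y \<in> T"
    then obtain n :: nat where "n > 0" "y [^] n = \<one>" using T_iff by blast
    then show thesis using that[of n] g by simp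
  next
    assume "g \<in> T"
    then obtain n :: nat where "n > 0" "g [^] n = \<one>" using T_iff by blast
    then show thesis using torsion_commutes_with_power[OF ln g _ _ y] that by blast
  qed
next
  case False
  obtain x where x: "nonnormal_inf x" using ex_nonnormal_inf by blast
  have xG: "x \<in> carrier G" using x by (simp add: nonnormal_inf_def)
  obtain k l :: int where kl: "k \<noteq> 0" "l \<noteq> 0" "y [^] k = x [^] l" using commensurable[OF x y] False by blast
  obtain k' l' :: int where kl': "k' \<noteq> 0" "l' \<noteq> 0" "g [^] k' = x [^] l'" using commensurable[OF x g] False by blast
  have "y [^] (k * l') = g [^] (k' * l)" using int_pow_trans[OF y xG g kl(3) kl'(3)[symmetric]] .
  then have c: "y [^] (k * l') \<otimes> g = g \<otimes> y [^] (k * l')" using commute_int_pow[OF g g refl] by simp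
  define K where "K = nat \<bar>k * l'\<bar>"
  have "y [^] K \<otimes> g = g \<otimes> y [^] K"
  proof (cases "k * l' \<ge> 0")
    case True then show ?thesis using c by (simp add: K_def flip: int_pow_int)
  next
    case False
    then have "y [^] K = inv (y [^] (k * l'))" using y by (simp add: K_def flip: int_pow_int int_pow_neg)
    then show ?thesis using commute_inv[OF _ g c] y by simp
  qed
  moreover have "K > 0" using kl kl' by (simp add: K_def)
  ultimately show thesis by (rule that[rotated])
qed

text \<open>If the term after next lies in T, then so does the next one: its generators v = [u, h]
  commute with u and h modulo T, so v^K is [u, h^K] modulo T, which is trivial when h^K commutes
  with u. This is carried from the trivial end of the series up to the first commutators.\<close>

lemma commutator_in_T:
  assumes a: "a \<in> carrier G" and b: "b \<in> carrier G"
  shows "commutator G a b \<in> T"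
proof -
  define H where "H = generate G {a, b}"
  obtain L c where L: "L 0 = H" "L c = {\<one>}" "\<And>n. L n \<subseteq> H" "\<And>n. L (Suc n) \<subseteq> L n"
    "\<And>n a h. \<lbrakk>a \<in> L n; h \<in> H\<rbrakk> \<Longrightarrow> commutator G a h \<in> L (Suc n)"
    "\<And>n K. \<lbrakk>subgroup K G; \<And>a h. \<lbrakk>a \<in> L n; h \<in> H\<rbrakk> \<Longrightarrow> commutator G a h \<in> K\<rbrakk> \<Longrightarrow> L (Suc n) \<subseteq> K"
    using nilpotent_series[OF ln, of "{a, b}"] a b unfolding H_def
    by (metis empty_subsetI finite.emptyI finite.insertI insert_subset)
  have H: "subgroup H G" using a b by (simp add: H_def generate_is_subgroup)
  have ab: "a \<in> H" "b \<in> H" by (simp_all add: H_def generate.incl)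
  have "L (Suc n) \<subseteq> T \<Longrightarrow> L (Suc 0) \<subseteq> T" for n
  proof (induction n)
    case (Suc n)
    have "L (Suc n) \<subseteq> T"
    proof (rule L(6)[OF subgroup_T])
      fix u h assume u: "u \<in> L n" and h: "h \<in> H"
      have uG: "u \<in> carrier G" "u \<in> H" using u L(3) subgroup.subset[OF H] by blast+
      have hG: "h \<in> carrier G" using h subgroup.subset[OF H] by blast
      define v where "v = commutator G u h"
      have v: "v \<in> L (Suc n)" using L(5)[OF u h] by (simp add: v_def)
      have *: "commutator G v u \<in> T" "commutator G v h \<in> T" using L(5)[OF v] uG h Suc.prems by blast+
      obtain K :: nat where K: "K > 0" "h [^] K \<otimes> u = u \<otimes> h [^] K" using power_commutes[OF hG uG(1)] .
      then have "commutator G u (h [^] K) = \<one>"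
        using commute_iff_commutator[of u "h [^] K"] uG hG by simp
      then have "commutator G u (h [^] K) \<in> T" using subgroup.one_closed[OF subgroup_T] by simp
      then have "v [^] K \<in> T"
        using commutator_pow_mod_normal(1)[OF normal_T uG(1) hG, of K] * by (simp add: v_def)
      then have "v \<in> T" using torsion_of_pow[of v K] K(1) uG hG by (simp add: v_def)
      then show "commutator G u h \<in> T" by (simp add: v_def)
    qed
    then show ?case by (rule Suc.IH)
  qed simp
  moreover have "L (Suc c) \<subseteq> T" using L(2) L(4)[of c] subgroup.one_closed[OF subgroup_T] by auto
  ultimately have "L (Suc 0) \<subseteq> T" by blast
  then show ?thesis using L(5)[of a 0 b] L(1) ab by blast
qed

section \<open>The quotient by the torsion subgroup\<close>

lemma comm_mod_T: "comm_group (G Mod T)"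
proof -
  interpret N: normal T G by (rule normal_T)
  interpret Q: group "G Mod T" by (rule N.factorgroup_is_group)
  show ?thesis
  proof (rule Q.group_comm_groupI)
    fix A B assume "A \<in> carrier (G Mod T)" "B \<in> carrier (G Mod T)"
    then obtain a b where ab: "a \<in> carrier G" "b \<in> carrier G" "A = T #> a" "B = T #> b"
      by (auto simp: carrier_FactGroup)
    have "a \<otimes> b = commutator G a b \<otimes> (b \<otimes> a)" using ab by (simp add: grp_simps)
    then have "a \<otimes> b \<in> T #> (b \<otimes> a)" using commutator_in_T[OF ab(1,2)] by (auto simp: r_coset_def)
    then have "T #> (b \<otimes> a) = T #> (a \<otimes> b)"
      using ab subgroup_T by (intro repr_independence) simp_all
    then show "A \<otimes>\<^bsub>G Mod T\<^esub> B = B \<otimes>\<^bsub>G Mod T\<^esub> A"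
      using ab N.rcos_sum by simp
  qed
qed

lemma mod_T_hom: "group_hom G (G Mod T) (\<lambda>a. T #> a)"
  using normal.r_coset_hom_Mod[OF normal_T] is_group comm_group.axioms(2)[OF comm_mod_T]
  by (simp add: group_hom_def group_hom_axioms_def)

lemma mod_T_ker: "a \<in> carrier G \<Longrightarrow> T #> a = \<one>\<^bsub>G Mod T\<^esub> \<longleftrightarrow> a \<in> T"
  using subgroup.rcos_const[OF subgroup_T is_group] coset_join1[of T a] TG subgroup_T by auto

text \<open>
  Among \<open>c + 1\<close> conjugates \<open>y\<^sup>j x y\<^sup>-\<^sup>j\<close>, where \<open>c = |C\<^sub>T(x)|\<close>, two lie in the same orbit of \<open>T\<close>: all
  of them lie in \<open>x B\<close> for a finite \<open>B \<le> T\<close>, and each \<open>B\<close>-orbit has at least \<open>|B| / c\<close> elements.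
\<close>

lemma power_in_centralizer_T:
  assumes x: "nonnormal_inf x" and y: "y \<in> carrier G"
  obtains n s where "0 < (n::nat)" "n \<le> card {s \<in> T. s \<otimes> x = x \<otimes> s}" "s \<in> T" "(s \<otimes> y [^] n) \<otimes> x = x \<otimes> (s \<otimes> y [^] n)"
proof -
  have xG: "x \<in> carrier G" and xw: "x \<notin> T" "\<not> normal_cyc G x" using x by (simp_all add: nonnormal_inf_def)
  define E where "E = {s \<in> T. s \<otimes> x = x \<otimes> s}"
  define c where "c = card E"
  have finE: "finite E" unfolding E_def using finite_centralizer_T[OF xG xw] .
  define z where "z = (\<lambda>j::nat. y [^] j \<otimes> x \<otimes> inv (y [^] j))"
  have zG: "z j \<in> carrier G" for j using xG y by (simp add: z_def)
  \<comment> \<open>Generated by the finitely many torsion elements [x^-1, y^j], so finite; all the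
    conjugates z j considered lie in x B, and conjugation by B keeps them there.\<close>
  define B where "B = generate G ((\<lambda>j. inv x \<otimes> z j) ` {0..c})"
  have F: "(\<lambda>j. inv x \<otimes> z j) ` {0..c} \<subseteq> T"
  proof
    fix v assume "v \<in> (\<lambda>j. inv x \<otimes> z j) ` {0..c}"
    then obtain j where j: "v = inv x \<otimes> z j" by blast
    then have "v = commutator G (inv x) (y [^] j)" using xG y by (simp add: z_def m_assoc)
    then show "v \<in> T" using commutator_in_T[of "inv x" "y [^] j"] xG y by simp
  qed
  have B: "finite B" "B \<subseteq> T" unfolding B_def using torsion_generate[OF _ F] by simp_all
  have sB: "subgroup B G" unfolding B_def using F TG by (intro generate_is_subgroup) blast
  have BG: "B \<subseteq> carrier G" using B(2) TG by blast
  have zB: "inv x \<otimes> z j \<in> B" if "j \<le> c" for j unfolding B_def using that by (intro generate.incl) auto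
  define f where "f = (\<lambda>(j, b). b \<otimes> z j \<otimes> inv b)"
  have "f ` ({0..c} \<times> B) \<subseteq> (\<lambda>b. x \<otimes> b) ` B"
  proof clarify
    fix j b assume j: "j \<in> {0..c}" and b: "b \<in> B"
    have bG: "b \<in> carrier G" using b BG by blast
    have "inv x \<otimes> b \<otimes> inv (inv x) \<in> B" using normal_of_subset_T[OF sB B(2), of "inv x" b] xG b by simp
    then have "(inv x \<otimes> b \<otimes> inv (inv x)) \<otimes> (inv x \<otimes> z j) \<otimes> inv b \<in> B"
      using zB[of j] j b sB by (simp add: subgroup.m_closed subgroup.m_inv_closed)
    moreover have "f (j, b) = x \<otimes> ((inv x \<otimes> b \<otimes> inv (inv x)) \<otimes> (inv x \<otimes> z j) \<otimes> inv b)"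
      using xG bG zG[of j] by (simp add: f_def grp_simps)
    ultimately show "f (j, b) \<in> (\<lambda>b. x \<otimes> b) ` B" by blast
  qed
  \<comment> \<open>There are (c + 1)|B| pairs and at most |B| values, so some value is taken more
    than c times.\<close>
  moreover have "c * card ((\<lambda>b. x \<otimes> b) ` B) < card ({0..c} \<times> B)"
  proof -
    have "card B > 0" using B(1) subgroup.one_closed[OF sB] by (auto simp: card_gt_0_iff)
    moreover have "card ((\<lambda>b. x \<otimes> b) ` B) \<le> card B" using B(1) by (rule card_image_le)
    then have "c * card ((\<lambda>b. x \<otimes> b) ` B) \<le> c * card B" by (rule mult_le_mono2)
    moreover have "card ({0..c} \<times> B) = c * card B + card B" by (simp add: card_cartesian_product)
    ultimately show ?thesis by linarith
  qed
  ultimately have "\<exists>v\<in>(\<lambda>b. x \<otimes> b) ` B. c < card {a \<in> {0..c} \<times> B. f a = v}"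
    using B(1) by (intro large_fibre) simp_all
  then obtain v where v: "c < card {a \<in> {0..c} \<times> B. f a = v}" by blast
  define W where "W = {a \<in> {0..c} \<times> B. f a = v}"
  have "\<exists>a\<in>W. \<exists>a'\<in>W. fst a \<noteq> fst a'"
  proof (rule ccontr)
    assume "\<not> ?thesis"
    then have same: "fst a = fst a'" if "a \<in> W" "a' \<in> W" for a a' using that by blast
    have "card W > c" using v by (simp add: W_def)
    then have "W \<noteq> {}" by auto
    then obtain a0 where a0: "a0 \<in> W" by blast
    obtain j b0 where jb: "a0 = (j, b0)" by (metis surj_pair)
    have b0: "b0 \<in> B" "b0 \<in> carrier G" "j \<le> c" "b0 \<otimes> z j \<otimes> inv b0 = v"
      using a0 BG by (auto simp: W_def jb f_def)
    \<comment> \<open>For pairs with the same j and the same value, the quotient of the second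
      components centralises z j. Conjugating back by y^j carries it into the centralizer of x in T,
      which has only c elements, fewer than the fibre.\<close>
    define h where "h = (\<lambda>a :: nat \<times> 'a. inv (y [^] j) \<otimes> (inv b0 \<otimes> snd a) \<otimes> y [^] j)"
    have Wb: "snd a \<in> B" "snd a \<in> carrier G" "snd a \<otimes> z j \<otimes> inv (snd a) = v" "fst a = j" if "a \<in> W" for a
      using that same[OF that a0] BG by (auto simp: W_def jb f_def)
    have "h a \<in> E" if a: "a \<in> W" for a
    proof -
      note b = Wb[OF a]
      have r: "inv b0 \<otimes> snd a \<in> carrier G" using b b0 by simp
      have "(inv b0 \<otimes> snd a) \<otimes> z j \<otimes> inv (inv b0 \<otimes> snd a) = inv b0 \<otimes> (snd a \<otimes> z j \<otimes> inv (snd a)) \<otimes> b0"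
        using b(2) b0(2) zG[of j] by (simp add: grp_simps)
      also have "\<dots> = inv b0 \<otimes> (b0 \<otimes> z j \<otimes> inv b0) \<otimes> b0" unfolding b(3) b0(4) ..
      also have "\<dots> = z j" using b0(2) zG[of j] by (simp add: grp_simps)
      finally have 1: "(inv b0 \<otimes> snd a) \<otimes> z j = z j \<otimes> (inv b0 \<otimes> snd a)"
        using conj_eq_iff[OF r zG[of j] zG[of j]] by simp
      have "h a \<otimes> x = inv (y [^] j) \<otimes> ((inv b0 \<otimes> snd a) \<otimes> z j) \<otimes> y [^] j"
        using r xG y by (simp add: h_def z_def grp_simps)
      also have "\<dots> = x \<otimes> h a" unfolding 1 using r xG y by (simp add: h_def z_def grp_simps)
      finally have "h a \<otimes> x = x \<otimes> h a" .
      moreover have "h a \<in> T"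
      proof -
        have "inv b0 \<otimes> snd a \<in> T" using b0(1) b(1) sB B(2) by (meson subgroup.m_closed subgroup.m_inv_closed subsetD)
        then show ?thesis using conj_T[of "inv (y [^] j)" "inv b0 \<otimes> snd a"] y by (simp add: h_def)
      qed
      ultimately show ?thesis by (simp add: E_def)
    qed
    moreover have "inj_on h W"
    proof (rule inj_onI)
      fix a a' assume *: "a \<in> W" "a' \<in> W" "h a = h a'"
      have "snd a = snd a'"
        using *(3) Wb(2)[OF *(1)] Wb(2)[OF *(2)] b0(2) y by (simp add: h_def)
      then show "a = a'" using Wb(4)[OF *(1)] Wb(4)[OF *(2)] by (simp add: prod_eq_iff)
    qed
    ultimately have "card W \<le> c" unfolding c_def using finE by (intro card_inj_on_le) auto
    then show False using v by (simp add: W_def)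
  qed
  then obtain a a' where a: "a \<in> W" "a' \<in> W" "fst a < fst a'" by (metis linorder_neqE_nat)
  obtain i b j b' where ab: "a = (i, b)" "a' = (j, b')" by (metis surj_pair)
  have ij: "i < j" "j \<le> c" and b: "b \<in> B" "b' \<in> B" "b \<in> carrier G" "b' \<in> carrier G"
    and eq: "b \<otimes> z i \<otimes> inv b = b' \<otimes> z j \<otimes> inv b'"
    using a BG by (auto simp: W_def ab f_def)
  obtain n where n: "n > 0" "j = i + n" using less_imp_add_positive[OF ij(1)] by blast
  define u where "u = y [^] i"
  have u: "u \<in> carrier G" "y [^] j = u \<otimes> y [^] n" using y by (simp_all add: u_def n(2) nat_pow_mult)
  \<comment> \<open>The equality of the two conjugates, rewritten as conjugation of x by s y^n with
    n = j - i; the torsion part is carried to the left of y^n by conjugation with u.\<close>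
  define s where "s = inv u \<otimes> (inv b \<otimes> b') \<otimes> u"
  have s: "s \<in> T"
  proof -
    have "inv b \<otimes> b' \<in> T" using b sB B(2) by (meson subgroup.m_closed subgroup.m_inv_closed subsetD)
    then show ?thesis using conj_T[of "inv u" "inv b \<otimes> b'"] u by (simp add: s_def)
  qed
  have sG: "s \<in> carrier G" using s TG by blast
  have "(s \<otimes> y [^] n) \<otimes> x \<otimes> inv (s \<otimes> y [^] n) = inv u \<otimes> inv b \<otimes> (b' \<otimes> z j \<otimes> inv b') \<otimes> b \<otimes> u"
    using b u xG y by (simp add: s_def z_def grp_simps)
  also have "\<dots> = x" unfolding eq[symmetric] using b u xG y by (simp add: z_def grp_simps flip: u_def)
  finally have "(s \<otimes> y [^] n) \<otimes> x = x \<otimes> (s \<otimes> y [^] n)"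
    using conj_eq_iff[of "s \<otimes> y [^] n" x x] sG y xG by simp
  then show thesis using that[of n s] n ij s by (simp add: c_def E_def)
qed

text \<open>The quotient is torsion-free abelian and a fixed power of each element lies in the
  cyclic subgroup generated by x, so it is infinite cyclic; g is any preimage of a
  generator.\<close>

lemma cyclic_mod_T:
  obtains g where "g \<in> carrier G" "g \<notin> T" "\<And>y. y \<in> carrier G \<Longrightarrow> \<exists>q::int. \<exists>s\<in>T. y = g [^] q \<otimes> s"
proof -
  obtain x where x: "nonnormal_inf x" using ex_nonnormal_inf by blast
  have xG: "x \<in> carrier G" and xw: "x \<notin> T" "\<not> normal_cyc G x" using x by (simp_all add: nonnormal_inf_def)
  interpret Q: comm_group "G Mod T" by (rule comm_mod_T)
  interpret h: group_hom G "G Mod T" "\<lambda>a. T #> a" by (rule mod_T_hom)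
  define c where "c = card {s \<in> T. s \<otimes> x = x \<otimes> s}"
  obtain N :: nat where N: "N > 0"
      "\<forall>y\<in>carrier G. y \<otimes> x = x \<otimes> y \<longrightarrow> (\<exists>k::int. y [^] N = x [^] k)"
    using fci_power[OF xG xw(2)] by blast
  have cG: "carrier (G Mod T) = (\<lambda>a. T #> a) ` carrier G" by (rule carrier_FactGroup)
  have tf: "A = \<one>\<^bsub>G Mod T\<^esub>" if A: "A \<in> carrier (G Mod T)" "n > 0" "A [^]\<^bsub>G Mod T\<^esub> (n::nat) = \<one>\<^bsub>G Mod T\<^esub>" for A n
  proof -
    obtain a where a: "a \<in> carrier G" "A = T #> a" using A(1) cG by blast
    have "T #> (a [^] n) = \<one>\<^bsub>G Mod T\<^esub>" using A(3) a h.hom_nat_pow[OF a(1), of n] by simp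
    then have "a [^] n \<in> T" using mod_T_ker[of "a [^] n"] a by blast
    then have "a \<in> T" using torsion_of_pow[OF a(1) _ A(2)] by blast
    then show ?thesis using mod_T_ker a by simp
  qed
  \<comment> \<open>The n with s y^n in C(x) varies with y but is at most c, hence divides the
    factorial; N is the exponent from the FCI bound for x. Modulo T the factor s disappears.\<close>
  have pw: "\<exists>k::int. A [^]\<^bsub>G Mod T\<^esub> (fact c * N) = (T #> x) [^]\<^bsub>G Mod T\<^esub> k" if A: "A \<in> carrier (G Mod T)" for A
  proof -
    obtain y where y: "y \<in> carrier G" "A = T #> y" using A cG by blast
    obtain n s where n: "0 < (n::nat)" "n \<le> card {s \<in> T. s \<otimes> x = x \<otimes> s}"
      and s: "s \<in> T" "(s \<otimes> y [^] n) \<otimes> x = x \<otimes> (s \<otimes> y [^] n)"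
      using power_in_centralizer_T[OF x y(1)] .
    have sG: "s \<in> carrier G" using s TG by blast
    obtain k :: int where k: "(s \<otimes> y [^] n) [^] N = x [^] k" using N(2) s(2) sG y by blast
    have "T #> s = \<one>\<^bsub>G Mod T\<^esub>" using mod_T_ker sG s by simp
    then have "T #> (s \<otimes> y [^] n) = \<one>\<^bsub>G Mod T\<^esub> \<otimes>\<^bsub>G Mod T\<^esub> (A [^]\<^bsub>G Mod T\<^esub> n)"
      using h.hom_mult[OF sG nat_pow_closed[OF y(1), of n]] h.hom_nat_pow[OF y(1), of n] y(2) by metis
    then have "T #> (s \<otimes> y [^] n) = A [^]\<^bsub>G Mod T\<^esub> n"
      using Q.l_one[OF Q.nat_pow_closed[OF A, of n]] by metis
    then have e: "(A [^]\<^bsub>G Mod T\<^esub> n) [^]\<^bsub>G Mod T\<^esub> N = (T #> x) [^]\<^bsub>G Mod T\<^esub> k"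
      using h.hom_nat_pow[of "s \<otimes> y [^] n" N] h.hom_int_pow[OF xG, of k] k sG y by simp
    have "n dvd fact c" using n by (intro dvd_fact) (auto simp: c_def)
    then obtain q where q: "fact c = n * q" using dvdE by blast
    have "A [^]\<^bsub>G Mod T\<^esub> (fact c * N) = ((A [^]\<^bsub>G Mod T\<^esub> n) [^]\<^bsub>G Mod T\<^esub> N) [^]\<^bsub>G Mod T\<^esub> q"
      using A by (simp add: q Q.nat_pow_pow mult.commute mult.left_commute)
    also have "\<dots> = (T #> x) [^]\<^bsub>G Mod T\<^esub> (k * int q)"
      unfolding e using xG by (simp add: int_pow_int flip: Q.int_pow_pow)
    finally show ?thesis ..
  qed
  have "\<exists>A\<in>carrier (G Mod T). \<forall>B\<in>carrier (G Mod T). \<exists>q::int. B = A [^]\<^bsub>G Mod T\<^esub> q"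
  proof (rule Q.cyclic_of_bounded_rank_one)
    show "fact c * N > 0" using N(1) by simp
    show "T #> x \<in> carrier (G Mod T)" using xG cG by blast
  qed (fact tf pw)+
  then obtain A where A: "A \<in> carrier (G Mod T)"
      "\<forall>B\<in>carrier (G Mod T). \<exists>q::int. B = A [^]\<^bsub>G Mod T\<^esub> q" by blast
  obtain g where g: "g \<in> carrier G" "A = T #> g" using A(1) cG by blast
  have gen: "\<exists>q::int. \<exists>s\<in>T. y = g [^] q \<otimes> s" if y: "y \<in> carrier G" for y
  proof -
    have "T #> y \<in> carrier (G Mod T)" using y cG by blast
    then obtain q :: int where q: "T #> y = A [^]\<^bsub>G Mod T\<^esub> q" using bspec[OF A(2)] by blast
    define s where "s = inv (g [^] q) \<otimes> y"
    have sG: "s \<in> carrier G" using g y by (simp add: s_def)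
    have gq: "T #> (g [^] q) = A [^]\<^bsub>G Mod T\<^esub> q" using h.hom_int_pow[OF g(1), of q] g by simp
    have "T #> s = inv\<^bsub>G Mod T\<^esub> (T #> (g [^] q)) \<otimes>\<^bsub>G Mod T\<^esub> (T #> y)"
      unfolding s_def using g y by (simp only: h.hom_mult h.hom_inv int_pow_closed inv_closed)
    also have "\<dots> = \<one>\<^bsub>G Mod T\<^esub>"
      unfolding gq q by (rule Q.l_inv[OF Q.int_pow_closed[OF A(1)]])
    finally have "s \<in> T" using mod_T_ker[OF sG] by blast
    moreover have "y = g [^] q \<otimes> s" using g y by (simp add: s_def inv_cancel_left)
    ultimately show ?thesis by blast
  qed
  have "g \<notin> T"
  proof
    assume gT: "g \<in> T"
    obtain q :: int and s where "s \<in> T" "x = g [^] q \<otimes> s" using gen[OF xG] by blast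
    then have "x \<in> T" using subgroup_T subgroup_int_pow_closed[OF subgroup_T gT] by (simp add: subgroup.m_closed)
    then show False using xw by blast
  qed
  then show thesis using that g(1) gen by blast
qed

end

section \<open>The torsion subgroup and the action of a generator\<close>

context nonperiodic_fci begin

lemma dedekind_T: "dedekind (G\<lparr>carrier := T\<rparr>)"
  using dedekind_subgroup[OF subgroup_T torsion_normal_cyc] .

interpretation D: dedekind "G\<lparr>carrier := T\<rparr>" by (rule dedekind_T)

abbreviation "D \<equiv> G\<lparr>carrier := T\<rparr>"

definition "P p = p_part D p"

lemma P_iff: "x \<in> P p \<longleftrightarrow> x \<in> T \<and> (\<exists>n::nat. x [^] (p ^ n) = \<one>)"
  by (simp add: P_def p_part_def flip: nat_pow_consistent)

lemma PT: "P p \<subseteq> T" by (auto simp: P_iff)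

lemma subgroup_P_D: "subgroup (P p) D"
  unfolding P_def by (rule D.subgroup_p_part)

lemma subgroup_P: "subgroup (P p) G"
  using incl_subgroup[OF subgroup_T subgroup_P_D] .

lemma P_upd: "D\<lparr>carrier := P p\<rparr> = G\<lparr>carrier := P p\<rparr>"
  by simp

lemma sylow_P: "Factorial_Ring.prime p \<Longrightarrow> sylow_component D p = G\<lparr>carrier := P p\<rparr>"
  using D.sylow_component_eq unfolding P_def by simp

lemma ord_D: "x \<in> T \<Longrightarrow> D.ord x = ord x"
  by (rule ord_consistent[OF subgroup_T])

lemma ord_T_pos: "x \<in> T \<Longrightarrow> ord x > 0"
  using T_iff ord_le_pow_eq_one(1) by blast

lemma pi_prime: "p \<in> prime_divisors D \<Longrightarrow> Factorial_Ring.prime p"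
  by (simp add: prime_divisors_def)

lemma pi_elem:
  assumes p: "p \<in> prime_divisors D"
  obtains z where "z \<in> P p" "z \<noteq> \<one>" "z [^] p = \<one>" "ord z = p"
proof -
  obtain x where x: "x \<in> T" "p dvd ord x" using p ord_D by (auto simp: prime_divisors_def)
  have xG: "x \<in> carrier G" using x(1) TG by blast
  obtain m where m: "ord x = p * m" using x(2) dvdE by blast
  have pp: "p > 1" using pi_prime[OF p] prime_gt_1_nat by blast
  have m0: "m \<noteq> 0" using m ord_T_pos[OF x(1)] by (intro notI) simp
  define z where "z = x [^] m"
  have zT: "z \<in> T" unfolding z_def
    using subgroup_int_pow_closed[OF subgroup_T x(1), of "int m"] by (simp add: int_pow_int)
  have oz: "ord z = p" unfolding z_def using xG m m0 by (subst ord_pow) simp_all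
  have zG: "z \<in> carrier G" using zT TG by blast
  have zp: "z [^] p = \<one>" using pow_ord_eq_1[OF zG] oz by simp
  moreover have "z \<noteq> \<one>" using oz pp by auto
  moreover have "z \<in> P p" using zT zp by (auto simp: P_iff intro!: exI[of _ 1])
  ultimately show thesis using that oz by blast
qed

text \<open>The conjugation exponent l satisfies p | (l - 1)^n, hence l is 1 modulo p.\<close>

lemma prime_order_central_G:
  assumes p: "Factorial_Ring.prime (p::nat)" and z: "z \<in> T" "z [^] p = \<one>" and g: "g \<in> carrier G"
  shows "g \<otimes> z = z \<otimes> g"
proof (cases "z = \<one>")
  case False
  have zG: "z \<in> carrier G" using z TG by blast
  have oz: "ord z = p" using prime_divisorsI(2)[OF p zG z(2) False] .
  obtain l :: int where l: "g \<otimes> z \<otimes> inv g = z [^] l"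
    using torsion_normal_cyc[OF z(1)] g unfolding normal_cyc_def by blast
  obtain n where "z [^] ((l - 1) ^ n) = \<one>" using power_conj_unipotent[OF ln g zG l] .
  then have "int p dvd (l - 1) ^ n" using int_pow_eq_id[OF zG] oz by simp
  then have "int p dvd l - 1" using p by (metis prime_dvd_power prime_nat_int_transfer)
  then have "z [^] (l - 1) = \<one>" using int_pow_eq_id[OF zG] oz by simp
  then have "z [^] l = z" using zG by (simp add: int_pow_diff) (metis int_pow_closed inv_equality inv_inv inv_closed)
  then show ?thesis using l conj_eq_iff[OF g zG zG] by simp
qed (use g in simp)

lemma finite_socle:
  assumes p: "Factorial_Ring.prime (p::nat)"
  shows "finite {z \<in> T. z [^] p = \<one>}"
proof -
  obtain x where x: "nonnormal_inf x" using ex_nonnormal_inf by blast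
  have "{z \<in> T. z [^] p = \<one>} \<subseteq> {s \<in> T. s \<otimes> x = x \<otimes> s}"
    using prime_order_central_G[OF p] x by (auto simp: nonnormal_inf_def)
  then show ?thesis using finite_centralizer_T x finite_subset unfolding nonnormal_inf_def by blast
qed

lemma finite_pi: "finite (prime_divisors D)"
proof -
  obtain x where x: "nonnormal_inf x" using ex_nonnormal_inf by blast
  have "prime_divisors D \<subseteq> ord ` {s \<in> T. s \<otimes> x = x \<otimes> s}"
  proof
    fix p assume p: "p \<in> prime_divisors D"
    obtain z where z: "z \<in> P p" "z [^] p = \<one>" "ord z = p" using pi_elem[OF p] .
    then have "z \<in> T" using PT by blast
    then have "z \<otimes> x = x \<otimes> z"
      using prime_order_central_G[OF pi_prime[OF p] _ z(2)] x by (simp add: nonnormal_inf_def)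
    then show "p \<in> ord ` {s \<in> T. s \<otimes> x = x \<otimes> s}" using \<open>z \<in> T\<close> z(3) by blast
  qed
  then show ?thesis using finite_centralizer_T x finite_surj unfolding nonnormal_inf_def by blast
qed

text \<open>Here finiteness comes from the finite set of solutions of z^2 = 1, which contains the
  exponent-2 subgroup C; finite rank of this component is deduced from it afterwards.\<close>

lemma P_nonabelian:
  assumes p: "Factorial_Ring.prime (p::nat)" and nc: "\<not> comm_group (G\<lparr>carrier := P p\<rparr>)"
  shows "p = 2" "finite (P p)"
    "\<lbrakk>f \<in> hom (G\<lparr>carrier := P p\<rparr>) (G\<lparr>carrier := P p\<rparr>);
       \<And>x. x \<in> P p \<Longrightarrow> \<exists>k::int. f x = x [^] k;
       \<And>x. x \<in> P p \<Longrightarrow> f x = \<one> \<Longrightarrow> x = \<one>\<rbrakk>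
      \<Longrightarrow> \<exists>q\<in>P p. \<forall>d\<in>P p. f d = q \<otimes> d \<otimes> inv q"
proof -
  have nc': "\<not> comm_group (D\<lparr>carrier := p_part D p\<rparr>)" using nc by (simp add: P_def)
  note * = D.p_part_nonabelian[OF p nc', folded P_def, unfolded P_upd]
  show "p = 2" using * by metis
  show "finite (P p)"
  proof (rule *)
    fix C assume C: "subgroup C (G\<lparr>carrier := P p\<rparr>)" "\<And>w. w \<in> C \<Longrightarrow> w [^]\<^bsub>D\<^esub> (2::nat) = \<one>\<^bsub>D\<^esub>"
      "finite C \<Longrightarrow> finite (P p)"
    have "C \<subseteq> {z \<in> T. z [^] (2::nat) = \<one>}"
      using C(2) subgroup.subset[OF C(1)] PT by (auto simp flip: nat_pow_consistent)
    then show "finite (P p)" using finite_socle[OF two_is_prime_nat] C(3) finite_subset by blast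
  qed
  assume f: "f \<in> hom (G\<lparr>carrier := P p\<rparr>) (G\<lparr>carrier := P p\<rparr>)"
       "\<And>x. x \<in> P p \<Longrightarrow> \<exists>k::int. f x = x [^] k"
       "\<And>x. x \<in> P p \<Longrightarrow> f x = \<one> \<Longrightarrow> x = \<one>"
  have "\<exists>k::int. f x = x [^]\<^bsub>D\<^esub> k" if x: "x \<in> P p" for x
  proof -
    obtain k :: int where "f x = x [^] k" using f(2)[OF x] by blast
    moreover have "x \<in> T" using x PT by blast
    ultimately show ?thesis using int_pow_consistent[OF subgroup_T, of x k] by metis
  qed
  then have "\<exists>q\<in>P p. \<forall>d\<in>P p. f d = q \<otimes>\<^bsub>D\<^esub> d \<otimes>\<^bsub>D\<^esub> inv\<^bsub>D\<^esub> q"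
    using f by (rule_tac *) simp_all
  then show "\<exists>q\<in>P p. \<forall>d\<in>P p. f d = q \<otimes> d \<otimes> inv q"
    using m_inv_consistent[OF subgroup_T] PT by (auto simp: subset_iff)
qed

lemma P_rank:
  assumes p: "Factorial_Ring.prime (p::nat)"
  shows "finite_rank (G\<lparr>carrier := P p\<rparr>)"
proof (cases "comm_group (G\<lparr>carrier := P p\<rparr>)")
  case True
  then interpret C: comm_group "G\<lparr>carrier := P p\<rparr>" .
  show ?thesis
  proof (rule C.finite_rank_of_finite_socle[OF p])
    show "\<exists>n. x [^]\<^bsub>G\<lparr>carrier := P p\<rparr>\<^esub> (p ^ n) = \<one>\<^bsub>G\<lparr>carrier := P p\<rparr>\<^esub>"
      if "x \<in> carrier (G\<lparr>carrier := P p\<rparr>)" for x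
      using that P_iff by (simp flip: nat_pow_consistent)
    have "{z \<in> P p. z [^] p = \<one>} \<subseteq> {z \<in> T. z [^] p = \<one>}" using PT by blast
    then show "finite {z \<in> carrier (G\<lparr>carrier := P p\<rparr>).
        z [^]\<^bsub>G\<lparr>carrier := P p\<rparr>\<^esub> p = \<one>\<^bsub>G\<lparr>carrier := P p\<rparr>\<^esub>}"
      using finite_socle[OF p] finite_subset by (auto simp flip: nat_pow_consistent)
  qed
next
  case False
  then have "finite (P p)" by (rule P_nonabelian(2)[OF p])
  then show ?thesis unfolding finite_rank_def
    by (intro exI[of _ "card (P p)"] allI impI) (auto intro!: card_mono)
qed

text \<open>Conjugation by the inverse of g is a power automorphism of the non-abelian 2-component,
  hence inner there, given by some q. Then g q centralises that component, and it has the same image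
  as g modulo T.\<close>

lemma exists_generator:
  obtains g where "g \<in> carrier G" "g \<notin> T" "\<And>y. y \<in> carrier G \<Longrightarrow> \<exists>q::int. \<exists>s\<in>T. y = g [^] q \<otimes> s"
    "\<And>d. \<not> comm_group (G\<lparr>carrier := P 2\<rparr>) \<Longrightarrow> d \<in> P 2 \<Longrightarrow> g \<otimes> d = d \<otimes> g"
proof -
  obtain g where g: "g \<in> carrier G" "g \<notin> T"
    and gen: "\<And>y. y \<in> carrier G \<Longrightarrow> \<exists>q::int. \<exists>s\<in>T. y = g [^] q \<otimes> s"
    using cyclic_mod_T by metis
  show thesis
  proof (cases "comm_group (G\<lparr>carrier := P 2\<rparr>)")
    case True
    then show thesis using that[OF g gen] by blast
  next
    case False
    let ?H = "G\<lparr>carrier := P 2\<rparr>"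
    define f where "f = (\<lambda>d. inv g \<otimes> d \<otimes> inv (inv g))"
    have PG: "d \<in> carrier G" if "d \<in> P 2" for d using that PT TG by blast
    have fP: "f d \<in> P 2" if "d \<in> P 2" for d
      unfolding f_def by (rule normal_of_subset_T[OF subgroup_P PT inv_closed[OF g(1)] that])
    have 1: "f \<in> hom ?H ?H"
      using fP PG conj_mult[of "inv g"] g by (auto simp: hom_def f_def simp del: m_assoc)
    have 2: "\<exists>k::int. f d = d [^] k" if "d \<in> P 2" for d
      using torsion_normal_cyc[of d] PT that g unfolding normal_cyc_def f_def by blast
    have 3: "d = \<one>" if "d \<in> P 2" "f d = \<one>" for d
      using that PG[OF that(1)] g conj_eq_iff[of "inv g" d \<one>] by (simp add: f_def)
    obtain q where q: "q \<in> P 2" "\<And>d. d \<in> P 2 \<Longrightarrow> f d = q \<otimes> d \<otimes> inv q"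
      using P_nonabelian(3)[OF two_is_prime_nat False 1 2 3] by blast
    have qG: "q \<in> carrier G" and qT: "q \<in> T" using q(1) PG PT by blast+
    define g' where "g' = g \<otimes> q"
    have g'G: "g' \<in> carrier G" using g qG by (simp add: g'_def)
    have comm: "g' \<otimes> d = d \<otimes> g'" if d: "d \<in> P 2" for d
    proof -
      have "d \<otimes> g' = g \<otimes> f d \<otimes> q" using g qG PG[OF d] by (simp add: g'_def f_def grp_simps)
      also have "\<dots> = g' \<otimes> d" unfolding q(2)[OF d] using g qG PG[OF d] by (simp add: g'_def grp_simps)
      finally show ?thesis by simp
    qed
    interpret Q: comm_group "G Mod T" by (rule comm_mod_T)
    interpret h: group_hom G "G Mod T" "\<lambda>a. T #> a" by (rule mod_T_hom)
    have "T #> g' = (T #> g) \<otimes>\<^bsub>G Mod T\<^esub> (T #> q)" unfolding g'_def using g(1) qG by (rule h.hom_mult)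
    also have "T #> q = \<one>\<^bsub>G Mod T\<^esub>" using mod_T_ker qG qT by blast
    also have "(T #> g) \<otimes>\<^bsub>G Mod T\<^esub> \<one>\<^bsub>G Mod T\<^esub> = T #> g" using g(1) by (intro Q.r_one h.hom_closed)
    finally have gg: "T #> g' = T #> g" .
    have gen': "\<exists>k::int. \<exists>s\<in>T. y = g' [^] k \<otimes> s" if y: "y \<in> carrier G" for y
    proof -
      obtain k :: int and s where ks: "s \<in> T" "y = g [^] k \<otimes> s" using gen[OF y] by blast
      define u where "u = inv (g' [^] k) \<otimes> g [^] k"
      have uG: "u \<in> carrier G" using g'G g by (simp add: u_def)
      have "T #> u = inv\<^bsub>G Mod T\<^esub> (T #> (g' [^] k)) \<otimes>\<^bsub>G Mod T\<^esub> (T #> (g [^] k))"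
        unfolding u_def using g(1) g'G by (simp only: h.hom_mult h.hom_inv int_pow_closed inv_closed)
      also have "T #> (g' [^] k) = T #> (g [^] k)"
        using h.hom_int_pow[OF g(1), of k] h.hom_int_pow[OF g'G, of k] gg by metis
      also have "inv\<^bsub>G Mod T\<^esub> (T #> (g [^] k)) \<otimes>\<^bsub>G Mod T\<^esub> (T #> (g [^] k)) = \<one>\<^bsub>G Mod T\<^esub>"
        using g(1) by (intro Q.l_inv h.hom_closed) simp
      finally have "u \<in> T" using mod_T_ker[OF uG] by blast
      then have "u \<otimes> s \<in> T" using ks(1) subgroup_T by (simp add: subgroup.m_closed)
      moreover have "s \<in> carrier G" using ks(1) TG by blast
      then have "y = g' [^] k \<otimes> (u \<otimes> s)" using ks(2) g g'G by (simp add: u_def grp_simps)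
      ultimately show ?thesis by blast
    qed
    have "g' \<notin> T"
    proof
      assume "g' \<in> T"
      then have "g' \<otimes> inv q \<in> T" using qT subgroup_T by (simp add: subgroup.m_closed subgroup.m_inv_closed)
      then show False using g qG by (simp add: g'_def m_assoc)
    qed
    then show thesis using that[of g'] g'G gen' comm by blast
  qed
qed

end

section \<open>The power automorphism induced by a generator modulo torsion\<close>

locale nonperiodic_fci_generator = nonperiodic_fci +
  fixes g
  assumes g: "g \<in> carrier G" "g \<notin> T"
    and gen: "y \<in> carrier G \<Longrightarrow> \<exists>q::int. \<exists>s\<in>T. y = g [^] q \<otimes> s"
    and g2: "\<not> comm_group (G\<lparr>carrier := P 2\<rparr>) \<Longrightarrow> d \<in> P 2 \<Longrightarrow> g \<otimes> d = d \<otimes> g"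
begin

interpretation D: dedekind "G\<lparr>carrier := T\<rparr>" by (rule dedekind_T)

text \<open>The direction of conjugation matches \<open>cyclic_semidirect\<close>; the restriction
  to T makes the map extensional, as membership in \<open>auto\<close> requires.\<close>

definition "\<phi> = (\<lambda>d\<in>T. inv g \<otimes> d \<otimes> g)"

lemma phi_eq: "d \<in> T \<Longrightarrow> \<phi> d = inv g \<otimes> d \<otimes> inv (inv g)"
  using g by (simp add: \<phi>_def)

lemma phi_in: "d \<in> T \<Longrightarrow> \<phi> d \<in> T"
  using conj_T[of "inv g" d] g by (simp add: phi_eq)

lemma phi_power: "d \<in> T \<Longrightarrow> \<exists>k::int. \<phi> d = d [^] k"
proof -
  assume d: "d \<in> T"
  have "\<exists>k::int. inv g \<otimes> d \<otimes> inv (inv g) = d [^] k"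
    using torsion_normal_cyc[OF d] inv_closed[OF g(1)] unfolding normal_cyc_def by blast
  then show ?thesis by (simp only: phi_eq[OF d])
qed

lemma phi_mult: "d \<in> T \<Longrightarrow> e \<in> T \<Longrightarrow> \<phi> (d \<otimes> e) = \<phi> d \<otimes> \<phi> e"
  using conj_mult[of "inv g" d e] g TG subgroup.m_closed[OF subgroup_T, of d e]
  by (simp add: phi_eq subset_iff del: m_assoc inv_inv)

lemma phi_inj: "d \<in> T \<Longrightarrow> e \<in> T \<Longrightarrow> \<phi> d = \<phi> e \<Longrightarrow> d = e"
  using g TG by (auto simp: phi_eq subset_iff)

lemma phi_one_iff: "d \<in> T \<Longrightarrow> \<phi> d = \<one> \<Longrightarrow> d = \<one>"
  using g TG conj_eq_iff[of "inv g" d \<one>] by (auto simp: phi_eq subset_iff simp del: inv_inv)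

lemma phi_fix_iff: "d \<in> T \<Longrightarrow> \<phi> d = d \<longleftrightarrow> g \<otimes> d = d \<otimes> g"
proof -
  assume "d \<in> T"
  then have d: "d \<in> carrier G" "d \<in> T" using TG by blast+
  have "\<phi> d = d \<longleftrightarrow> inv g \<otimes> d = d \<otimes> inv g"
    using conj_eq_iff[of "inv g" d d] d g by (simp add: phi_eq)
  also have "\<dots> \<longleftrightarrow> g \<otimes> d = d \<otimes> g"
    using commute_inv[of g d] commute_inv[of "inv g" d] d g by auto
  finally show ?thesis .
qed

lemma power_automorphism_phi: "power_automorphism D \<phi>"
  unfolding power_automorphism_def auto_def
proof (intro conjI ballI IntI)
  show "\<phi> \<in> hom D D" using phi_in phi_mult by (simp add: hom_def)
  have "bij_betw \<phi> T T"
  proof (rule bij_betw_imageI)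
    show "inj_on \<phi> T" using phi_inj by (rule inj_onI)
    show "\<phi> ` T = T"
    proof
      show "T \<subseteq> \<phi> ` T"
      proof
        fix d assume d: "d \<in> T"
        have "d = \<phi> (g \<otimes> d \<otimes> inv g)"
          using conj_T[OF g(1) d] TG d g(1) by (simp add: phi_eq subset_iff grp_simps)
        then show "d \<in> \<phi> ` T" using conj_T[OF g(1) d] by blast
      qed
    qed (use phi_in in blast)
  qed
  then show "\<phi> \<in> Bij (carrier D)" by (simp add: Bij_def \<phi>_def)
  show "\<exists>k::int. \<phi> x = x [^]\<^bsub>D\<^esub> k" if "x \<in> carrier D" for x
    using phi_power[of x] that int_pow_consistent[OF subgroup_T, of x] by simp
qed

lemma exponent_exists:
  assumes p: "p \<in> prime_divisors D" and c: "comm_group (G\<lparr>carrier := P p\<rparr>)"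
  shows "\<exists>t. is_exponent (G\<lparr>carrier := P p\<rparr>) p (restrict \<phi> (P p)) t"
proof -
  let ?H = "G\<lparr>carrier := P p\<rparr>"
  interpret C: comm_group ?H by (rule c)
  obtain z where z: "z \<in> P p" "z \<noteq> \<one>" "z [^] p = \<one>" using pi_elem[OF p] by metis
  have fP: "\<phi> d \<in> P p" if "d \<in> P p" for d
  proof -
    have "d \<in> T" using that PT by blast
    then show ?thesis
      using normal_of_subset_T[OF subgroup_P PT inv_closed[OF g(1)] that] by (simp only: phi_eq)
  qed
  have f1: "\<exists>n. x [^]\<^bsub>?H\<^esub> (p ^ n) = \<one>\<^bsub>?H\<^esub>" if "x \<in> carrier ?H" for x
    using that P_iff by (simp flip: nat_pow_consistent)
  have f2: "restrict \<phi> (P p) \<in> hom ?H ?H"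
    using fP phi_mult PT subgroup.m_closed[OF subgroup_P] by (auto simp: hom_def subset_iff)
  have f3: "\<exists>k::int. restrict \<phi> (P p) x = x [^]\<^bsub>?H\<^esub> k" if "x \<in> carrier ?H" for x
    using that phi_power[of x] PT int_pow_consistent[OF subgroup_P, of x p] by auto
  have f4: "x = \<one>\<^bsub>?H\<^esub>" if "x \<in> carrier ?H" "restrict \<phi> (P p) x = \<one>\<^bsub>?H\<^esub>" for x
    using that phi_one_iff[of x] PT by auto
  have f5: "z \<in> carrier ?H" "z \<noteq> \<one>\<^bsub>?H\<^esub>" "z [^]\<^bsub>?H\<^esub> p = \<one>\<^bsub>?H\<^esub>"
    using z by (simp_all flip: nat_pow_consistent)
  show ?thesis
    by (rule C.power_automorphism_exponent[OF pi_prime[OF p] f1 f2 f3 f4 f5]) blast+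
qed

text \<open>A value is chosen because on a component of finite exponent only a residue of the
  exponent is determined.\<close>

definition "t p = (SOME u. is_exponent (G\<lparr>carrier := P p\<rparr>) p (restrict \<phi> (P p)) u)"

context
  fixes p
  assumes p: "p \<in> prime_divisors D" and c: "comm_group (G\<lparr>carrier := P p\<rparr>)"
begin

lemma t_exponent: "is_exponent (G\<lparr>carrier := P p\<rparr>) p (restrict \<phi> (P p)) (t p)"
  unfolding t_def using exponent_exists[OF p c] by (rule someI_ex)

lemma t_carrier: "t p \<in> carrier (padic_ring p)"
  using t_exponent by (simp add: is_exponent_def Units_def)

lemma phi_t:
  assumes d: "d \<in> P p" "ord d = p ^ n"
  shows "\<phi> d = d [^] t p n"
proof -
  have "multiplicity p (ord d) = n"
    using d pi_prime[OF p] not_prime_unit[of p] by (auto simp: multiplicity_same_power)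
  then show ?thesis
    using t_exponent d int_pow_consistent[OF subgroup_P d(1)]
    by (auto simp: is_exponent_def padic_pow_def ord_consistent[OF subgroup_P d(1)])
qed

text \<open>Elements of order p are central in G, so the automorphism fixes them.\<close>

lemma t_one: "t p 1 = 1"
proof -
  obtain z where z: "z \<in> P p" "z \<noteq> \<one>" "z [^] p = \<one>" "ord z = p" using pi_elem[OF p] .
  have zT: "z \<in> T" "z \<in> carrier G" using z PT TG by blast+
  have pp: "p > 1" using pi_prime[OF p] prime_gt_1_nat by blast
  have "\<phi> z = z" using prime_order_central_G[OF pi_prime[OF p] zT(1) z(3) g(1)] phi_fix_iff zT by simp
  then have "z [^] t p 1 = z" using phi_t[OF z(1), of 1] z(4) by simp
  then have "z [^] (t p 1 - 1) = \<one>" using zT by (simp add: int_pow_diff)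
  then have "int p dvd t p 1 - 1" using int_pow_eq_id[OF zT(2)] z(4) by simp
  then have "t p 1 mod int p = 1 mod int p" by (simp add: mod_eq_dvd_iff)
  moreover have "0 \<le> t p 1" "t p 1 < int p" using t_carrier by (auto simp: padic_ring_def dest: spec[of _ 1])
  ultimately show ?thesis using pp by simp
qed

lemma P_commute_T:
  assumes "d \<in> P p" "s \<in> T"
  shows "s \<otimes> d = d \<otimes> s"
proof -
  have cm: "x \<otimes> y = y \<otimes> x" if "x \<in> P p" "y \<in> P p" for x y
    using c comm_group_carrier_iff[OF subgroup_P] that by blast
  have "D.ord x > 0" if "x \<in> carrier D" for x using that ord_D ord_T_pos by simp
  from D.p_part_commute_of_commute[OF this pi_prime[OF p], folded P_def] cm
  show ?thesis using assms by simp
qed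

text \<open>Turns an exponent that is an ordinary integer into a genuine power map; it is needed for
  1 and -1.\<close>

lemma t_pow_eq:
  assumes d: "d \<in> P p" and u: "\<And>n. t p n = u mod int p ^ n"
  shows "\<phi> d = d [^] u"
proof -
  have dG: "d \<in> carrier G" using d PT TG by blast
  obtain n where n: "ord d = p ^ n"
    using d ord_prime_power_iff[OF pi_prime[OF p] dG] by (auto simp: P_iff)
  have "d [^] (p ^ n) = \<one>" using pow_ord_eq_1[OF dG] n by simp
  then show ?thesis using phi_t[OF d n] int_pow_mod[OF dG, of "p ^ n" u] by (simp add: u)
qed

text \<open>Otherwise g centralises the component, and so does T, since an abelian component is
  central in T. Thus every element of G centralises it, against the finiteness of C_T(x).\<close>

lemma t_neq_one:
  assumes inf: "infinite (P p)"
  shows "t p \<noteq> \<one>\<^bsub>padic_ring p\<^esub>"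
proof
  assume t1: "t p = \<one>\<^bsub>padic_ring p\<^esub>"
  have gd: "g \<otimes> d = d \<otimes> g" if d: "d \<in> P p" for d
  proof -
    have dT: "d \<in> T" "d \<in> carrier G" using d PT TG by blast+
    have "\<phi> d = d [^] (1::int)" by (rule t_pow_eq[OF d]) (simp add: t1 padic_ring_def)
    then show ?thesis using phi_fix_iff dT by simp
  qed
  obtain x where x: "nonnormal_inf x" using ex_nonnormal_inf by blast
  then obtain q :: int and s where qs: "s \<in> T" "x = g [^] q \<otimes> s" using gen unfolding nonnormal_inf_def by blast
  have "P p \<subseteq> {s \<in> T. s \<otimes> x = x \<otimes> s}"
  proof
    fix d assume d: "d \<in> P p"
    have dT: "d \<in> T" "d \<in> carrier G" "s \<in> carrier G" using d PT TG qs(1) by blast+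
    have "g [^] q \<otimes> d = d \<otimes> g [^] q" using commute_int_pow[OF g(1) dT(2) gd[OF d]] .
    then have "x \<otimes> d = d \<otimes> x"
      unfolding qs(2) using commute_mult[of "g [^] q" s d] P_commute_T[OF d qs(1)] g dT by simp
    then show "d \<in> {s \<in> T. s \<otimes> x = x \<otimes> s}" using dT by simp
  qed
  moreover have "finite {s \<in> T. s \<otimes> x = x \<otimes> s}" using finite_centralizer_T x unfolding nonnormal_inf_def by blast
  ultimately show False using inf finite_subset by blast
qed

text \<open>Otherwise the square of g centralises the component, and so does x = g^2 d for d in it.
  The infinite centralizer forces x to be central; then d commutes with g and is therefore equal to
  its inverse, contrary to its choice.\<close>

lemma t_neq_minus_one:
  assumes p2: "p = 2" and inf: "infinite (P p)"
  shows "t p \<noteq> \<ominus>\<^bsub>padic_ring p\<^esub> \<one>\<^bsub>padic_ring p\<^esub>"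
proof
  assume t1: "t p = \<ominus>\<^bsub>padic_ring p\<^esub> \<one>\<^bsub>padic_ring p\<^esub>"
  have tn: "t p = (\<lambda>n. (- 1) mod int p ^ n)"
    unfolding t1 by (rule padic_uminus_one) (simp add: p2)
  have inv: "\<phi> d = inv d" if d: "d \<in> P p" for d
  proof -
    have dG: "d \<in> carrier G" using d PT TG by blast
    have "\<phi> d = d [^] (- 1 :: int)" by (rule t_pow_eq[OF d]) (simp only: tn)
    then show ?thesis using dG by (simp add: int_pow_neg)
  qed
  have "finite {z \<in> T. z [^] (2::nat) = \<one>}" by (rule finite_socle[OF two_is_prime_nat])
  then have "\<not> P p \<subseteq> {z \<in> T. z [^] (2::nat) = \<one>}" using inf finite_subset by blast
  then obtain d where d: "d \<in> P p" "d [^] (2::nat) \<noteq> \<one>" using PT by blast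
  have dG: "d \<in> carrier G" "d \<in> T" using d PT TG by blast+
  \<comment> \<open>The square of g alone could be central in G, where FCI gives no bound. The
    factor d, whose square is not 1, keeps x from commuting with g.\<close>
  define x where "x = g \<otimes> g \<otimes> d"
  have xG: "x \<in> carrier G" using g dG by (simp add: x_def)
  have "x \<notin> T"
  proof
    assume "x \<in> T"
    then have "x \<otimes> inv d \<in> T" using dG subgroup_T by (simp add: subgroup.m_closed subgroup.m_inv_closed)
    then have "g [^] (2::nat) \<in> T" using g dG by (simp add: x_def m_assoc numeral_2_eq_2)
    then show False using torsion_of_pow[OF g(1), of 2] g(2) by simp
  qed
  have "e \<otimes> x = x \<otimes> e" if e: "e \<in> P p" for e
  proof -
    have eG: "e \<in> carrier G" "e \<in> T" using e PT TG by blast+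
    have ee: "inv e \<in> P p" using subgroup.m_inv_closed[OF subgroup_P e] .
    have "\<phi> (\<phi> e) = e" using inv[OF e] inv[OF ee] eG by simp
    then have "inv g \<otimes> (inv g \<otimes> e \<otimes> g) \<otimes> g = e" using eG g phi_in[OF eG(2)] by (simp add: phi_eq)
    then have "(g \<otimes> g) \<otimes> e = (g \<otimes> g) \<otimes> (inv g \<otimes> (inv g \<otimes> e \<otimes> g) \<otimes> g)" by simp
    also have "\<dots> = e \<otimes> (g \<otimes> g)" using eG g by (simp add: grp_simps)
    finally have "(g \<otimes> g) \<otimes> e = e \<otimes> (g \<otimes> g)" .
    moreover have "d \<otimes> e = e \<otimes> d" using P_commute_T[OF e dG(2)] .
    ultimately show ?thesis unfolding x_def using commute_mult[of "g \<otimes> g" d e] g dG eG by simp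
  qed
  then have "P p \<subseteq> {s \<in> T. s \<otimes> x = x \<otimes> s}" using PT by blast
  then have "infinite {s \<in> T. s \<otimes> x = x \<otimes> s}" using inf finite_subset by blast
  then have "\<not> nonnormal_inf x" using finite_centralizer_T unfolding nonnormal_inf_def by blast
  then have "g \<otimes> x = x \<otimes> g" using nonnormal_infI[OF xG \<open>x \<notin> T\<close> g(1)] by blast
  then have "g \<otimes> d = d \<otimes> g" using g dG by (simp add: x_def m_assoc)
  then have "inv d = d" using phi_fix_iff[OF dG(2)] inv[OF d(1)] by simp
  then have "d \<otimes> d = \<one>" using dG by (metis r_inv)
  then show False using d(2) dG by (simp add: numeral_2_eq_2)
qed

end

section \<open>The datum of the torsion subgroup and the isomorphism\<close>

lemma fci_datum_D: "fci_datum D \<phi> t"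
  unfolding fci_datum_def
proof (intro conjI ballI impI)
  show "periodic D"
    unfolding periodic_def using D.is_group T_iff by (simp flip: nat_pow_consistent)
  show "dedekind_group D" using dedekind_T dedekind_group_iff by blast
  show "finite (prime_divisors D)" by (rule finite_pi)
  show "finite_rank (sylow_component D p)" if "p \<in> prime_divisors D" for p
    using P_rank pi_prime[OF that] sylow_P by simp
  show "power_automorphism D \<phi>" by (rule power_automorphism_phi)
  show "is_exponent (sylow_component D p) p (restrict \<phi> (carrier (sylow_component D p))) (t p)"
    if "p \<in> prime_divisors D" "comm_group (sylow_component D p)" for p
    using t_exponent[OF that(1)] that(2) sylow_P[OF pi_prime[OF that(1)]] by simp
  show "\<phi> x = x" if "2 \<in> prime_divisors D \<and> \<not> comm_group (sylow_component D 2)"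
    "x \<in> carrier (sylow_component D 2)" for x
    using that sylow_P[OF two_is_prime_nat] g2[of x] phi_fix_iff[of x] PT by auto
  fix p assume p: "p \<in> prime_divisors D" "2 < p"
  note pp = pi_prime[OF p(1)]
  have c: "comm_group (G\<lparr>carrier := P p\<rparr>)" using P_nonabelian(1)[OF pp] p(2) by auto
  show "([p] \<cdot>\<^bsub>padic_ring p\<^esub> \<one>\<^bsub>padic_ring p\<^esub>) divides\<^bsub>padic_ring p\<^esub>
      (t p \<ominus>\<^bsub>padic_ring p\<^esub> \<one>\<^bsub>padic_ring p\<^esub>)"
    using padic_dvd_minus_one_iff[of p "t p"] t_carrier[OF p(1) c] t_one[OF p(1) c] p(2) by simp
  show "t p \<noteq> \<one>\<^bsub>padic_ring p\<^esub>" if "infinite (carrier (sylow_component D p))"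
    using that t_neq_one[OF p(1) c] sylow_P[OF pp] by simp
next
  assume a: "2 \<in> prime_divisors D \<and> infinite (carrier (sylow_component D 2))"
  then have p: "2 \<in> prime_divisors D" and inf: "infinite (P 2)" using sylow_P[OF two_is_prime_nat] by simp_all
  have c: "comm_group (G\<lparr>carrier := P 2\<rparr>)" using P_nonabelian(2)[OF two_is_prime_nat] inf by blast
  show "t 2 \<noteq> \<one>\<^bsub>padic_ring 2\<^esub>" by (rule t_neq_one[OF p c inf])
  show "t 2 \<noteq> \<ominus>\<^bsub>padic_ring 2\<^esub> \<one>\<^bsub>padic_ring 2\<^esub>" by (rule t_neq_minus_one[OF p c refl inf])
qed

text \<open>The map sends (m, d) to g^m d. It is multiplicative because conjugation by g^k realises
  the k-th power of the automorphism, injective because <g> meets T trivially, and surjective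
  because g generates G modulo T.\<close>

lemma iso_semidirect: "G \<cong> cyclic_semidirect D \<phi>"
proof -
  interpret F: fci_data D \<phi> t by unfold_locales (rule fci_datum_D)
  have nat: "F.\<Phi> (int n) d = inv (g [^] n) \<otimes> d \<otimes> g [^] n" if d: "d \<in> T" for n d
  proof (induction n)
    case 0
    then show ?case using d TG by (simp add: subset_iff)
  next
    case (Suc n)
    have dG: "d \<in> carrier G" using d TG by blast
    have c: "F.\<Phi> (int n) (\<phi> d) = inv (g [^] n) \<otimes> \<phi> d \<otimes> g [^] n" if "\<And>e. e \<in> T \<Longrightarrow> F.\<Phi> (int n) e = inv (g [^] n) \<otimes> e \<otimes> g [^] n"
      using that phi_in[OF d] by blast
    have "F.\<Phi> (int (Suc n)) d = F.\<Phi> 1 (F.\<Phi> (int n) d)"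
      using F.Phi_add[of d 1 "int n"] d by simp
    also have "\<dots> = inv g \<otimes> (inv (g [^] n) \<otimes> d \<otimes> g [^] n) \<otimes> g"
      using Suc d conj_T[of "inv (g [^] n)" d] g by (simp add: F.Phi_1 phi_eq)
    also have "\<dots> = inv (g [^] Suc n) \<otimes> d \<otimes> g [^] Suc n"
      using g dG by (simp add: grp_simps)
    finally show ?case .
  qed
  have Phi: "F.\<Phi> k d = inv (g [^] k) \<otimes> d \<otimes> g [^] k" if d: "d \<in> T" for k :: int and d
  proof (cases "k \<ge> 0")
    case True
    then show ?thesis using nat[OF d, of "nat k"] by (simp flip: int_pow_int)
  next
    case False
    have dG: "d \<in> carrier G" using d TG by blast
    define e where "e = inv (g [^] k) \<otimes> d \<otimes> g [^] k"
    have e: "e \<in> T" using conj_T[of "inv (g [^] k)" d] g d by (simp add: e_def)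
    have "F.\<Phi> (- k) e = inv (g [^] (- k)) \<otimes> e \<otimes> g [^] (- k)"
      using nat[OF e, of "nat (- k)"] False by (simp flip: int_pow_int)
    also have "\<dots> = d" using g dG by (simp add: e_def int_pow_neg grp_simps)
    finally have "F.\<Phi> k d = e" using F.Phi_minus(2)[of e k] e by simp
    then show ?thesis by (simp add: e_def)
  qed
  define \<psi> where "\<psi> = (\<lambda>(m::int, d). g [^] m \<otimes> d)"
  have "\<psi> \<in> iso F.G G"
  proof (rule isoI)
    show "\<psi> \<in> hom F.G G"
    proof (rule homI)
      fix a assume "a \<in> carrier F.G"
      then show "\<psi> a \<in> carrier G" using g TG by (auto simp: F.carrier_G \<psi>_def)
    next
      fix a b assume "a \<in> carrier F.G" "b \<in> carrier F.G"
      moreover obtain m d n e where ab: "a = (m, d)" "b = (n, e)" by (metis surj_pair)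
      ultimately have de: "d \<in> T" "e \<in> T" "d \<in> carrier G" "e \<in> carrier G" using TG by (auto simp: F.carrier_G)
      have "\<psi> (a \<otimes>\<^bsub>F.G\<^esub> b) = g [^] (m + n) \<otimes> (inv (g [^] n) \<otimes> d \<otimes> g [^] n \<otimes> e)"
        by (simp add: ab F.mult_G \<psi>_def Phi[OF de(1)])
      also have "\<dots> = g [^] m \<otimes> d \<otimes> (g [^] n \<otimes> e)"
        using g de by (simp add: int_pow_mult grp_simps)
      finally show "\<psi> (a \<otimes>\<^bsub>F.G\<^esub> b) = \<psi> a \<otimes> \<psi> b" by (simp add: ab \<psi>_def)
    qed
    show "bij_betw \<psi> (carrier F.G) (carrier G)"
    proof (rule bij_betw_imageI)
      show "inj_on \<psi> (carrier F.G)"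
      proof (rule inj_onI)
        fix a b assume "a \<in> carrier F.G" "b \<in> carrier F.G" and eq: "\<psi> a = \<psi> b"
        moreover obtain m d n e where ab: "a = (m, d)" "b = (n, e)" by (metis surj_pair)
        ultimately have de: "d \<in> T" "e \<in> T" "d \<in> carrier G" "e \<in> carrier G" using TG by (auto simp: F.carrier_G)
        have eq': "g [^] m \<otimes> d = g [^] n \<otimes> e" using eq by (simp add: ab \<psi>_def)
        have "g [^] (m - n) = inv (g [^] n) \<otimes> (g [^] m \<otimes> d) \<otimes> inv d"
          using g de by (simp add: grp_simps add.commute[of "- n"] flip: int_pow_neg int_pow_mult)
        also have "\<dots> = e \<otimes> inv d" unfolding eq' using g de by (simp add: grp_simps)
        also have "\<dots> \<in> T" using de subgroup_T by (simp add: subgroup.m_closed subgroup.m_inv_closed)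
        finally have "m - n = 0" using inf_int_pow[OF g] by blast
        then show "a = b" using eq' g de by (simp add: ab)
      qed
      show "\<psi> ` carrier F.G = carrier G"
      proof
        show "\<psi> ` carrier F.G \<subseteq> carrier G" using g TG by (auto simp: F.carrier_G \<psi>_def)
        show "carrier G \<subseteq> \<psi> ` carrier F.G"
        proof
          fix y assume "y \<in> carrier G"
          then obtain q :: int and s where "s \<in> T" "y = g [^] q \<otimes> s" using gen by blast
          then show "y \<in> \<psi> ` carrier F.G" by (auto simp: F.carrier_G \<psi>_def intro!: image_eqI[of _ _ "(q, s)"])
        qed
      qed
    qed
  qed
  then have "F.G \<cong> G" by (rule is_isoI)
  then have "G \<cong> F.G" by (rule group.iso_sym[OF F.group_G])
  then show ?thesis by (simp add: F.G_def)
qed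

end

theorem theorem3p7:
  fixes D :: "('a, 'b) monoid_scheme" and G :: "('c, 'd) monoid_scheme"
  shows "(\<forall>\<phi> t. fci_datum D \<phi> t \<longrightarrow>
            locally_nilpotent_group (cyclic_semidirect D \<phi>) \<and>
            fci_group (cyclic_semidirect D \<phi>)) \<and>
         (group G \<and> \<not> periodic G \<and> locally_nilpotent_group G \<and> fci_group G \<longrightarrow>
            comm_group G \<or>
            (subgroup (torsion_elements G) G \<and>
             (\<exists>\<phi> t. fci_datum (G\<lparr>carrier := torsion_elements G\<rparr>) \<phi> t \<and>
                G \<cong> cyclic_semidirect (G\<lparr>carrier := torsion_elements G\<rparr>) \<phi>)))"
proof (intro conjI allI impI)
  show "locally_nilpotent_group (cyclic_semidirect D \<phi>)" "fci_group (cyclic_semidirect D \<phi>)"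
    if "fci_datum D \<phi> t" for \<phi> t
    using fci_datum_imp[OF that] by simp_all
  assume G: "group G \<and> \<not> periodic G \<and> locally_nilpotent_group G \<and> fci_group G"
  show "comm_group G \<or>
            (subgroup (torsion_elements G) G \<and>
             (\<exists>\<phi> t. fci_datum (G\<lparr>carrier := torsion_elements G\<rparr>) \<phi> t \<and>
                G \<cong> cyclic_semidirect (G\<lparr>carrier := torsion_elements G\<rparr>) \<phi>))"
  proof (cases "comm_group G")
    case nonab: False
    interpret nonperiodic_fci G
      using G nonab by (simp add: nonperiodic_fci_def nonperiodic_fci_axioms_def)
    obtain g where g: "g \<in> carrier G" "g \<notin> T"
      "\<And>y. y \<in> carrier G \<Longrightarrow> \<exists>q::int. \<exists>s\<in>T. y = g [^]\<^bsub>G\<^esub> q \<otimes>\<^bsub>G\<^esub> s"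
      "\<And>d. \<not> comm_group (G\<lparr>carrier := P 2\<rparr>) \<Longrightarrow> d \<in> P 2 \<Longrightarrow> g \<otimes>\<^bsub>G\<^esub> d = d \<otimes>\<^bsub>G\<^esub> g"
      using exists_generator by metis
    interpret nonperiodic_fci_generator G g by unfold_locales (fact g)+
    show ?thesis
      using subgroup_T fci_datum_D iso_semidirect unfolding T_def by blast
  qed simp
qed

end
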